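(* Let $\{x,y\}$ be a two-sided basis of $V$, let $\{{}^*x,{}^*y\}$ be a dual basis in ${}^*V$, and let $\{{}^{**}x,{}^{**}y\}$ be a dual basis of that in ${}^{**}V$. If $V$ is non-simple, then $A_gV\cong A_g$ as left $A_g$-modules, and in fact $A_gV$ is freely generated by $y$. If $V$ is simple, then there is a presentation of left $A_g$-modules $$A_g^{\oplus2}\xrightarrow{\begin{pmatrix}g_{-2}^{-1}\,{}^{**}x\,{}^*x&g_{-2}^{-1}\,{}^{**}x\,{}^*y\\ g_{-2}^{-1}\,{}^{**}y\,{}^*x&g_{-2}^{-1}\,{}^{**}y\,{}^*y\end{pmatrix}}A_g^{\oplus2}\xrightarrow{\begin{pmatrix} x \\ y \end{pmatrix}}A_gV\to0$$ (elements of $A_g^{\oplus2}$ are row vectors and the maps are right multiplication by the matrices).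
   Context: $K_0,K_1$ are fields of characteristic $\neq 2$ and $V$ is a $K_0$-$K_1$-bimodule of rank two: $\dim_{K_0}V=\dim V_{K_1}=2$. For $i\in\mathbb{Z}$ put $K_i=K_0$ if $i$ is even, $K_i=K_1$ if $i$ is odd. For fields $L,M$ and an $L$-$M$-bimodule $W$, the right dual $W^*=\operatorname{Hom}_M(W_M,M)$ and left dual ${}^*W=\operatorname{Hom}_L({}_LW,L)$ are $M$-$L$-bimodules via $(a\psi b)(v)=a\psi(bv)$, respectively $(a\phi b)(v)=b\phi(va)$. Put $V^{0*}=V$, $V^{i*}=(V^{(i-1)*})^*$ for $i>0$, $V^{i*}={}^*(V^{(i+1)*})$ for $i<0$; $V^{i*}$ is a $K_i$-$K_{i+1}$-bimodule of rank two, and $V^{(i+1)*}$ is canonically the right dual of $V^{i*}$ for every $i$. A $\mathbb{Z}$-indexed algebra $D$ consists of abelian groups $D_{ij}$ ($i,j\in\mathbb{Z}$) with associative biadditive multiplications $D_{ij}\times D_{jl}\to D_{il}$ and units $e_i\in D_{ii}$. Let $T$ be the tensor $\mathbb{Z}$-indexed algebra: $T_{ij}=0$ for $i>j$, $T_{ii}=K_i$, $T_{ij}=V^{i*}\otimes_{K_{i+1}}\cdots\otimes_{K_{j-1}}V^{(j-1)*}$ for $i<j$. Let $Q_i\subset V^{i*}\otimes V^{(i+1)*}\cong\operatorname{End}_{K_{i+1}}(V^{i*})$ be the image of $K_i$ acting by left multiplication; it is generated by $\sum_s x_s\otimes x_s^*$ for any right basis $\{x_s\}$ of $V^{i*}$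 with dual basis $\{x_s^*\}$. The non-commutative symmetric algebra is $A=\mathbb{S}^{nc}(V)=T/R$, where $R$ is the ideal generated by all $Q_i$. The family $g=\{g_i\}$, $g_i\in A_{i,i+\delta}$, is defined as follows. (a) $V$ simple: there are a field $F$ and embeddings $\iota_j:K_j\to F$ with $[F:\iota_j(K_j)]=2$ ($j=0,1$) such that $V\cong{}_0F_1$, i.e. $F$ with left action via $\iota_0$ and right action via $\iota_1$; ${}_1F_0$ is $F$ with left action via $\iota_1$ and right action via $\iota_0$. With $\sigma_j$ the generator of $\operatorname{Gal}(F/\iota_j(K_j))$ and $\operatorname{tr}_j(a)=\iota_j^{-1}(\frac12(a+\sigma_j(a)))$, the maps $a\mapsto[b\mapsto\operatorname{tr}_1(ba)]$ and $a\mapsto[b\mapsto\operatorname{tr}_0(ba)]$ identify ${}_0F_1^*={}_1F_0$ and ${}_1F_0^*={}_0F_1$, so $V^{i*}={}_0F_1$ for $i$ even and ${}_1F_0$ for $i$ odd. Choose $w_j\in F$ with $w_j^2\in\iota_j(K_j)$ and $w_j\notin\iota_0(K_0)\cup\iota_1(K_1)$. Then $\delta=2$ and $g_i$ is the image of $w_1\otimes1+1\otimes w_1\in F\otimes_{K_1}F$ for $i$ even and of $w_0\otimes1+1\otimes w_0\in F\otimes_{K_0}F$ for $i$ odd. (b) $V$ non-simple: one identifies $K_0=K_1=K$ and $V=K^2$ with usual left action and right action $v\cdot a=v\,\phi(a)$ (row vectors), with $\phi(a)=\begin{pmatrix}\sigma(a)&0\\0&\tau(a)\end{pmatrix}$,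 $\sigma,\tau\in\operatorname{Aut}K$, or $\phi(a)=\begin{pmatrix}\sigma(a)&\eta(a)\\0&\sigma(a)\end{pmatrix}$, $\sigma\in\operatorname{Aut}K$, $\eta$ a $(\sigma,\sigma)$-derivation. Put $u_0=(1,0)$, $v_0=(0,1)$ and let $\{u_{i+1},v_{i+1}\}\subset V^{(i+1)*}$ be the basis dual to $\{u_i,v_i\}\subset V^{i*}$ for all $i\in\mathbb{Z}$. Then $\delta=1$ and $g_i=v_i$ for $i$ even, $g_i=u_i$ for $i$ odd. The family $g$ is normal: $g_iA_{i+\delta,j+\delta}=A_{ij}g_j$ for all $i,j$. $A[g^{-1}]$ is the $\mathbb{Z}$-indexed algebra obtained from $A$ by inverting all $g_i$; $A_g:=A[g^{-1}]_{00}$ and $A_gV:=A[g^{-1}]_{01}$, a left $A_g$-module (the multiplication map $A_g\otimes_{K_0}V\to A[g^{-1}]_{01}$ is surjective). A two-sided basis of a bimodule is a simultaneous left and right basis. Here $V=A_{01}$, ${}^*V=V^{(-1)*}=A_{-1,0}$ and ${}^{**}V=V^{(-2)*}=A_{-2,-1}$; the dual basis $\{{}^*x,{}^*y\}$ of $\{x,y\}$ in ${}^*V$ is such that ${}^*x\otimes x+{}^*y\otimes y$ generates $Q_{-1}$, and $\{{}^{**}x,{}^{**}y\}$ is obtained from $\{{}^*x,{}^*y\}$ in the same way. In the simple case $g_{-2}^{-1}\in A[g^{-1}]_{0,-2}$, so the matrix entries lie in $A_g$.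
   Formalization: For V non-simple, "freely generated by y" is stated only for y a left K_0-multiple of v_0 = g_0 (false otherwise, e.g. y = u_0); for V simple, the dual basis {**x,**y} is additionally assumed to be a two-sided basis of **V (exactness fails otherwise). *)

theory Defs
  imports "HOL-Algebra.Module" "HOL-Algebra.QuotRing" "HOL-Algebra.Embedded_Algebras"
    "HOL-Algebra.Free_Abelian_Groups"
begin

text \<open>
  Fields are HOL-Algebra rings, and all carriers are explicit.  Objects indexed by \<open>\<int>\<close> that only
  depend on the parity of the index are written with \<open>alt\<close>: \<open>K\<^sub>i = alt K0 K1 i\<close>.
\<close>

definition alt :: "'x \<Rightarrow> 'x \<Rightarrow> int \<Rightarrow> 'x" where
  "alt p q i = (if even i then p else q)"


section \<open>Bimodules over fields, bases and duals\<close>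

text \<open>
  The ring multiplication and unit that the record inherits from \<open>ring\<close> via \<open>module\<close> play no role.
\<close>

record ('k, 'v) bimod = "('k, 'v) module" +
  rsmult :: "'v \<Rightarrow> 'k \<Rightarrow> 'v"

text \<open>Over commutative rings, a right module is a left module for the flipped action.\<close>

abbreviation right_module :: "('k, 'v) bimod \<Rightarrow> ('k, 'v) bimod" where
  "right_module M \<equiv> M\<lparr>smult := \<lambda>a v. rsmult M v a\<rparr>"

definition bimodule :: "'k ring \<Rightarrow> 'k ring \<Rightarrow> ('k, 'v) bimod \<Rightarrow> bool" where
  "bimodule L M W \<longleftrightarrow> module L W \<and> module M (right_module W) \<and>
     (\<forall>a\<in>carrier L. \<forall>v\<in>carrier W. \<forall>b\<in>carrier M.
        rsmult W (smult W a v) b = smult W a (rsmult W v b))"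

definition simple_bimodule :: "'k ring \<Rightarrow> 'k ring \<Rightarrow> ('k, 'v) bimod \<Rightarrow> bool" where
  "simple_bimodule L M W \<longleftrightarrow> bimodule L M W \<and> carrier W \<noteq> {\<zero>\<^bsub>W\<^esub>} \<and>
     (\<forall>U. submodule U L W \<and> submodule U M (right_module W) \<longrightarrow> U = {\<zero>\<^bsub>W\<^esub>} \<or> U = carrier W)"

definition left_basis :: "'k ring \<Rightarrow> ('k, 'v) bimod \<Rightarrow> 'v \<Rightarrow> 'v \<Rightarrow> bool" where
  "left_basis L W x y \<longleftrightarrow> x \<in> carrier W \<and> y \<in> carrier W \<and>
     (\<forall>v\<in>carrier W. \<exists>!(a, b). a \<in> carrier L \<and> b \<in> carrier L \<and>
        v = smult W a x \<oplus>\<^bsub>W\<^esub> smult W b y)"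

definition right_basis :: "'k ring \<Rightarrow> ('k, 'v) bimod \<Rightarrow> 'v \<Rightarrow> 'v \<Rightarrow> bool" where
  "right_basis M W x y \<longleftrightarrow> left_basis M (right_module W) x y"

definition rank_two_bimodule :: "'k ring \<Rightarrow> 'k ring \<Rightarrow> ('k, 'v) bimod \<Rightarrow> bool" where
  "rank_two_bimodule L M W \<longleftrightarrow> bimodule L M W \<and>
     (\<exists>x y. left_basis L W x y) \<and> (\<exists>x y. right_basis M W x y)"

definition two_sided_basis :: "'k ring \<Rightarrow> 'k ring \<Rightarrow> ('k, 'v) bimod \<Rightarrow> 'v \<Rightarrow> 'v \<Rightarrow> bool" where
  "two_sided_basis L M W x y \<longleftrightarrow> left_basis L W x y \<and> right_basis M W x y"

definition bimod_iso :: "'k ring \<Rightarrow> 'k ring \<Rightarrow> ('k, 'v) bimod \<Rightarrow> ('k, 'w) bimod \<Rightarrow> ('v \<Rightarrow> 'w) set" where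
  "bimod_iso L M V W = {f. bij_betw f (carrier V) (carrier W) \<and>
     (\<forall>v\<in>carrier V. \<forall>w\<in>carrier V. f (v \<oplus>\<^bsub>V\<^esub> w) = f v \<oplus>\<^bsub>W\<^esub> f w) \<and>
     (\<forall>a\<in>carrier L. \<forall>v\<in>carrier V. f (smult V a v) = smult W a (f v)) \<and>
     (\<forall>v\<in>carrier V. \<forall>b\<in>carrier M. f (rsmult V v b) = rsmult W (f v) b)}"

text \<open>
  For an \<open>L\<close>-\<open>M\<close>-bimodule \<open>W\<close>, the right dual consists of the right \<open>M\<close>-linear maps \<open>W \<rightarrow> M\<close> and the
  left dual of the left \<open>L\<close>-linear maps \<open>W \<rightarrow> L\<close>.  Both are \<open>M\<close>-\<open>L\<close>-bimodules.
\<close>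

definition right_dual :: "'k ring \<Rightarrow> 'k ring \<Rightarrow> ('k, 'v) bimod \<Rightarrow> ('k, 'v \<Rightarrow> 'k) bimod" where
  "right_dual L M W =
    \<lparr>carrier = {\<psi> \<in> carrier W \<rightarrow>\<^sub>E carrier M.
        (\<forall>v\<in>carrier W. \<forall>w\<in>carrier W. \<psi> (v \<oplus>\<^bsub>W\<^esub> w) = \<psi> v \<oplus>\<^bsub>M\<^esub> \<psi> w) \<and>
        (\<forall>v\<in>carrier W. \<forall>b\<in>carrier M. \<psi> (rsmult W v b) = \<psi> v \<otimes>\<^bsub>M\<^esub> b)},
     monoid.mult = undefined, monoid.one = undefined,
     ring.zero = (\<lambda>v\<in>carrier W. \<zero>\<^bsub>M\<^esub>),
     ring.add = (\<lambda>\<psi> \<chi>. \<lambda>v\<in>carrier W. \<psi> v \<oplus>\<^bsub>M\<^esub> \<chi> v),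
     smult = (\<lambda>a \<psi>. \<lambda>v\<in>carrier W. a \<otimes>\<^bsub>M\<^esub> \<psi> v),
     rsmult = (\<lambda>\<psi> b. \<lambda>v\<in>carrier W. \<psi> (smult W b v))\<rparr>"

definition left_dual :: "'k ring \<Rightarrow> 'k ring \<Rightarrow> ('k, 'v) bimod \<Rightarrow> ('k, 'v \<Rightarrow> 'k) bimod" where
  "left_dual L M W =
    \<lparr>carrier = {\<phi> \<in> carrier W \<rightarrow>\<^sub>E carrier L.
        (\<forall>v\<in>carrier W. \<forall>w\<in>carrier W. \<phi> (v \<oplus>\<^bsub>W\<^esub> w) = \<phi> v \<oplus>\<^bsub>L\<^esub> \<phi> w) \<and>
        (\<forall>a\<in>carrier L. \<forall>v\<in>carrier W. \<phi> (smult W a v) = a \<otimes>\<^bsub>L\<^esub> \<phi> v)},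
     monoid.mult = undefined, monoid.one = undefined,
     ring.zero = (\<lambda>v\<in>carrier W. \<zero>\<^bsub>L\<^esub>),
     ring.add = (\<lambda>\<phi> \<chi>. \<lambda>v\<in>carrier W. \<phi> v \<oplus>\<^bsub>L\<^esub> \<chi> v),
     smult = (\<lambda>a \<phi>. \<lambda>v\<in>carrier W. \<phi> (rsmult W v a)),
     rsmult = (\<lambda>\<phi> b. \<lambda>v\<in>carrier W. b \<otimes>\<^bsub>L\<^esub> \<phi> v)\<rparr>"

text \<open>
  The iterated duals \<open>W i = V\<^sup>i\<^sup>*\<close> cannot literally be iterated function spaces, because the type would
  depend on \<open>i\<close>.  A dual system is the family of iterated duals together with the evaluation pairings:
  for \<open>i \<ge> 0\<close> the pairing \<open>ev i\<close> identifies \<open>W (i + 1)\<close> with the right dual of \<open>W i\<close>, and for \<open>i < 0\<close> it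
  identifies \<open>W i\<close> with the left dual of \<open>W (i + 1)\<close>.  In either case \<open>ev i \<psi> v\<close> is the value at
  \<open>v \<in> W i\<close> of \<open>\<psi> \<in> W (i + 1)\<close>, regarded as an element of the right dual of \<open>W i\<close>.
\<close>

locale dual_system =
  fixes K0 K1 :: "'k ring"
    and V :: "('k, 'v) bimod"
    and W :: "int \<Rightarrow> ('k, 'v) bimod"
    and ev :: "int \<Rightarrow> 'v \<Rightarrow> 'v \<Rightarrow> 'k"
  assumes start: "W 0 = V"
    and bimod: "\<And>i. bimodule (alt K0 K1 i) (alt K0 K1 (i + 1)) (W i)"
    and right: "\<And>i. 0 \<le> i \<Longrightarrow> (\<lambda>\<psi>. \<lambda>v\<in>carrier (W i). ev i \<psi> v)
        \<in> bimod_iso (alt K0 K1 (i + 1)) (alt K0 K1 i)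
            (W (i + 1)) (right_dual (alt K0 K1 i) (alt K0 K1 (i + 1)) (W i))"
    and left: "\<And>i. i < 0 \<Longrightarrow> (\<lambda>\<phi>. \<lambda>v\<in>carrier (W (i + 1)). ev i v \<phi>)
        \<in> bimod_iso (alt K0 K1 i) (alt K0 K1 (i + 1))
            (W i) (left_dual (alt K0 K1 (i + 1)) (alt K0 K1 i) (W (i + 1)))"

text \<open>\<open>{x', y'}\<close> in \<open>W (i + 1)\<close> is the basis dual to the right basis \<open>{x, y}\<close> of \<open>W i\<close>.\<close>

definition dual_bases ::
    "(int \<Rightarrow> 'k ring) \<Rightarrow> (int \<Rightarrow> ('k, 'v) bimod) \<Rightarrow> (int \<Rightarrow> 'v \<Rightarrow> 'v \<Rightarrow> 'k)
       \<Rightarrow> int \<Rightarrow> 'v \<Rightarrow> 'v \<Rightarrow> 'v \<Rightarrow> 'v \<Rightarrow> bool" where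
  "dual_bases K W ev i x y x' y' \<longleftrightarrow>
     right_basis (K (i + 1)) (W i) x y \<and> x' \<in> carrier (W (i + 1)) \<and> y' \<in> carrier (W (i + 1)) \<and>
     ev i x' x = \<one>\<^bsub>K (i + 1)\<^esub> \<and> ev i x' y = \<zero>\<^bsub>K (i + 1)\<^esub> \<and>
     ev i y' x = \<zero>\<^bsub>K (i + 1)\<^esub> \<and> ev i y' y = \<one>\<^bsub>K (i + 1)\<^esub>"


section \<open>\<open>\<int>\<close>-indexed algebras\<close>

text \<open>
  The abelian group \<open>D\<^sub>i\<^sub>j\<close> is \<open>zgrp D i j\<close>, a HOL-Algebra group whose group operation \<open>mult\<close> is the
  addition of \<open>D\<^sub>i\<^sub>j\<close>; the multiplication \<open>D\<^sub>i\<^sub>j \<times> D\<^sub>j\<^sub>l \<rightarrow> D\<^sub>i\<^sub>l\<close> is \<open>zmult D i j l\<close>.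
\<close>

record 'a zalg =
  zgrp :: "int \<Rightarrow> int \<Rightarrow> 'a monoid"
  zmult :: "int \<Rightarrow> int \<Rightarrow> int \<Rightarrow> 'a \<Rightarrow> 'a \<Rightarrow> 'a"
  zone :: "int \<Rightarrow> 'a"

abbreviation zcar :: "'a zalg \<Rightarrow> int \<Rightarrow> int \<Rightarrow> 'a set" where
  "zcar D i j \<equiv> carrier (zgrp D i j)"

locale z_algebra =
  fixes D :: "'a zalg"
  assumes grp: "\<And>i j. comm_group (zgrp D i j)"
    and mult_closed: "\<And>i j l a b. \<lbrakk>a \<in> zcar D i j; b \<in> zcar D j l\<rbrakk> \<Longrightarrow> zmult D i j l a b \<in> zcar D i l"
    and distrib_right: "\<And>i j l a a' b. \<lbrakk>a \<in> zcar D i j; a' \<in> zcar D i j; b \<in> zcar D j l\<rbrakk> \<Longrightarrow>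
        zmult D i j l (a \<otimes>\<^bsub>zgrp D i j\<^esub> a') b
          = zmult D i j l a b \<otimes>\<^bsub>zgrp D i l\<^esub> zmult D i j l a' b"
    and distrib_left: "\<And>i j l a b b'. \<lbrakk>a \<in> zcar D i j; b \<in> zcar D j l; b' \<in> zcar D j l\<rbrakk> \<Longrightarrow>
        zmult D i j l a (b \<otimes>\<^bsub>zgrp D j l\<^esub> b')
          = zmult D i j l a b \<otimes>\<^bsub>zgrp D i l\<^esub> zmult D i j l a b'"
    and assoc: "\<And>i j l m a b c. \<lbrakk>a \<in> zcar D i j; b \<in> zcar D j l; c \<in> zcar D l m\<rbrakk> \<Longrightarrow>
        zmult D i l m (zmult D i j l a b) c = zmult D i j m a (zmult D j l m b c)"
    and one_closed: "\<And>i. zone D i \<in> zcar D i i"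
    and one_left: "\<And>i j a. a \<in> zcar D i j \<Longrightarrow> zmult D i i j (zone D i) a = a"
    and one_right: "\<And>i j a. a \<in> zcar D i j \<Longrightarrow> zmult D i j j a (zone D j) = a"

definition zideal :: "'a zalg \<Rightarrow> (int \<Rightarrow> int \<Rightarrow> 'a set) \<Rightarrow> bool" where
  "zideal D I \<longleftrightarrow> (\<forall>i j. subgroup (I i j) (zgrp D i j)) \<and>
     (\<forall>i j l. \<forall>a\<in>zcar D i j. \<forall>b\<in>I j l. zmult D i j l a b \<in> I i l) \<and>
     (\<forall>i j l. \<forall>a\<in>I i j. \<forall>b\<in>zcar D j l. zmult D i j l a b \<in> I i l)"

definition zideal_gen :: "'a zalg \<Rightarrow> (int \<Rightarrow> int \<Rightarrow> 'a set) \<Rightarrow> int \<Rightarrow> int \<Rightarrow> 'a set" where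
  "zideal_gen D X i j = \<Inter>{I i j | I. zideal D I \<and> (\<forall>p q. X p q \<subseteq> I p q)}"

definition zclass :: "'a zalg \<Rightarrow> (int \<Rightarrow> int \<Rightarrow> 'a set) \<Rightarrow> int \<Rightarrow> int \<Rightarrow> 'a \<Rightarrow> 'a set" where
  "zclass D I i j a = I i j #>\<^bsub>zgrp D i j\<^esub> a"

text \<open>
  In the product of two classes, the union runs over all representatives; for an ideal \<open>I\<close> all the
  sets in it are equal.
\<close>

definition zquot :: "'a zalg \<Rightarrow> (int \<Rightarrow> int \<Rightarrow> 'a set) \<Rightarrow> 'a set zalg" where
  "zquot D I =
    \<lparr>zgrp = (\<lambda>i j. zgrp D i j Mod I i j),
     zmult = (\<lambda>i j l X Y. \<Union>a\<in>X. \<Union>b\<in>Y. zclass D I i l (zmult D i j l a b)),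
     zone = (\<lambda>i. zclass D I i i (zone D i))\<rparr>"


subsection \<open>Inverting a family of elements\<close>

text \<open>
  \<open>zloc D d g\<close> is the \<open>\<int>\<close>-indexed algebra obtained from \<open>D\<close> by inverting all \<open>g i \<in> D\<^sub>i\<^sub>,\<^sub>i\<^sub>+\<^sub>d\<close>: it is
  generated by symbols \<open>Elt i j a\<close> for the elements \<open>a\<close> of \<open>D\<^sub>i\<^sub>j\<close> and \<open>Inv i\<close> in position \<open>(i + d, i)\<close>,
  subject to the relations that \<open>Elt\<close> is a homomorphism of \<open>\<int>\<close>-indexed algebras and that \<open>Inv i\<close> is a
  two-sided inverse of \<open>g i\<close>.  Before imposing relations, position \<open>(i, j)\<close> is the free abelian group
  on the paths of symbols from \<open>i\<close> to \<open>j\<close>.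
\<close>

datatype 'a loc_letter = Elt int int 'a | Inv int

fun is_path :: "'a zalg \<Rightarrow> int \<Rightarrow> int \<Rightarrow> 'a loc_letter list \<Rightarrow> int \<Rightarrow> bool" where
  "is_path D d i [] j \<longleftrightarrow> i = j"
| "is_path D d i (Elt p q a # s) j \<longleftrightarrow> p = i \<and> a \<in> zcar D p q \<and> is_path D d q s j"
| "is_path D d i (Inv p # s) j \<longleftrightarrow> p + d = i \<and> is_path D d p s j"

definition concat_ext :: "('a list \<Rightarrow>\<^sub>0 int) \<Rightarrow> ('a list \<Rightarrow>\<^sub>0 int) \<Rightarrow> ('a list \<Rightarrow>\<^sub>0 int)" where
  "concat_ext p q = frag_extend (\<lambda>s. frag_extend (\<lambda>t. frag_of (s @ t)) q) p"

definition path_zalg :: "'a zalg \<Rightarrow> int \<Rightarrow> ('a loc_letter list \<Rightarrow>\<^sub>0 int) zalg" where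
  "path_zalg D d =
    \<lparr>zgrp = (\<lambda>i j. free_Abelian_group {s. is_path D d i s j}),
     zmult = (\<lambda>i j l. concat_ext),
     zone = (\<lambda>i. frag_of [])\<rparr>"

definition loc_rels ::
    "'a zalg \<Rightarrow> int \<Rightarrow> (int \<Rightarrow> 'a) \<Rightarrow> int \<Rightarrow> int \<Rightarrow> ('a loc_letter list \<Rightarrow>\<^sub>0 int) set" where
  "loc_rels D d g i j =
     {frag_of [Elt i j (a \<otimes>\<^bsub>zgrp D i j\<^esub> b)] - frag_of [Elt i j a] - frag_of [Elt i j b] | a b.
        a \<in> zcar D i j \<and> b \<in> zcar D i j} \<union>
     {frag_of [Elt i l a, Elt l j b] - frag_of [Elt i j (zmult D i l j a b)] | l a b.
        a \<in> zcar D i l \<and> b \<in> zcar D l j} \<union>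
     (if i = j then
        {frag_of [Elt i i (zone D i)] - frag_of [],
         frag_of [Elt i (i + d) (g i), Inv i] - frag_of [],
         frag_of [Inv (i - d), Elt (i - d) i (g (i - d))] - frag_of []}
      else {})"

definition loc_ideal ::
    "'a zalg \<Rightarrow> int \<Rightarrow> (int \<Rightarrow> 'a) \<Rightarrow> int \<Rightarrow> int \<Rightarrow> ('a loc_letter list \<Rightarrow>\<^sub>0 int) set" where
  "loc_ideal D d g = zideal_gen (path_zalg D d) (loc_rels D d g)"

definition zloc :: "'a zalg \<Rightarrow> int \<Rightarrow> (int \<Rightarrow> 'a) \<Rightarrow> ('a loc_letter list \<Rightarrow>\<^sub>0 int) set zalg" where
  "zloc D d g = zquot (path_zalg D d) (loc_ideal D d g)"

text \<open>The canonical image of \<open>a \<in> D\<^sub>i\<^sub>j\<close>, and the inverse of \<open>g i\<close> in position \<open>(i + d, i)\<close>.\<close>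

definition loc_map ::
    "'a zalg \<Rightarrow> int \<Rightarrow> (int \<Rightarrow> 'a) \<Rightarrow> int \<Rightarrow> int \<Rightarrow> 'a \<Rightarrow> ('a loc_letter list \<Rightarrow>\<^sub>0 int) set" where
  "loc_map D d g i j a = zclass (path_zalg D d) (loc_ideal D d g) i j (frag_of [Elt i j a])"

definition loc_inv ::
    "'a zalg \<Rightarrow> int \<Rightarrow> (int \<Rightarrow> 'a) \<Rightarrow> int \<Rightarrow> ('a loc_letter list \<Rightarrow>\<^sub>0 int) set" where
  "loc_inv D d g i = zclass (path_zalg D d) (loc_ideal D d g) (i + d) i (frag_of [Inv i])"


subsection \<open>Left modules\<close>

text \<open>
  \<open>zmod D i j\<close> is \<open>D\<^sub>i\<^sub>j\<close> as a left module over the (in general non-commutative) ring \<open>D\<^sub>i\<^sub>i\<close>.  The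
  library locale \<open>module\<close> requires a commutative ring, hence only its record type is used here.
\<close>

definition zmod :: "'a zalg \<Rightarrow> int \<Rightarrow> int \<Rightarrow> ('a, 'a) module" where
  "zmod D i j =
    \<lparr>carrier = zcar D i j, monoid.mult = undefined, monoid.one = undefined,
     ring.zero = \<one>\<^bsub>zgrp D i j\<^esub>, ring.add = monoid.mult (zgrp D i j), smult = zmult D i i j\<rparr>"

definition module_sum :: "('r, 'm) module \<Rightarrow> ('r, 'n) module \<Rightarrow> ('r, 'm \<times> 'n) module" where
  "module_sum M N =
    \<lparr>carrier = carrier M \<times> carrier N, monoid.mult = undefined, monoid.one = undefined,
     ring.zero = (\<zero>\<^bsub>M\<^esub>, \<zero>\<^bsub>N\<^esub>),
     ring.add = (\<lambda>(m, n) (m', n'). (m \<oplus>\<^bsub>M\<^esub> m', n \<oplus>\<^bsub>N\<^esub> n')),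
     smult = (\<lambda>r (m, n). (smult M r m, smult N r n))\<rparr>"

definition lmodule_hom :: "'r set \<Rightarrow> ('r, 'm) module \<Rightarrow> ('r, 'n) module \<Rightarrow> ('m \<Rightarrow> 'n) set" where
  "lmodule_hom R M N = {h \<in> carrier M \<rightarrow> carrier N.
     (\<forall>m\<in>carrier M. \<forall>m'\<in>carrier M. h (m \<oplus>\<^bsub>M\<^esub> m') = h m \<oplus>\<^bsub>N\<^esub> h m') \<and>
     (\<forall>r\<in>R. \<forall>m\<in>carrier M. h (smult M r m) = smult N r (h m))}"

definition lmodule_iso :: "'r set \<Rightarrow> ('r, 'm) module \<Rightarrow> ('r, 'n) module \<Rightarrow> ('m \<Rightarrow> 'n) set" where
  "lmodule_iso R M N = {h \<in> lmodule_hom R M N. bij_betw h (carrier M) (carrier N)}"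

definition freely_generated_by :: "'r set \<Rightarrow> ('r, 'm) module \<Rightarrow> 'm \<Rightarrow> bool" where
  "freely_generated_by R M y \<longleftrightarrow> y \<in> carrier M \<and> (\<forall>m\<in>carrier M. \<exists>!r. r \<in> R \<and> m = smult M r y)"

text \<open>Exactness of \<open>P \<rightarrow> Q \<rightarrow> M \<rightarrow> 0\<close>, with maps \<open>d\<close> and \<open>p\<close>.\<close>

definition is_presentation ::
    "'r set \<Rightarrow> ('r, 'l) module \<Rightarrow> ('r, 'm) module \<Rightarrow> ('r, 'n) module
       \<Rightarrow> ('l \<Rightarrow> 'm) \<Rightarrow> ('m \<Rightarrow> 'n) \<Rightarrow> bool" where
  "is_presentation R P Q M d p \<longleftrightarrow> d \<in> lmodule_hom R P Q \<and> p \<in> lmodule_hom R Q M \<and>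
     p ` carrier Q = carrier M \<and> d ` carrier P = {q \<in> carrier Q. p q = \<zero>\<^bsub>M\<^esub>}"


section \<open>The tensor algebra and the non-commutative symmetric algebra\<close>

text \<open>
  For \<open>i < j\<close>, \<open>tens_grp K W i j\<close> is \<open>W i \<otimes> \<dots> \<otimes> W (j - 1)\<close> (over \<open>K (i + 1), \<dots>, K (j - 1)\<close>): the free
  abelian group on the words \<open>[v\<^sub>i, \<dots>, v\<^sub>j\<^sub>-\<^sub>1]\<close> modulo additivity in each factor and the balancing
  relations.
\<close>

definition tens_words :: "(int \<Rightarrow> ('k, 'v) bimod) \<Rightarrow> int \<Rightarrow> int \<Rightarrow> 'v list set" where
  "tens_words W i j =
     {s. int (length s) = j - i \<and> (\<forall>n<length s. s ! n \<in> carrier (W (i + int n)))}"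

definition tens_rels ::
    "(int \<Rightarrow> 'k ring) \<Rightarrow> (int \<Rightarrow> ('k, 'v) bimod) \<Rightarrow> int \<Rightarrow> int \<Rightarrow> ('v list \<Rightarrow>\<^sub>0 int) set" where
  "tens_rels K W i j =
     {frag_of (s @ [x \<oplus>\<^bsub>W (i + int (length s))\<^esub> y] @ t) - frag_of (s @ [x] @ t) - frag_of (s @ [y] @ t)
        | s x y t. s @ [x] @ t \<in> tens_words W i j \<and> s @ [y] @ t \<in> tens_words W i j} \<union>
     {frag_of (s @ [rsmult (W (i + int (length s))) x a, y] @ t)
        - frag_of (s @ [x, smult (W (i + int (length s) + 1)) a y] @ t)
        | s x a y t. s @ [x, y] @ t \<in> tens_words W i j \<and> a \<in> carrier (K (i + int (length s) + 1))}"

definition tens_null ::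
    "(int \<Rightarrow> 'k ring) \<Rightarrow> (int \<Rightarrow> ('k, 'v) bimod) \<Rightarrow> int \<Rightarrow> int \<Rightarrow> ('v list \<Rightarrow>\<^sub>0 int) set" where
  "tens_null K W i j = generate (free_Abelian_group (tens_words W i j)) (tens_rels K W i j)"

definition tens_class ::
    "(int \<Rightarrow> 'k ring) \<Rightarrow> (int \<Rightarrow> ('k, 'v) bimod) \<Rightarrow> int \<Rightarrow> int
       \<Rightarrow> ('v list \<Rightarrow>\<^sub>0 int) \<Rightarrow> ('v list \<Rightarrow>\<^sub>0 int) set" where
  "tens_class K W i j c = tens_null K W i j #>\<^bsub>free_Abelian_group (tens_words W i j)\<^esub> c"

definition tens_grp ::
    "(int \<Rightarrow> 'k ring) \<Rightarrow> (int \<Rightarrow> ('k, 'v) bimod) \<Rightarrow> int \<Rightarrow> int \<Rightarrow> ('v list \<Rightarrow>\<^sub>0 int) set monoid" where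
  "tens_grp K W i j = free_Abelian_group (tens_words W i j) Mod tens_null K W i j"

text \<open>
  An element of \<open>T\<^sub>i\<^sub>i = K i\<close> is tagged with \<open>Inl\<close>, and an element of \<open>T\<^sub>i\<^sub>j\<close> with \<open>i \<noteq> j\<close> with \<open>Inr\<close>.  For
  \<open>i > j\<close> there are no words, so that \<open>tens_grp K W i j\<close> is trivial.
\<close>

type_synonym ('k, 'v) tens = "'k + ('v list \<Rightarrow>\<^sub>0 int) set"

definition T_grp ::
    "(int \<Rightarrow> 'k ring) \<Rightarrow> (int \<Rightarrow> ('k, 'v) bimod) \<Rightarrow> int \<Rightarrow> int \<Rightarrow> ('k, 'v) tens monoid" where
  "T_grp K W i j =
    (if i = j
     then \<lparr>carrier = Inl ` carrier (K i), monoid.mult = (\<lambda>X Y. Inl (projl X \<oplus>\<^bsub>K i\<^esub> projl Y)), monoid.one = Inl \<zero>\<^bsub>K i\<^esub>\<rparr>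
     else \<lparr>carrier = Inr ` carrier (tens_grp K W i j),
           monoid.mult = (\<lambda>X Y. Inr (projr X \<otimes>\<^bsub>tens_grp K W i j\<^esub> projr Y)),
           monoid.one = Inr \<one>\<^bsub>tens_grp K W i j\<^esub>\<rparr>)"

definition lact_word :: "('k, 'v) bimod \<Rightarrow> 'k \<Rightarrow> 'v list \<Rightarrow> 'v list" where
  "lact_word M a s = smult M a (hd s) # tl s"

definition ract_word :: "('k, 'v) bimod \<Rightarrow> 'v list \<Rightarrow> 'k \<Rightarrow> 'v list" where
  "ract_word M s a = butlast s @ [rsmult M (last s) a]"

definition T_mult ::
    "(int \<Rightarrow> 'k ring) \<Rightarrow> (int \<Rightarrow> ('k, 'v) bimod) \<Rightarrow> int \<Rightarrow> int \<Rightarrow> int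
       \<Rightarrow> ('k, 'v) tens \<Rightarrow> ('k, 'v) tens \<Rightarrow> ('k, 'v) tens" where
  "T_mult K W i j l X Y =
    (if i \<le> j \<and> j \<le> l then
       (case (X, Y) of
          (Inl a, Inl b) \<Rightarrow> Inl (a \<otimes>\<^bsub>K i\<^esub> b)
        | (Inl a, Inr Y) \<Rightarrow>
            Inr (\<Union>q\<in>Y. tens_class K W i l (frag_extend (\<lambda>t. frag_of (lact_word (W i) a t)) q))
        | (Inr X, Inl b) \<Rightarrow>
            Inr (\<Union>p\<in>X. tens_class K W i l (frag_extend (\<lambda>s. frag_of (ract_word (W (j - 1)) s b)) p))
        | (Inr X, Inr Y) \<Rightarrow> Inr (\<Union>p\<in>X. \<Union>q\<in>Y. tens_class K W i l (concat_ext p q)))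
     else \<one>\<^bsub>T_grp K W i l\<^esub>)"

definition T_alg :: "(int \<Rightarrow> 'k ring) \<Rightarrow> (int \<Rightarrow> ('k, 'v) bimod) \<Rightarrow> ('k, 'v) tens zalg" where
  "T_alg K W = \<lparr>zgrp = T_grp K W, zmult = T_mult K W, zone = (\<lambda>i. Inl \<one>\<^bsub>K i\<^esub>)\<rparr>"

definition pure_tens ::
    "(int \<Rightarrow> 'k ring) \<Rightarrow> (int \<Rightarrow> ('k, 'v) bimod) \<Rightarrow> int \<Rightarrow> 'v list \<Rightarrow> ('k, 'v) tens" where
  "pure_tens K W i s = Inr (tens_class K W i (i + int (length s)) (frag_of s))"

text \<open>
  Under \<open>W i \<otimes> W (i + 1) \<cong> End (W i)\<close>, an endomorphism \<open>f\<close> corresponds to \<open>f x \<otimes> x' + f y \<otimes> y'\<close> for any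
  right basis \<open>{x, y}\<close> of \<open>W i\<close> with dual basis \<open>{x', y'}\<close>.  \<open>Q_set K W ev i\<close> consists of the tensors
  that correspond to the left multiplications by elements of \<open>K i\<close>.
\<close>

definition Q_set ::
    "(int \<Rightarrow> 'k ring) \<Rightarrow> (int \<Rightarrow> ('k, 'v) bimod) \<Rightarrow> (int \<Rightarrow> 'v \<Rightarrow> 'v \<Rightarrow> 'k) \<Rightarrow> int \<Rightarrow> ('k, 'v) tens set" where
  "Q_set K W ev i =
     {pure_tens K W i [smult (W i) a x, x'] \<otimes>\<^bsub>T_grp K W i (i + 2)\<^esub> pure_tens K W i [smult (W i) a y, y']
        | a x y x' y'. a \<in> carrier (K i) \<and> dual_bases K W ev i x y x' y'}"

definition R_ideal ::
    "(int \<Rightarrow> 'k ring) \<Rightarrow> (int \<Rightarrow> ('k, 'v) bimod) \<Rightarrow> (int \<Rightarrow> 'v \<Rightarrow> 'v \<Rightarrow> 'k)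
       \<Rightarrow> int \<Rightarrow> int \<Rightarrow> ('k, 'v) tens set" where
  "R_ideal K W ev = zideal_gen (T_alg K W) (\<lambda>i j. if j = i + 2 then Q_set K W ev i else {})"

definition nc_sym ::
    "(int \<Rightarrow> 'k ring) \<Rightarrow> (int \<Rightarrow> ('k, 'v) bimod) \<Rightarrow> (int \<Rightarrow> 'v \<Rightarrow> 'v \<Rightarrow> 'k) \<Rightarrow> ('k, 'v) tens set zalg" where
  "nc_sym K W ev = zquot (T_alg K W) (R_ideal K W ev)"

text \<open>The image in \<open>A\<^sub>i\<^sub>,\<^sub>i\<^sub>+\<^sub>n\<close> of a pure tensor with \<open>n\<close> factors.\<close>

definition sym_pure ::
    "(int \<Rightarrow> 'k ring) \<Rightarrow> (int \<Rightarrow> ('k, 'v) bimod) \<Rightarrow> (int \<Rightarrow> 'v \<Rightarrow> 'v \<Rightarrow> 'k)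
       \<Rightarrow> int \<Rightarrow> 'v list \<Rightarrow> ('k, 'v) tens set" where
  "sym_pure K W ev i s =
     zclass (T_alg K W) (R_ideal K W ev) i (i + int (length s)) (pure_tens K W i s)"


section \<open>The normal family: simple case\<close>

text \<open>
  \<open>field_bimod F \<iota> \<kappa>\<close> is \<open>F\<close> with left action via \<open>\<iota>\<close> and right action via \<open>\<kappa>\<close>.
\<close>

definition field_bimod :: "'f ring \<Rightarrow> ('k \<Rightarrow> 'f) \<Rightarrow> ('k \<Rightarrow> 'f) \<Rightarrow> ('k, 'f) bimod" where
  "field_bimod F \<iota> \<kappa> =
    \<lparr>carrier = carrier F, monoid.mult = monoid.mult F, monoid.one = \<one>\<^bsub>F\<^esub>, ring.zero = \<zero>\<^bsub>F\<^esub>, ring.add = ring.add F,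
     smult = (\<lambda>a v. \<iota> a \<otimes>\<^bsub>F\<^esub> v), rsmult = (\<lambda>v b. v \<otimes>\<^bsub>F\<^esub> \<kappa> b)\<rparr>"

definition galois_group :: "'f ring \<Rightarrow> 'f set \<Rightarrow> ('f \<Rightarrow> 'f) set" where
  "galois_group F L = {\<rho> \<in> ring_iso F F. \<forall>c\<in>L. \<rho> c = c}"

text \<open>As the Galois group is finite, non-negative powers suffice.\<close>

definition galois_generator :: "'f ring \<Rightarrow> 'f set \<Rightarrow> ('f \<Rightarrow> 'f) \<Rightarrow> bool" where
  "galois_generator F L \<sigma> \<longleftrightarrow> \<sigma> \<in> galois_group F L \<and>
     (\<forall>\<rho>\<in>galois_group F L. \<exists>n. \<forall>a\<in>carrier F. \<rho> a = (\<sigma> ^^ n) a)"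

definition half_trace :: "'f ring \<Rightarrow> 'k ring \<Rightarrow> ('k \<Rightarrow> 'f) \<Rightarrow> ('f \<Rightarrow> 'f) \<Rightarrow> 'f \<Rightarrow> 'k" where
  "half_trace F K \<iota> \<sigma> a =
     inv_into (carrier K) \<iota> (inv\<^bsub>F\<^esub> (\<one>\<^bsub>F\<^esub> \<oplus>\<^bsub>F\<^esub> \<one>\<^bsub>F\<^esub>) \<otimes>\<^bsub>F\<^esub> (a \<oplus>\<^bsub>F\<^esub> \<sigma> a))"

text \<open>
  The isomorphism \<open>f 0\<close> is \<open>\<^sub>0F\<^sub>1 \<cong> V\<close>; the remaining \<open>f i\<close> are determined by it and are the
  identifications of \<open>V\<^sup>i\<^sup>*\<close> with \<open>\<^sub>0F\<^sub>1\<close> or \<open>\<^sub>1F\<^sub>0\<close> given by the trace pairings.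
\<close>

locale simple_model = dual_system K0 K1 V W ev
  for K0 K1 :: "'k ring" and V :: "('k, 'v) bimod" and W ev +
  fixes F :: "'f ring"
    and \<iota>0 \<iota>1 :: "'k \<Rightarrow> 'f"
    and \<sigma>0 \<sigma>1 :: "'f \<Rightarrow> 'f"
    and w0 w1 :: 'f
    and f :: "int \<Rightarrow> 'f \<Rightarrow> 'v"
  assumes field_F: "field F"
    and emb: "\<iota>0 \<in> ring_hom K0 F" "\<iota>1 \<in> ring_hom K1 F"
    and degree: "ring.dimension F 2 (\<iota>0 ` carrier K0) (carrier F)"
      "ring.dimension F 2 (\<iota>1 ` carrier K1) (carrier F)"
    and gal: "galois_generator F (\<iota>0 ` carrier K0) \<sigma>0" "galois_generator F (\<iota>1 ` carrier K1) \<sigma>1"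
    and w_closed: "w0 \<in> carrier F" "w1 \<in> carrier F"
    and w_square: "w0 \<otimes>\<^bsub>F\<^esub> w0 \<in> \<iota>0 ` carrier K0" "w1 \<otimes>\<^bsub>F\<^esub> w1 \<in> \<iota>1 ` carrier K1"
    and w_notin: "w0 \<notin> \<iota>0 ` carrier K0 \<union> \<iota>1 ` carrier K1" "w1 \<notin> \<iota>0 ` carrier K0 \<union> \<iota>1 ` carrier K1"
    and f_iso: "\<And>i. f i \<in> bimod_iso (alt K0 K1 i) (alt K0 K1 (i + 1))
        (field_bimod F (alt \<iota>0 \<iota>1 i) (alt \<iota>0 \<iota>1 (i + 1))) (W i)"
    and f_pairing: "\<And>i a b. \<lbrakk>a \<in> carrier F; b \<in> carrier F\<rbrakk> \<Longrightarrow>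
        ev i (f (i + 1) a) (f i b) =
          alt (half_trace F K0 \<iota>0 \<sigma>0) (half_trace F K1 \<iota>1 \<sigma>1) (i + 1) (b \<otimes>\<^bsub>F\<^esub> a)"

definition g_simple ::
    "(int \<Rightarrow> 'k ring) \<Rightarrow> (int \<Rightarrow> ('k, 'v) bimod) \<Rightarrow> (int \<Rightarrow> 'v \<Rightarrow> 'v \<Rightarrow> 'k)
       \<Rightarrow> 'f ring \<Rightarrow> 'f \<Rightarrow> 'f \<Rightarrow> (int \<Rightarrow> 'f \<Rightarrow> 'v) \<Rightarrow> int \<Rightarrow> ('k, 'v) tens set" where
  "g_simple K W ev F w0 w1 f i =
     (let w = alt w1 w0 i in
      sym_pure K W ev i [f i w, f (i + 1) \<one>\<^bsub>F\<^esub>]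
        \<otimes>\<^bsub>zgrp (nc_sym K W ev) i (i + 2)\<^esub> sym_pure K W ev i [f i \<one>\<^bsub>F\<^esub>, f (i + 1) w])"


section \<open>The normal family: non-simple case\<close>

text \<open>
  Row vectors \<open>K\<^sup>2\<close> with usual left action and right action \<open>v \<cdot> b = v \<phi>(b)\<close>, where \<open>\<phi>\<close> is the upper
  triangular matrix with rows \<open>(\<alpha>, \<eta>)\<close> and \<open>(0, \<beta>)\<close>.
\<close>

definition row_bimod :: "'k ring \<Rightarrow> ('k \<Rightarrow> 'k) \<Rightarrow> ('k \<Rightarrow> 'k) \<Rightarrow> ('k \<Rightarrow> 'k) \<Rightarrow> ('k, 'k \<times> 'k) bimod" where
  "row_bimod K \<alpha> \<eta> \<beta> =
    \<lparr>carrier = carrier K \<times> carrier K, monoid.mult = undefined, monoid.one = undefined,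
     ring.zero = (\<zero>\<^bsub>K\<^esub>, \<zero>\<^bsub>K\<^esub>),
     ring.add = (\<lambda>(r, s) (r', s'). (r \<oplus>\<^bsub>K\<^esub> r', s \<oplus>\<^bsub>K\<^esub> s')),
     smult = (\<lambda>a (r, s). (a \<otimes>\<^bsub>K\<^esub> r, a \<otimes>\<^bsub>K\<^esub> s)),
     rsmult = (\<lambda>(r, s) b. (r \<otimes>\<^bsub>K\<^esub> \<alpha> b, r \<otimes>\<^bsub>K\<^esub> \<eta> b \<oplus>\<^bsub>K\<^esub> s \<otimes>\<^bsub>K\<^esub> \<beta> b))\<rparr>"

definition derivation :: "'k ring \<Rightarrow> ('k \<Rightarrow> 'k) \<Rightarrow> ('k \<Rightarrow> 'k) \<Rightarrow> bool" where
  "derivation K \<sigma> \<eta> \<longleftrightarrow> \<eta> \<in> carrier K \<rightarrow> carrier K \<and>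
     (\<forall>a\<in>carrier K. \<forall>b\<in>carrier K. \<eta> (a \<oplus>\<^bsub>K\<^esub> b) = \<eta> a \<oplus>\<^bsub>K\<^esub> \<eta> b \<and>
        \<eta> (a \<otimes>\<^bsub>K\<^esub> b) = \<sigma> a \<otimes>\<^bsub>K\<^esub> \<eta> b \<oplus>\<^bsub>K\<^esub> \<eta> a \<otimes>\<^bsub>K\<^esub> \<sigma> b)"

text \<open>
  \<open>\<theta>\<close> is the identification of \<open>K\<^sub>0\<close> with \<open>K\<^sub>1\<close>, and \<open>f\<close> the identification of \<open>K\<^sub>0\<^sup>2\<close> with \<open>V\<close>.
  The first alternative of \<open>normal_form\<close> is the diagonal one.
\<close>

locale nonsimple_model = dual_system K0 K1 V W ev
  for K0 K1 :: "'k ring" and V :: "('k, 'v) bimod" and W ev +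
  fixes \<theta> \<sigma> \<tau> \<eta> :: "'k \<Rightarrow> 'k"
    and f :: "'k \<times> 'k \<Rightarrow> 'v"
    and u v :: "int \<Rightarrow> 'v"
  assumes ident: "\<theta> \<in> ring_iso K0 K1"
    and auts: "\<sigma> \<in> ring_iso K0 K0" "\<tau> \<in> ring_iso K0 K0"
    and normal_form: "(\<forall>a\<in>carrier K0. \<eta> a = \<zero>\<^bsub>K0\<^esub>) \<or>
        (\<forall>a\<in>carrier K0. \<tau> a = \<sigma> a) \<and> derivation K0 \<sigma> \<eta>"
    and f_iso: "f \<in> bimod_iso K0 K1
        (row_bimod K0 (\<sigma> \<circ> inv_into (carrier K0) \<theta>) (\<eta> \<circ> inv_into (carrier K0) \<theta>)
           (\<tau> \<circ> inv_into (carrier K0) \<theta>)) V"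
    and uv_start: "u 0 = f (\<one>\<^bsub>K0\<^esub>, \<zero>\<^bsub>K0\<^esub>)" "v 0 = f (\<zero>\<^bsub>K0\<^esub>, \<one>\<^bsub>K0\<^esub>)"
    and uv_dual: "\<And>i. dual_bases (alt K0 K1) W ev i (u i) (v i) (u (i + 1)) (v (i + 1))"

definition g_nonsimple ::
    "(int \<Rightarrow> 'k ring) \<Rightarrow> (int \<Rightarrow> ('k, 'v) bimod) \<Rightarrow> (int \<Rightarrow> 'v \<Rightarrow> 'v \<Rightarrow> 'k)
       \<Rightarrow> (int \<Rightarrow> 'v) \<Rightarrow> (int \<Rightarrow> 'v) \<Rightarrow> int \<Rightarrow> ('k, 'v) tens set" where
  "g_nonsimple K W ev u v i = sym_pure K W ev i [alt v u i i]"

end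

(* In the simple case, everything but exactness at the middle term is formal. Let {sx, sy} be the basis
   of the left dual that is dual to {x, y}, and write g_{-1} = p x + q y with p, q in that dual. If
   a x + b y = 0 in A[g^{-1}], then (a x + b y) g_{-1}^{-1} (p, q) = 0, while the rows x g_{-1}^{-1} (p, q)
   and y g_{-1}^{-1} (p, q) agree with (1, 0) and (0, 1) up to left multiples of (sx, sy); hence (a, b) is
   itself such a multiple. That agreement amounts to four identities in A_{-2,0}, the quotient of the
   tensor square of F over K_1 by K_0 z, where z = 1 @ 1 + w_1 @ w_1^{-1} is central for the F-F-bimodule
   structure and g_{-2} = w_1 z; they are solvable because {sx, sy} is a K_0-basis of F. Only relations
   that hold in A are used, so neither its Hilbert series nor a description of A[g^{-1}] by fractions is
   needed. In the non-simple case, right multiplication by the inverse of g_0 is an isomorphism. *)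

theory Submission
  imports Defs
begin

section \<open>Biadditive maps and their quotients\<close>

lemma (in comm_group) rcos_sum_subgroup:
  assumes "subgroup N G" "a \<in> carrier G" "b \<in> carrier G"
  shows "(N #> a) <#> (N #> b) = N #> (a \<otimes> b)"
  using assms by (simp add: normal.rcos_sum subgroup_imp_normal)

lemma (in comm_group) rcos_eq_iff:
  assumes "subgroup N G" "a \<in> carrier G" "b \<in> carrier G"
  shows "N #> a = N #> b \<longleftrightarrow> a \<otimes> inv b \<in> N"
proof -
  interpret N: subgroup N G by fact
  have "N #> a = N #> b \<longleftrightarrow> a \<in> N #> b"
    using assms by (metis rcos_self repr_independence)
  then show ?thesis
    using N.rcos_module[OF is_group assms(3,2)] by simp
qed

lemma (in comm_group) rcos_self_elim:
  assumes "subgroup N G" "a \<in> carrier G" "b \<in> N #> a"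
  obtains n where "n \<in> N" "b = n \<otimes> a"
  using assms by (auto simp: r_coset_def)

lemma (in group_hom) subgroup_preimage:
  assumes "subgroup N H"
  shows "subgroup {a \<in> carrier G. h a \<in> N} G"
proof -
  interpret N: subgroup N H by fact
  show ?thesis by (rule G.subgroupI) (auto intro: exI[of _ "\<one>"])
qed

lemma (in group_hom) hom_generate_into:
  assumes "subgroup N H" "S \<subseteq> carrier G" "\<And>s. s \<in> S \<Longrightarrow> h s \<in> N" "a \<in> generate G S"
  shows "h a \<in> N"
  using G.generate_subgroup_incl[OF _ subgroup_preimage[OF assms(1)], of S] assms(2-4) by auto

lemma (in group_hom) hom_coset:
  assumes "comm_group G" "comm_group H" "subgroup M G" "subgroup N H" "\<And>m. m \<in> M \<Longrightarrow> h m \<in> N" "a \<in> carrier G"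
  shows "(\<Union>a' \<in> M #> a. N #>\<^bsub>H\<^esub> h a') = N #>\<^bsub>H\<^esub> h a"
proof -
  interpret G: comm_group G by fact
  interpret H: comm_group H by fact
  interpret M: subgroup M G by fact
  have "N #>\<^bsub>H\<^esub> h a' = N #>\<^bsub>H\<^esub> h a" if a': "a' \<in> M #> a" for a'
  proof -
    obtain m where m: "m \<in> M" "a' = m \<otimes> a"
      using a' assms by (auto elim: G.rcos_self_elim)
    then have "h a' \<otimes>\<^bsub>H\<^esub> inv\<^bsub>H\<^esub> h a = h m"
      using assms by (simp add: H.m_assoc)
    then show ?thesis
      using assms m by (subst H.rcos_eq_iff) auto
  qed
  moreover have "a \<in> M #> a"
    using assms G.rcos_self by blast
  ultimately show ?thesis by blast
qed

locale biadditive = G: comm_group G + H: comm_group H + L: comm_group L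
  for G :: "'a monoid" and H :: "'b monoid" and L :: "'c monoid" +
  fixes m :: "'a \<Rightarrow> 'b \<Rightarrow> 'c"
  assumes closed [simp, intro]: "a \<in> carrier G \<Longrightarrow> b \<in> carrier H \<Longrightarrow> m a b \<in> carrier L"
    and add_left: "\<lbrakk>a \<in> carrier G; a' \<in> carrier G; b \<in> carrier H\<rbrakk> \<Longrightarrow>
        m (a \<otimes>\<^bsub>G\<^esub> a') b = m a b \<otimes>\<^bsub>L\<^esub> m a' b"
    and add_right: "\<lbrakk>a \<in> carrier G; b \<in> carrier H; b' \<in> carrier H\<rbrakk> \<Longrightarrow>
        m a (b \<otimes>\<^bsub>H\<^esub> b') = m a b \<otimes>\<^bsub>L\<^esub> m a b'"
begin

lemma hom_left: "b \<in> carrier H \<Longrightarrow> group_hom G L (\<lambda>a. m a b)"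
  by unfold_locales (auto simp: hom_def add_left)

lemma hom_right: "a \<in> carrier G \<Longrightarrow> group_hom H L (m a)"
  by unfold_locales (auto simp: hom_def add_right)

lemma one_left [simp]: "b \<in> carrier H \<Longrightarrow> m \<one>\<^bsub>G\<^esub> b = \<one>\<^bsub>L\<^esub>"
  using group_hom.hom_one[OF hom_left] by simp

lemma one_right [simp]: "a \<in> carrier G \<Longrightarrow> m a \<one>\<^bsub>H\<^esub> = \<one>\<^bsub>L\<^esub>"
  using group_hom.hom_one[OF hom_right] by simp

lemma inv_left: "\<lbrakk>a \<in> carrier G; b \<in> carrier H\<rbrakk> \<Longrightarrow> m (inv\<^bsub>G\<^esub> a) b = inv\<^bsub>L\<^esub> m a b"
  using group_hom.hom_inv[OF hom_left] by simp

end

locale biadditive_quotient = biadditive +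
  fixes I J N
  assumes subgroups: "subgroup I G" "subgroup J H" "subgroup N L"
    and null_left: "\<And>a b. a \<in> I \<Longrightarrow> b \<in> carrier H \<Longrightarrow> m a b \<in> N"
    and null_right: "\<And>a b. a \<in> carrier G \<Longrightarrow> b \<in> J \<Longrightarrow> m a b \<in> N"
begin

sublocale I: subgroup I G by (rule subgroups)
sublocale J: subgroup J H by (rule subgroups)
sublocale N: subgroup N L by (rule subgroups)

definition quot_map :: "'a set \<Rightarrow> 'b set \<Rightarrow> 'c set" where
  "quot_map X Y = (\<Union>a\<in>X. \<Union>b\<in>Y. N #>\<^bsub>L\<^esub> m a b)"

lemma quot_map_coset [simp]:
  assumes "a \<in> carrier G" "b \<in> carrier H"
  shows "quot_map (I #>\<^bsub>G\<^esub> a) (J #>\<^bsub>H\<^esub> b) = N #>\<^bsub>L\<^esub> m a b"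
proof -
  have "(\<Union>b'\<in>J #>\<^bsub>H\<^esub> b. N #>\<^bsub>L\<^esub> m a' b') = N #>\<^bsub>L\<^esub> m a' b" if "a' \<in> I #>\<^bsub>G\<^esub> a" for a'
  proof -
    have "a' \<in> carrier G"
      using that assms G.r_coset_subset_G[OF I.subset] by blast
    then show ?thesis
      using group_hom.hom_coset[OF hom_right] subgroups null_right assms
      by (metis H.comm_group_axioms L.comm_group_axioms)
  qed
  then have "quot_map (I #>\<^bsub>G\<^esub> a) (J #>\<^bsub>H\<^esub> b) = (\<Union>a'\<in>I #>\<^bsub>G\<^esub> a. N #>\<^bsub>L\<^esub> m a' b)"
    by (simp add: quot_map_def)
  also have "\<dots> = N #>\<^bsub>L\<^esub> m a b"
    using assms subgroups null_left
    by (intro group_hom.hom_coset[OF hom_left]) (auto intro: G.comm_group_axioms L.comm_group_axioms)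
  finally show ?thesis .
qed

lemma biadditive_quot_map: "biadditive (G Mod I) (H Mod J) (L Mod N) quot_map"
proof (intro biadditive.intro biadditive_axioms.intro)
  show "comm_group (G Mod I)" "comm_group (H Mod J)" "comm_group (L Mod N)"
    using subgroups by (auto intro: G.abelian_FactGroup H.abelian_FactGroup L.abelian_FactGroup)
qed (auto simp: carrier_FactGroup G.rcos_sum_subgroup H.rcos_sum_subgroup L.rcos_sum_subgroup
    subgroups add_left add_right)

end


section \<open>Quotients of indexed algebras\<close>

text \<open>
  Associativity of the symmetric algebra is never needed, because associativity of a localization
  comes from the free path algebra.
\<close>

locale biadditive_zalg =
  fixes D :: "'a zalg"
  assumes mult_biadditive: "\<And>i j l. biadditive (zgrp D i j) (zgrp D j l) (zgrp D i l) (zmult D i j l)"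
begin

lemma zgrp_comm_group: "comm_group (zgrp D i j)"
  using mult_biadditive[of i j j] by (simp add: biadditive_def)

lemma zadd_closed [simp, intro]:
  "a \<in> zcar D i j \<Longrightarrow> b \<in> zcar D i j \<Longrightarrow> a \<otimes>\<^bsub>zgrp D i j\<^esub> b \<in> zcar D i j"
  using zgrp_comm_group by (metis comm_groupE(1))

lemma zmult_closed [simp, intro]:
  "a \<in> zcar D i j \<Longrightarrow> b \<in> zcar D j l \<Longrightarrow> zmult D i j l a b \<in> zcar D i l"
  using biadditive.closed[OF mult_biadditive] .

lemma zideal_carrier: "zideal D (zcar D)"
proof -
  have "subgroup (zcar D i j) (zgrp D i j)" for i j
    using zgrp_comm_group by (simp add: group.subgroup_self comm_group.axioms(2))
  then show ?thesis by (auto simp: zideal_def)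
qed

lemma zideal_gen:
  assumes "\<And>i j. X i j \<subseteq> zcar D i j"
  shows "zideal D (zideal_gen D X)"
proof -
  have "subgroup (zideal_gen D X i j) (zgrp D i j)" for i j
    unfolding zideal_gen_def
  proof (rule group.subgroups_Inter)
    show "group (zgrp D i j)"
      using zgrp_comm_group comm_group.axioms(2) by blast
    show "{I i j |I. zideal D I \<and> (\<forall>p q. X p q \<subseteq> I p q)} \<noteq> {}"
      using assms zideal_carrier by blast
  qed (auto simp: zideal_def)
  moreover have "zmult D i j l a b \<in> zideal_gen D X i l"
    if "a \<in> zcar D i j \<and> b \<in> zideal_gen D X j l \<or> a \<in> zideal_gen D X i j \<and> b \<in> zcar D j l" for i j l a b
    unfolding zideal_gen_def
  proof clarify
    fix I assume I: "zideal D I" "\<forall>p q. X p q \<subseteq> I p q"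
    then have "zideal_gen D X p q \<subseteq> I p q" for p q
      by (auto simp: zideal_gen_def)
    then show "zmult D i j l a b \<in> I i l"
      using that I(1) unfolding zideal_def by blast
  qed
  ultimately show ?thesis
    unfolding zideal_def by blast
qed

lemma zideal_gen_incl: "X i j \<subseteq> zideal_gen D X i j"
  by (auto simp: zideal_gen_def)

lemma biadditive_quotient_zideal:
  assumes "zideal D I"
  shows "biadditive_quotient (zgrp D i j) (zgrp D j l) (zgrp D i l) (zmult D i j l) (I i j) (I j l) (I i l)"
  using assms mult_biadditive
  by (auto simp: biadditive_quotient_def biadditive_quotient_axioms_def zideal_def)

lemma zmult_zquot:
  assumes "zideal D I"
  shows "zmult (zquot D I) i j l = biadditive_quotient.quot_map (zgrp D i l) (zmult D i j l) (I i l)"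
  by (simp add: fun_eq_iff zquot_def zclass_def
      biadditive_quotient.quot_map_def[OF biadditive_quotient_zideal[OF assms]])

lemma zcar_zquot: "zcar (zquot D I) i j = zclass D I i j ` zcar D i j"
  by (simp add: zquot_def zclass_def carrier_FactGroup image_def)

lemma zclass_closed [intro]: "a \<in> zcar D i j \<Longrightarrow> zclass D I i j a \<in> zcar (zquot D I) i j"
  by (simp add: zcar_zquot)

lemma zclass_add:
  assumes "zideal D I" "a \<in> zcar D i j" "b \<in> zcar D i j"
  shows "zclass D I i j a \<otimes>\<^bsub>zgrp (zquot D I) i j\<^esub> zclass D I i j b = zclass D I i j (a \<otimes>\<^bsub>zgrp D i j\<^esub> b)"
  using assms comm_group.rcos_sum_subgroup[OF zgrp_comm_group] by (simp add: zquot_def zclass_def zideal_def)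

lemma zclass_mult:
  assumes "zideal D I" "a \<in> zcar D i j" "b \<in> zcar D j l"
  shows "zmult (zquot D I) i j l (zclass D I i j a) (zclass D I j l b) = zclass D I i l (zmult D i j l a b)"
  using assms by (simp add: zmult_zquot zclass_def
      biadditive_quotient.quot_map_coset[OF biadditive_quotient_zideal])

lemma zclass_eq_one:
  assumes "zideal D I" "a \<in> I i j"
  shows "zclass D I i j a = \<one>\<^bsub>zgrp (zquot D I) i j\<^esub>"
proof -
  interpret comm_group "zgrp D i j" by (rule zgrp_comm_group)
  have "subgroup (I i j) (zgrp D i j)"
    using assms(1) by (simp add: zideal_def)
  then show ?thesis
    using assms(2) by (simp add: zquot_def zclass_def coset_join2 subgroup.mem_carrier)
qed

lemma zclass_eqI:
  assumes "zideal D I" "a \<in> zcar D i j" "b \<in> zcar D i j" "a \<otimes>\<^bsub>zgrp D i j\<^esub> inv\<^bsub>zgrp D i j\<^esub> b \<in> I i j"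
  shows "zclass D I i j a = zclass D I i j b"
  using assms comm_group.rcos_eq_iff[OF zgrp_comm_group] by (simp add: zclass_def zideal_def)

lemma biadditive_zalg_zquot:
  assumes "zideal D I"
  shows "biadditive_zalg (zquot D I)"
  using biadditive_quotient.biadditive_quot_map[OF biadditive_quotient_zideal[OF assms]]
  by (simp add: biadditive_zalg_def zmult_zquot[OF assms]) (simp add: zquot_def)

end

lemma (in z_algebra) biadditive_zalg: "biadditive_zalg D"
  by (intro biadditive_zalg.intro biadditive.intro biadditive_axioms.intro)
    (auto intro: grp mult_closed distrib_left distrib_right)

lemma (in z_algebra) z_algebra_zquot:
  assumes "zideal D I"
  shows "z_algebra (zquot D I)"
proof -
  interpret D: biadditive_zalg D by (rule biadditive_zalg)
  interpret Q: biadditive_zalg "zquot D I" by (rule D.biadditive_zalg_zquot[OF assms])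
  show ?thesis
  proof (rule z_algebra.intro)
    show "comm_group (zgrp (zquot D I) i j)" for i j by (rule Q.zgrp_comm_group)
  next
    fix i j l a b c
    show "zmult (zquot D I) i j l (a \<otimes>\<^bsub>zgrp (zquot D I) i j\<^esub> b) c =
        zmult (zquot D I) i j l a c \<otimes>\<^bsub>zgrp (zquot D I) i l\<^esub> zmult (zquot D I) i j l b c"
      if "a \<in> zcar (zquot D I) i j" "b \<in> zcar (zquot D I) i j" "c \<in> zcar (zquot D I) j l"
      using biadditive.add_left[OF Q.mult_biadditive] that .
    show "zmult (zquot D I) i j l a (b \<otimes>\<^bsub>zgrp (zquot D I) j l\<^esub> c) =
        zmult (zquot D I) i j l a b \<otimes>\<^bsub>zgrp (zquot D I) i l\<^esub> zmult (zquot D I) i j l a c"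
      if "a \<in> zcar (zquot D I) i j" "b \<in> zcar (zquot D I) j l" "c \<in> zcar (zquot D I) j l"
      using biadditive.add_right[OF Q.mult_biadditive] that .
  next
    fix i j l m a b c
    assume "a \<in> zcar (zquot D I) i j" "b \<in> zcar (zquot D I) j l" "c \<in> zcar (zquot D I) l m"
    then show "zmult (zquot D I) i l m (zmult (zquot D I) i j l a b) c =
        zmult (zquot D I) i j m a (zmult (zquot D I) j l m b c)"
      by (auto simp: D.zcar_zquot D.zclass_mult[OF assms] mult_closed assoc)
  next
    have z: "zone (zquot D I) i = zclass D I i i (zone D i)" for i
      by (simp add: zquot_def)
    show one: "zone (zquot D I) i \<in> zcar (zquot D I) i i" for i
      by (auto simp: z D.zcar_zquot one_closed)
    show "zmult (zquot D I) i i j (zone (zquot D I) i) a = a"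
      "zmult (zquot D I) i j j a (zone (zquot D I) j) = a" if "a \<in> zcar (zquot D I) i j" for i j a
      using that by (auto simp: z D.zcar_zquot D.zclass_mult[OF assms] one_closed one_left one_right)
  qed auto
qed

section \<open>The path algebra and the localization\<close>

lemma frag_extend_add_fun: "frag_extend (\<lambda>s. A s + B s) p = frag_extend A p + frag_extend B p"
  by (simp add: frag_extend_def frag_cmul_distrib2 sum.distrib)

lemma keys_frag_extend_subset:
  assumes "Poly_Mapping.keys p \<subseteq> S" "\<And>s. s \<in> S \<Longrightarrow> Poly_Mapping.keys (f s) \<subseteq> T"
  shows "Poly_Mapping.keys (frag_extend f p) \<subseteq> T"
  using assms keys_frag_extend[of f p] by fastforce

lemma group_hom_frag_extend:
  assumes "\<And>s. s \<in> S \<Longrightarrow> Poly_Mapping.keys (f s) \<subseteq> T"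
  shows "group_hom (free_Abelian_group S) (free_Abelian_group T) (frag_extend f)"
proof -
  have "frag_extend f \<in> hom (free_Abelian_group S) (free_Abelian_group T)"
    using assms by (intro homI) (simp_all add: keys_frag_extend_subset frag_extend_add)
  then show ?thesis
    by (simp add: group_hom_def group_hom_axioms_def)
qed

lemma concat_ext_frag_of [simp]: "concat_ext (frag_of s) (frag_of t) = frag_of (s @ t)"
  by (simp add: concat_ext_def)

lemma concat_ext_add_left: "concat_ext (p + p') q = concat_ext p q + concat_ext p' q"
  by (simp add: concat_ext_def frag_extend_add)

lemma concat_ext_add_right: "concat_ext p (q + q') = concat_ext p q + concat_ext p q'"
  by (simp add: concat_ext_def frag_extend_add frag_extend_add_fun)

lemma concat_ext_zero [simp]: "concat_ext 0 q = 0" "concat_ext p 0 = 0"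
  by (simp_all add: concat_ext_def frag_extend_eq_0)

lemma concat_ext_diff_left: "concat_ext (p - p') q = concat_ext p q - concat_ext p' q"
  by (simp add: concat_ext_def frag_extend_diff)

lemma concat_ext_diff_right: "concat_ext p (q - q') = concat_ext p q - concat_ext p q'"
  by (metis add_diff_cancel concat_ext_add_right diff_add_cancel)

lemma concat_ext_assoc: "concat_ext (concat_ext p q) r = concat_ext p (concat_ext q r)"
proof -
  have "concat_ext (concat_ext (frag_of s) (frag_of t)) r = concat_ext (frag_of s) (concat_ext (frag_of t) r)"
    for s t
    using subset_UNIV
    by (induction r rule: frag_induction) (auto simp: concat_ext_diff_right)
  note 1 = this[simplified]
  have "concat_ext (concat_ext (frag_of s) q) r = concat_ext (frag_of s) (concat_ext q r)" for s
    using subset_UNIV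
    by (induction q rule: frag_induction) (simp_all add: 1 concat_ext_diff_left concat_ext_diff_right)
  note 2 = this
  show ?thesis
    using subset_UNIV
    by (induction p rule: frag_induction) (simp_all add: 2 concat_ext_diff_left)
qed

lemma concat_ext_Nil [simp]: "concat_ext (frag_of []) q = q" "concat_ext p (frag_of []) = p"
  using frag_expansion[symmetric] by (simp_all add: concat_ext_def)

lemma keys_concat_ext:
  assumes "Poly_Mapping.keys p \<subseteq> S" "Poly_Mapping.keys q \<subseteq> T"
    and "\<And>s t. s \<in> S \<Longrightarrow> t \<in> T \<Longrightarrow> s @ t \<in> U"
  shows "Poly_Mapping.keys (concat_ext p q) \<subseteq> U"
  unfolding concat_ext_def using assms by (intro keys_frag_extend_subset[of _ S] keys_frag_extend_subset[of _ T]) auto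

lemma biadditive_concat_ext:
  assumes "\<And>s t. s \<in> S \<Longrightarrow> t \<in> T \<Longrightarrow> s @ t \<in> U"
  shows "biadditive (free_Abelian_group S) (free_Abelian_group T) (free_Abelian_group U) concat_ext"
proof (intro biadditive.intro biadditive_axioms.intro)
  show "concat_ext p q \<in> carrier (free_Abelian_group U)"
    if "p \<in> carrier (free_Abelian_group S)" "q \<in> carrier (free_Abelian_group T)" for p q
    using that assms by (simp add: keys_concat_ext)
qed (simp_all add: abelian_free_Abelian_group concat_ext_add_left concat_ext_add_right)

lemma is_path_append: "is_path D d i s j \<Longrightarrow> is_path D d j t l \<Longrightarrow> is_path D d i (s @ t) l"
  by (induction D d i s j rule: is_path.induct) auto

lemma z_algebra_path_zalg: "z_algebra (path_zalg D d)"
proof -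
  have b: "biadditive (zgrp (path_zalg D d) i j) (zgrp (path_zalg D d) j l) (zgrp (path_zalg D d) i l)
      (zmult (path_zalg D d) i j l)" for i j l
    by (auto simp: path_zalg_def intro!: biadditive_concat_ext is_path_append)
  show ?thesis
  proof (rule z_algebra.intro)
    show "comm_group (zgrp (path_zalg D d) i j)" for i j
      by (simp add: path_zalg_def abelian_free_Abelian_group)
    show "zmult (path_zalg D d) i j l a b \<in> zcar (path_zalg D d) i l"
      if "a \<in> zcar (path_zalg D d) i j" "b \<in> zcar (path_zalg D d) j l" for i j l a b
      using biadditive.closed[OF b] that .
  qed (simp_all add: path_zalg_def concat_ext_assoc concat_ext_add_left concat_ext_add_right)
qed

locale localization = biadditive_zalg D for D :: "'a zalg" +
  fixes d :: int and g :: "int \<Rightarrow> 'a"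
  assumes zone_closed: "\<And>i. zone D i \<in> zcar D i i"
    and g_closed: "\<And>i. g i \<in> zcar D i (i + d)"
begin

abbreviation B :: "('a loc_letter list \<Rightarrow>\<^sub>0 int) set zalg" where
  "B \<equiv> zloc D d g"

abbreviation im :: "int \<Rightarrow> int \<Rightarrow> 'a \<Rightarrow> ('a loc_letter list \<Rightarrow>\<^sub>0 int) set" where
  "im \<equiv> loc_map D d g"

interpretation P: z_algebra "path_zalg D d" by (rule z_algebra_path_zalg)
interpretation P: biadditive_zalg "path_zalg D d" by (rule P.biadditive_zalg)

lemma carrier_path_zalg [simp]: "p \<in> zcar (path_zalg D d) i j \<longleftrightarrow> Poly_Mapping.keys p \<subseteq> {s. is_path D d i s j}"
  by (simp add: path_zalg_def)

lemma loc_rels_closed: "loc_rels D d g i j \<subseteq> zcar (path_zalg D d) i j"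
proof -
  interpret comm_group "zgrp D i j" by (rule zgrp_comm_group)
  show ?thesis
    using zone_closed[of i] g_closed[of i] g_closed[of "i - d"]
    by (auto simp: loc_rels_def dest!: keys_diff[THEN subsetD] split: if_splits)
qed

lemma zideal_loc_ideal: "zideal (path_zalg D d) (loc_ideal D d g)"
  unfolding loc_ideal_def by (rule P.zideal_gen) (rule loc_rels_closed)

lemma z_algebra_zloc: "z_algebra B"
  unfolding zloc_def by (rule P.z_algebra_zquot[OF zideal_loc_ideal])

lemma loc_class_eqI:
  assumes "p - q \<in> loc_rels D d g i j"
    "p \<in> zcar (path_zalg D d) i j" "q \<in> zcar (path_zalg D d) i j"
  shows "zclass (path_zalg D d) (loc_ideal D d g) i j p = zclass (path_zalg D d) (loc_ideal D d g) i j q"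
proof (rule P.zclass_eqI[OF zideal_loc_ideal assms(2,3)])
  have "p \<otimes>\<^bsub>zgrp (path_zalg D d) i j\<^esub> inv\<^bsub>zgrp (path_zalg D d) i j\<^esub> q = p - q"
    using assms by (simp add: path_zalg_def)
  then show "p \<otimes>\<^bsub>zgrp (path_zalg D d) i j\<^esub> inv\<^bsub>zgrp (path_zalg D d) i j\<^esub> q \<in> loc_ideal D d g i j"
    using assms(1) P.zideal_gen_incl[of "loc_rels D d g"] unfolding loc_ideal_def by auto
qed

lemma im_closed [intro]: "a \<in> zcar D i j \<Longrightarrow> im i j a \<in> zcar B i j"
  unfolding loc_map_def zloc_def by (rule P.zclass_closed) simp

lemma loc_inv_closed: "loc_inv D d g i \<in> zcar B (i + d) i"
  unfolding loc_inv_def zloc_def by (rule P.zclass_closed) simp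

lemma im_add:
  assumes "a \<in> zcar D i j" "b \<in> zcar D i j"
  shows "im i j (a \<otimes>\<^bsub>zgrp D i j\<^esub> b) = im i j a \<otimes>\<^bsub>zgrp B i j\<^esub> im i j b"
proof -
  interpret comm_group "zgrp D i j" by (rule zgrp_comm_group)
  have "frag_of [Elt i j a] \<in> zcar (path_zalg D d) i j" "frag_of [Elt i j b] \<in> zcar (path_zalg D d) i j"
    using assms by simp_all
  then have "im i j a \<otimes>\<^bsub>zgrp B i j\<^esub> im i j b = zclass (path_zalg D d) (loc_ideal D d g) i j
      (frag_of [Elt i j a] \<otimes>\<^bsub>zgrp (path_zalg D d) i j\<^esub> frag_of [Elt i j b])"
    using P.zclass_add[OF zideal_loc_ideal] by (simp add: loc_map_def zloc_def)
  also have "\<dots> = zclass (path_zalg D d) (loc_ideal D d g) i j (frag_of [Elt i j a] + frag_of [Elt i j b])"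
    by (simp add: path_zalg_def)
  also have "\<dots> = im i j (a \<otimes>\<^bsub>zgrp D i j\<^esub> b)"
    unfolding loc_map_def
  proof (rule loc_class_eqI[symmetric])
    show "frag_of [Elt i j (a \<otimes>\<^bsub>zgrp D i j\<^esub> b)] - (frag_of [Elt i j a] + frag_of [Elt i j b]) \<in> loc_rels D d g i j"
      using assms by (auto simp: loc_rels_def diff_diff_eq)
    show "frag_of [Elt i j a] + frag_of [Elt i j b] \<in> zcar (path_zalg D d) i j"
      using assms keys_add[of "frag_of [Elt i j a]" "frag_of [Elt i j b]"] by auto
  qed (use assms in auto)
  finally show ?thesis ..
qed

lemma im_mult:
  assumes "a \<in> zcar D i l" "b \<in> zcar D l j"
  shows "im i j (zmult D i l j a b) = zmult B i l j (im i l a) (im l j b)"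
proof -
  have "frag_of [Elt i l a] \<in> zcar (path_zalg D d) i l" "frag_of [Elt l j b] \<in> zcar (path_zalg D d) l j"
    using assms by simp_all
  then have "zmult B i l j (im i l a) (im l j b) = zclass (path_zalg D d) (loc_ideal D d g) i j
      (zmult (path_zalg D d) i l j (frag_of [Elt i l a]) (frag_of [Elt l j b]))"
    using P.zclass_mult[OF zideal_loc_ideal] by (simp add: loc_map_def zloc_def)
  also have "\<dots> = zclass (path_zalg D d) (loc_ideal D d g) i j (frag_of [Elt i l a, Elt l j b])"
    by (simp add: path_zalg_def)
  also have "\<dots> = im i j (zmult D i l j a b)"
    unfolding loc_map_def
  proof (rule loc_class_eqI)
    show "frag_of [Elt i l a, Elt l j b] - frag_of [Elt i j (zmult D i l j a b)] \<in> loc_rels D d g i j"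
      using assms by (auto simp: loc_rels_def)
  qed (use assms in auto)
  finally show ?thesis ..
qed

lemma zone_zloc: "zone B i = zclass (path_zalg D d) (loc_ideal D d g) i i (frag_of [])"
  by (simp add: zloc_def zquot_def path_zalg_def)

lemma im_zone: "im i i (zone D i) = zone B i"
  unfolding zone_zloc loc_map_def
  by (rule loc_class_eqI) (use zone_closed in \<open>auto simp: loc_rels_def\<close>)

lemma g_loc_inv: "zmult B i (i + d) i (im i (i + d) (g i)) (loc_inv D d g i) = zone B i"
proof -
  have "frag_of [Elt i (i + d) (g i)] \<in> zcar (path_zalg D d) i (i + d)"
    "frag_of [Inv i] \<in> zcar (path_zalg D d) (i + d) i"
    using g_closed by simp_all
  then have "zmult B i (i + d) i (im i (i + d) (g i)) (loc_inv D d g i) =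
      zclass (path_zalg D d) (loc_ideal D d g) i i
        (zmult (path_zalg D d) i (i + d) i (frag_of [Elt i (i + d) (g i)]) (frag_of [Inv i]))"
    using P.zclass_mult[OF zideal_loc_ideal] by (simp add: loc_map_def loc_inv_def zloc_def)
  also have "\<dots> = zclass (path_zalg D d) (loc_ideal D d g) i i (frag_of [Elt i (i + d) (g i), Inv i])"
    by (simp add: path_zalg_def)
  also have "\<dots> = zone B i"
    unfolding zone_zloc by (rule loc_class_eqI) (use g_closed in \<open>auto simp: loc_rels_def\<close>)
  finally show ?thesis .
qed

lemma loc_inv_g: "zmult B (i + d) i (i + d) (loc_inv D d g i) (im i (i + d) (g i)) = zone B (i + d)"
proof -
  have "frag_of [Elt i (i + d) (g i)] \<in> zcar (path_zalg D d) i (i + d)"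
    "frag_of [Inv i] \<in> zcar (path_zalg D d) (i + d) i"
    using g_closed by simp_all
  then have "zmult B (i + d) i (i + d) (loc_inv D d g i) (im i (i + d) (g i)) =
      zclass (path_zalg D d) (loc_ideal D d g) (i + d) (i + d)
        (zmult (path_zalg D d) (i + d) i (i + d) (frag_of [Inv i]) (frag_of [Elt i (i + d) (g i)]))"
    using P.zclass_mult[OF zideal_loc_ideal] by (simp add: loc_map_def loc_inv_def zloc_def)
  also have "\<dots> = zclass (path_zalg D d) (loc_ideal D d g) (i + d) (i + d) (frag_of [Inv i, Elt i (i + d) (g i)])"
    by (simp add: path_zalg_def)
  also have "\<dots> = zone B (i + d)"
    unfolding zone_zloc by (rule loc_class_eqI) (use g_closed in \<open>auto simp: loc_rels_def\<close>)
  finally show ?thesis .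
qed

end

section \<open>The tensor algebra\<close>

locale bimodule_sequence =
  fixes K :: "int \<Rightarrow> 'k ring" and W :: "int \<Rightarrow> ('k, 'v) bimod"
  assumes bimodule: "\<And>i. bimodule (K i) (K (i + 1)) (W i)"
begin

lemma left_module: "module (K i) (W i)"
  using bimodule[of i] by (simp add: bimodule_def)

lemma right_module: "module (K (i + 1)) (right_module (W i))"
  using bimodule[of i] by (simp add: bimodule_def)

lemma K_cring: "cring (K i)"
  using left_module[of i] by (simp add: module_def)

lemma W_add_closed [simp]:
  "x \<in> carrier (W i) \<Longrightarrow> y \<in> carrier (W i) \<Longrightarrow> x \<oplus>\<^bsub>W i\<^esub> y \<in> carrier (W i)"
  by (rule abelian_groupE(1)[OF module.axioms(2)[OF left_module]])

lemma smult_closed [simp]: "a \<in> carrier (K i) \<Longrightarrow> x \<in> carrier (W i) \<Longrightarrow> smult (W i) a x \<in> carrier (W i)"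
  using module.smult_closed[OF left_module] .

lemma rsmult_closed [simp]: "a \<in> carrier (K (i + 1)) \<Longrightarrow> x \<in> carrier (W i) \<Longrightarrow> rsmult (W i) x a \<in> carrier (W i)"
  using module.smult_closed[OF right_module, of a i x] by simp

lemma smult_rsmult:
  "\<lbrakk>a \<in> carrier (K i); x \<in> carrier (W i); b \<in> carrier (K (i + 1))\<rbrakk>
    \<Longrightarrow> rsmult (W i) (smult (W i) a x) b = smult (W i) a (rsmult (W i) x b)"
  using bimodule[of i] by (simp add: bimodule_def)

lemma smult_add:
  "\<lbrakk>a \<in> carrier (K i); x \<in> carrier (W i); y \<in> carrier (W i)\<rbrakk>
    \<Longrightarrow> smult (W i) a (x \<oplus>\<^bsub>W i\<^esub> y) = smult (W i) a x \<oplus>\<^bsub>W i\<^esub> smult (W i) a y"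
  using module.smult_r_distr[OF left_module] .

lemma smult_add_scalar:
  "\<lbrakk>a \<in> carrier (K i); b \<in> carrier (K i); x \<in> carrier (W i)\<rbrakk>
    \<Longrightarrow> smult (W i) (a \<oplus>\<^bsub>K i\<^esub> b) x = smult (W i) a x \<oplus>\<^bsub>W i\<^esub> smult (W i) b x"
  using module.smult_l_distr[OF left_module] .

lemma rsmult_add:
  "\<lbrakk>a \<in> carrier (K (i + 1)); x \<in> carrier (W i); y \<in> carrier (W i)\<rbrakk>
    \<Longrightarrow> rsmult (W i) (x \<oplus>\<^bsub>W i\<^esub> y) a = rsmult (W i) x a \<oplus>\<^bsub>W i\<^esub> rsmult (W i) y a"
  using module.smult_r_distr[OF right_module, of a i x y] by simp

lemma rsmult_add_scalar:
  "\<lbrakk>a \<in> carrier (K (i + 1)); b \<in> carrier (K (i + 1)); x \<in> carrier (W i)\<rbrakk>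
    \<Longrightarrow> rsmult (W i) x (a \<oplus>\<^bsub>K (i + 1)\<^esub> b) = rsmult (W i) x a \<oplus>\<^bsub>W i\<^esub> rsmult (W i) x b"
  using module.smult_l_distr[OF right_module, of a i b x] by simp

abbreviation words :: "int \<Rightarrow> int \<Rightarrow> 'v list set" where
  "words \<equiv> tens_words W"

lemma words_Nil [simp]: "[] \<in> words i j \<longleftrightarrow> i = j"
  by (auto simp: tens_words_def)

lemma words_Cons [simp]: "v # s \<in> words i j \<longleftrightarrow> v \<in> carrier (W i) \<and> s \<in> words (i + 1) j"
proof -
  have "(\<forall>n<Suc (length s). (v # s) ! n \<in> carrier (W (i + int n))) \<longleftrightarrow>
      v \<in> carrier (W i) \<and> (\<forall>n<length s. s ! n \<in> carrier (W (i + 1 + int n)))"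
    by (simp add: All_less_Suc2 ac_simps)
  then show ?thesis
    by (auto simp: tens_words_def)
qed

lemma words_append [simp]:
  "s @ t \<in> words i j \<longleftrightarrow> s \<in> words i (i + int (length s)) \<and> t \<in> words (i + int (length s)) j"
  by (induction s arbitrary: i) (auto simp: ac_simps)

lemma words_length: "s \<in> words i j \<Longrightarrow> j = i + int (length s)"
  by (simp add: tens_words_def)

abbreviation free :: "int \<Rightarrow> int \<Rightarrow> ('v list \<Rightarrow>\<^sub>0 int) monoid" where
  "free i j \<equiv> free_Abelian_group (words i j)"

abbreviation null :: "int \<Rightarrow> int \<Rightarrow> ('v list \<Rightarrow>\<^sub>0 int) set" where
  "null \<equiv> tens_null K W"

abbreviation cls :: "int \<Rightarrow> int \<Rightarrow> ('v list \<Rightarrow>\<^sub>0 int) \<Rightarrow> ('v list \<Rightarrow>\<^sub>0 int) set" where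
  "cls \<equiv> tens_class K W"

lemma tens_rels_cases:
  assumes "r \<in> tens_rels K W i j"
  obtains (add) s x y t where
      "r = frag_of (s @ (x \<oplus>\<^bsub>W (i + int (length s))\<^esub> y) # t) - frag_of (s @ x # t) - frag_of (s @ y # t)"
      "s @ x # t \<in> words i j" "s @ y # t \<in> words i j"
  | (balance) s x a y t where
      "r = frag_of (s @ rsmult (W (i + int (length s))) x a # y # t)
         - frag_of (s @ x # smult (W (i + int (length s) + 1)) a y # t)"
      "s @ x # y # t \<in> words i j" "a \<in> carrier (K (i + int (length s) + 1))"
proof -
  consider (a) s x y t where
      "r = frag_of (s @ [x \<oplus>\<^bsub>W (i + int (length s))\<^esub> y] @ t) - frag_of (s @ [x] @ t) - frag_of (s @ [y] @ t)"
      "s @ [x] @ t \<in> words i j" "s @ [y] @ t \<in> words i j"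
    | (b) s x a y t where
      "r = frag_of (s @ [rsmult (W (i + int (length s))) x a, y] @ t)
         - frag_of (s @ [x, smult (W (i + int (length s) + 1)) a y] @ t)"
      "s @ [x, y] @ t \<in> words i j" "a \<in> carrier (K (i + int (length s) + 1))"
    using assms unfolding tens_rels_def by blast
  then show ?thesis
  proof cases
    case a
    show ?thesis by (rule add[of s x y t]) (use a in simp_all)
  next
    case b
    show ?thesis by (rule balance[of s x a y t]) (use b in simp_all)
  qed
qed

lemma null_add:
  assumes "s @ x # t \<in> words i j" "s @ y # t \<in> words i j" "k = i + int (length s)"
  shows "frag_of (s @ (x \<oplus>\<^bsub>W k\<^esub> y) # t) - frag_of (s @ x # t) - frag_of (s @ y # t) \<in> null i j"
proof -
  have "frag_of (s @ [x \<oplus>\<^bsub>W k\<^esub> y] @ t) - frag_of (s @ [x] @ t) - frag_of (s @ [y] @ t) \<in> tens_rels K W i j"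
    using assms unfolding tens_rels_def append_Cons append_Nil by blast
  then show ?thesis
    by (simp add: tens_null_def generate.incl)
qed

lemma null_balance:
  assumes "s @ x # y # t \<in> words i j" "k = i + int (length s)" "a \<in> carrier (K (k + 1))"
  shows "frag_of (s @ rsmult (W k) x a # y # t) - frag_of (s @ x # smult (W (k + 1)) a y # t) \<in> null i j"
proof -
  have "frag_of (s @ [rsmult (W k) x a, y] @ t) - frag_of (s @ [x, smult (W (k + 1)) a y] @ t) \<in> tens_rels K W i j"
    using assms unfolding tens_rels_def append_Cons append_Nil by blast
  then show ?thesis
    by (simp add: tens_null_def generate.incl)
qed

lemma rels_closed: "tens_rels K W i j \<subseteq> carrier (free i j)"
proof
  fix r assume "r \<in> tens_rels K W i j"
  then show "r \<in> carrier (free i j)"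
    by (cases rule: tens_rels_cases) (auto dest!: keys_diff[THEN subsetD] simp: add.assoc)
qed

lemma null_subgroup: "subgroup (null i j) (free i j)"
  unfolding tens_null_def using rels_closed by (simp add: group.generate_is_subgroup)

lemma null_zero [simp]: "0 \<in> null i j"
  using subgroup.one_closed[OF null_subgroup] by simp

lemma null_closed: "p \<in> null i j \<Longrightarrow> Poly_Mapping.keys p \<subseteq> words i j"
  using subgroup.mem_carrier[OF null_subgroup] by simp

lemma null_plus: "p \<in> null i j \<Longrightarrow> q \<in> null i j \<Longrightarrow> p + q \<in> null i j"
  using subgroup.m_closed[OF null_subgroup] by simp

lemma null_diff: "p \<in> null i j \<Longrightarrow> q \<in> null i j \<Longrightarrow> p - q \<in> null i j"
  using null_plus subgroup.m_inv_closed[OF null_subgroup] null_closed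
  by (metis diff_conv_add_uminus inv_free_Abelian_group)

lemma null_hom:
  assumes "group_hom (free i j) (free i' j') h" "\<And>r. r \<in> tens_rels K W i j \<Longrightarrow> h r \<in> null i' j'"
    "p \<in> null i j"
  shows "h p \<in> null i' j'"
  using group_hom.hom_generate_into[OF assms(1) null_subgroup rels_closed assms(2)] assms(3)
  by (simp add: tens_null_def)

lemma words_concat: "s \<in> words i j \<Longrightarrow> t \<in> words j l \<Longrightarrow> s @ t \<in> words i l"
  using words_length by fastforce

lemma concat_biadditive: "biadditive (free i j) (free j l) (free i l) concat_ext"
  by (rule biadditive_concat_ext) (rule words_concat)

lemma null_concat_left:
  assumes p: "p \<in> null i j" and q: "Poly_Mapping.keys q \<subseteq> words j l"
  shows "concat_ext p q \<in> null i l"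
  using q
proof (induction q rule: free_Abelian_group_induct[consumes 1, case_names zero diff frag])
  case (frag u)
  have "group_hom (free i j) (free i l) (\<lambda>p. concat_ext p (frag_of u))"
    using biadditive.hom_left[OF concat_biadditive] frag by simp
  then show ?case
  proof (rule null_hom[OF _ _ p])
    fix r assume "r \<in> tens_rels K W i j"
    then show "concat_ext r (frag_of u) \<in> null i l"
    proof (cases rule: tens_rels_cases)
      case (add s x y t)
      then show ?thesis
        using null_add[of s x "t @ u" i l y] words_concat[OF _ frag, of "s @ x # t" i] words_concat[OF _ frag, of "s @ y # t" i]
        by (simp add: concat_ext_diff_left)
    next
      case (balance s x a y t)
      then show ?thesis
        using null_balance[of s x y "t @ u" i l _ a] words_concat[OF _ frag, of "s @ x # y # t" i]
        by (simp add: concat_ext_diff_left)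
    qed
  qed
qed (auto simp: concat_ext_diff_right null_diff)

lemma null_concat_right:
  assumes p: "Poly_Mapping.keys p \<subseteq> words i j" and q: "q \<in> null j l"
  shows "concat_ext p q \<in> null i l"
  using p
proof (induction p rule: free_Abelian_group_induct[consumes 1, case_names zero diff frag])
  case (frag u)
  have "group_hom (free j l) (free i l) (concat_ext (frag_of u))"
    using biadditive.hom_right[OF concat_biadditive] frag by simp
  then show ?case
  proof (rule null_hom[OF _ _ q])
    fix r assume "r \<in> tens_rels K W j l"
    then show "concat_ext (frag_of u) r \<in> null i l"
    proof (cases rule: tens_rels_cases)
      case (add s x y t)
      then show ?thesis
        using null_add[of "u @ s" x t i l y] words_concat[OF frag, of "s @ x # t" l] words_concat[OF frag, of "s @ y # t" l]
          words_length[OF frag]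
        by (simp add: concat_ext_diff_right add.assoc)
    next
      case (balance s x a y t)
      then show ?thesis
        using null_balance[of "u @ s" x y t i l _ a] words_concat[OF frag, of "s @ x # y # t" l] words_length[OF frag]
        by (simp add: concat_ext_diff_right add.assoc)
    qed
  qed
qed (auto simp: concat_ext_diff_left null_diff)

definition lact :: "int \<Rightarrow> 'k \<Rightarrow> ('v list \<Rightarrow>\<^sub>0 int) \<Rightarrow> ('v list \<Rightarrow>\<^sub>0 int)" where
  "lact i a = frag_extend (\<lambda>t. frag_of (lact_word (W i) a t))"

definition ract :: "int \<Rightarrow> ('v list \<Rightarrow>\<^sub>0 int) \<Rightarrow> 'k \<Rightarrow> ('v list \<Rightarrow>\<^sub>0 int)" where
  "ract j p b = frag_extend (\<lambda>s. frag_of (ract_word (W (j - 1)) s b)) p"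

lemma lact_word_closed: "i < j \<Longrightarrow> a \<in> carrier (K i) \<Longrightarrow> s \<in> words i j \<Longrightarrow> lact_word (W i) a s \<in> words i j"
  by (cases s) (auto simp: lact_word_def)

lemma ract_word_closed:
  assumes "i < j" "b \<in> carrier (K j)" "s \<in> words i j"
  shows "ract_word (W (j - 1)) s b \<in> words i j"
proof (cases s rule: rev_cases)
  case Nil
  then show ?thesis using assms by simp
next
  case (snoc s' v)
  then have "j - 1 = i + int (length s')"
    using words_length[OF assms(3)] by simp
  then show ?thesis
    using snoc assms rsmult_closed[of b "j - 1" v] by (simp add: ract_word_def flip: \<open>j - 1 = _\<close>)
qed

lemma lact_hom: "i < j \<Longrightarrow> a \<in> carrier (K i) \<Longrightarrow> group_hom (free i j) (free i j) (lact i a)"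
  unfolding lact_def by (rule group_hom_frag_extend) (simp add: lact_word_closed)

lemma ract_hom: "i < j \<Longrightarrow> b \<in> carrier (K j) \<Longrightarrow> group_hom (free i j) (free i j) (\<lambda>p. ract j p b)"
  unfolding ract_def by (rule group_hom_frag_extend) (simp add: ract_word_closed)

lemma lact_null:
  assumes "i < j" "a \<in> carrier (K i)" "p \<in> null i j"
  shows "lact i a p \<in> null i j"
proof (rule null_hom[OF lact_hom[OF assms(1,2)] _ assms(3)])
  fix r assume "r \<in> tens_rels K W i j"
  then show "lact i a r \<in> null i j"
  proof (cases rule: tens_rels_cases)
    case (add s x y t)
    then show ?thesis
      using null_add[of "[]" "smult (W i) a x" t i j "smult (W i) a y" i]
        null_add[of "smult (W i) a (hd s) # tl s" x t i j y "i + int (length s)"] assms(2)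
      by (cases s) (auto simp: lact_def frag_extend_diff lact_word_def smult_add)
  next
    case (balance s x b y t)
    then show ?thesis
      using null_balance[of "[]" "smult (W i) a x" y t i j i b]
        null_balance[of "smult (W i) a (hd s) # tl s" x y t i j "i + int (length s)" b] assms(2)
      by (cases s) (auto simp: lact_def frag_extend_diff lact_word_def smult_rsmult)
  qed
qed

lemma ract_word_snoc [simp]: "ract_word M (s @ [v]) b = s @ [rsmult M v b]"
  by (simp add: ract_word_def)

lemma ract_word_append: "t \<noteq> [] \<Longrightarrow> ract_word M (s @ t) b = s @ ract_word M t b"
  by (simp add: ract_word_def butlast_append)

lemma ract_word_Cons: "t \<noteq> [] \<Longrightarrow> ract_word M (v # t) b = v # ract_word M t b"
  by (simp add: ract_word_def)

lemma ract_word_single: "ract_word M [v] b = [rsmult M v b]"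
  by (simp add: ract_word_def)

lemma ract_null:
  assumes "i < j" "b \<in> carrier (K j)" "p \<in> null i j"
  shows "ract j p b \<in> null i j"
proof (rule null_hom[OF ract_hom[OF assms(1,2)] _ assms(3)])
  fix r assume "r \<in> tens_rels K W i j"
  then show "ract j r b \<in> null i j"
  proof (cases rule: tens_rels_cases)
    case (add s x y t)
    show ?thesis
    proof (cases "t = []")
      case True
      then have j: "i + int (length s) = j - 1"
        using words_length[OF add(2)] by simp
      have "rsmult (W (j - 1)) x b \<in> carrier (W (j - 1))" "rsmult (W (j - 1)) y b \<in> carrier (W (j - 1))"
        "rsmult (W (j - 1)) (x \<oplus>\<^bsub>W (j - 1)\<^esub> y) b = rsmult (W (j - 1)) x b \<oplus>\<^bsub>W (j - 1)\<^esub> rsmult (W (j - 1)) y b"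
        using add True assms(2) j rsmult_closed[of b "j - 1" x] rsmult_closed[of b "j - 1" y]
          rsmult_add[of b "j - 1" x y] by auto
      then show ?thesis
        using add True j assms(2) null_add[of s "rsmult (W (j - 1)) x b" "[]" i j "rsmult (W (j - 1)) y b" "j - 1", OF _ _ j[symmetric]]
        by (simp add: ract_def frag_extend_diff)
    next
      case False
      have "ract_word (W (j - 1)) (s @ x # t) b \<in> words i j" "ract_word (W (j - 1)) (s @ y # t) b \<in> words i j"
        using add assms by (auto intro!: ract_word_closed simp del: words_append)
      then show ?thesis
        using False add null_add[of s x "ract_word (W (j - 1)) t b" i j y "i + int (length s)"]
        by (simp add: ract_def frag_extend_diff ract_word_append ract_word_Cons)
    qed
  next
    case (balance s x a y t)
    show ?thesis
    proof (cases "t = []")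
      case True
      then have j: "i + int (length s) = j - 2"
        using words_length[OF balance(2)] by simp
      have "rsmult (W (j - 1)) y b \<in> carrier (W (j - 1))"
        "rsmult (W (j - 1)) (smult (W (j - 1)) a y) b = smult (W (j - 1)) a (rsmult (W (j - 1)) y b)"
        using balance True assms(2) j smult_rsmult[of a "j - 1" y b] rsmult_closed[of b "j - 1" y] by auto
      then show ?thesis
        using balance True assms(2) j null_balance[of s x "rsmult (W (j - 1)) y b" "[]" i j "j - 2" a, OF _ j[symmetric]]
        by (simp add: ract_def frag_extend_diff ract_word_append ract_word_Cons ract_word_single)
    next
      case False
      have "ract_word (W (j - 1)) (s @ x # y # t) b \<in> words i j"
        using balance assms by (auto intro!: ract_word_closed simp del: words_append)
      then show ?thesis
        using False balance null_balance[of s x y "ract_word (W (j - 1)) t b" i j "i + int (length s)" a]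
        by (simp add: ract_def frag_extend_diff ract_word_append ract_word_Cons)
    qed
  qed
qed

lemma lact_add_scalar:
  assumes "i < j" "a \<in> carrier (K i)" "b \<in> carrier (K i)" "Poly_Mapping.keys p \<subseteq> words i j"
  shows "lact i (a \<oplus>\<^bsub>K i\<^esub> b) p - lact i a p - lact i b p \<in> null i j"
  using assms(4)
proof (induction p rule: free_Abelian_group_induct[consumes 1, case_names zero diff frag])
  case (diff p q)
  have "lact i (a \<oplus>\<^bsub>K i\<^esub> b) (p - q) - lact i a (p - q) - lact i b (p - q) =
     (lact i (a \<oplus>\<^bsub>K i\<^esub> b) p - lact i a p - lact i b p) - (lact i (a \<oplus>\<^bsub>K i\<^esub> b) q - lact i a q - lact i b q)"
    by (simp add: lact_def frag_extend_diff algebra_simps)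
  then show ?case using diff null_diff by metis
next
  case (frag s)
  then show ?case
    using assms(1-3) null_add[of "[]" "smult (W i) a (hd s)" "tl s" i j "smult (W i) b (hd s)" i]
    by (cases s) (auto simp: lact_def lact_word_def smult_add_scalar)
qed (simp add: lact_def)

lemma ract_add_scalar:
  assumes "i < j" "a \<in> carrier (K j)" "b \<in> carrier (K j)" "Poly_Mapping.keys p \<subseteq> words i j"
  shows "ract j p (a \<oplus>\<^bsub>K j\<^esub> b) - ract j p a - ract j p b \<in> null i j"
  using assms(4)
proof (induction p rule: free_Abelian_group_induct[consumes 1, case_names zero diff frag])
  case (diff p q)
  have "ract j (p - q) (a \<oplus>\<^bsub>K j\<^esub> b) - ract j (p - q) a - ract j (p - q) b =
     (ract j p (a \<oplus>\<^bsub>K j\<^esub> b) - ract j p a - ract j p b) - (ract j q (a \<oplus>\<^bsub>K j\<^esub> b) - ract j q a - ract j q b)"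
    by (simp add: ract_def frag_extend_diff algebra_simps)
  then show ?case using diff null_diff by metis
next
  case (frag s)
  show ?case
  proof (cases s rule: rev_cases)
    case Nil
    then show ?thesis using frag assms(1) by simp
  next
    case (snoc t v)
    then have j: "i + int (length t) = j - 1"
      using words_length[OF frag] by simp
    then show ?thesis
      using frag snoc assms(2,3) null_add[of t "rsmult (W (j - 1)) v a" "[]" i j "rsmult (W (j - 1)) v b" "j - 1", OF _ _ j[symmetric]]
        rsmult_add_scalar[of a "j - 1" b v] rsmult_closed[of a "j - 1" v] rsmult_closed[of b "j - 1" v]
      by (simp add: ract_def)
  qed
qed (simp add: ract_def)

end

lemma comm_group_relabel:
  assumes "comm_group G" "\<And>x. p (f x) = x"
  shows "comm_group \<lparr>carrier = f ` carrier G, monoid.mult = (\<lambda>X Y. f (p X \<otimes>\<^bsub>G\<^esub> p Y)), monoid.one = f \<one>\<^bsub>G\<^esub>\<rparr>"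
proof -
  interpret G: comm_group G by fact
  show ?thesis
    by (rule comm_groupI) (auto simp: assms(2) G.m_ac intro!: bexI[OF _ G.inv_closed])
qed

context bimodule_sequence
begin

lemma cls_eqI: "p - q \<in> null i j \<Longrightarrow> Poly_Mapping.keys p \<subseteq> words i j \<Longrightarrow> Poly_Mapping.keys q \<subseteq> words i j
    \<Longrightarrow> cls i j p = cls i j q"
  unfolding tens_class_def
  by (subst comm_group.rcos_eq_iff[OF abelian_free_Abelian_group null_subgroup]) auto

lemma tens_grp_comm_group: "comm_group (tens_grp K W i j)"
  unfolding tens_grp_def by (rule comm_group.abelian_FactGroup[OF abelian_free_Abelian_group null_subgroup])

lemma carrier_tens_grp: "carrier (tens_grp K W i j) = cls i j ` {p. Poly_Mapping.keys p \<subseteq> words i j}"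
  by (auto simp: tens_grp_def tens_class_def carrier_FactGroup)

lemma cls_add:
  "Poly_Mapping.keys p \<subseteq> words i j \<Longrightarrow> Poly_Mapping.keys q \<subseteq> words i j
    \<Longrightarrow> cls i j p \<otimes>\<^bsub>tens_grp K W i j\<^esub> cls i j q = cls i j (p + q)"
  using comm_group.rcos_sum_subgroup[OF abelian_free_Abelian_group null_subgroup]
  by (simp add: tens_grp_def tens_class_def)

lemma T_grp_comm_group: "comm_group (T_grp K W i j)"
proof (cases "i = j")
  case True
  have "comm_group (add_monoid (K i))"
    using K_cring abelian_group.a_comm_group cring.axioms(1) ring.is_abelian_group by blast
  then show ?thesis
    using comm_group_relabel[of "add_monoid (K i)" projl Inl] True by (simp add: T_grp_def)
next
  case False
  then show ?thesis
    using comm_group_relabel[OF tens_grp_comm_group, of projr Inr] by (simp add: T_grp_def)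
qed

lemma carrier_T_grp_diag: "carrier (T_grp K W i i) = Inl ` carrier (K i)"
  by (simp add: T_grp_def)

lemma carrier_T_grp: "i \<noteq> j \<Longrightarrow> carrier (T_grp K W i j) = (\<lambda>p. Inr (cls i j p)) ` {p. Poly_Mapping.keys p \<subseteq> words i j}"
  by (auto simp: T_grp_def carrier_tens_grp)

lemma T_add_diag: "Inl a \<otimes>\<^bsub>T_grp K W i i\<^esub> Inl b = Inl (a \<oplus>\<^bsub>K i\<^esub> b)"
  by (simp add: T_grp_def)

lemma T_add:
  "i \<noteq> j \<Longrightarrow> Poly_Mapping.keys p \<subseteq> words i j \<Longrightarrow> Poly_Mapping.keys q \<subseteq> words i j
    \<Longrightarrow> Inr (cls i j p) \<otimes>\<^bsub>T_grp K W i j\<^esub> Inr (cls i j q) = Inr (cls i j (p + q))"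
  by (simp add: T_grp_def cls_add)

lemma T_mult_Inl_Inl: "T_mult K W i i i (Inl a) (Inl b) = Inl (a \<otimes>\<^bsub>K i\<^esub> b)"
  by (simp add: T_mult_def)

lemma T_mult_Inl_Inr:
  assumes "i < l" "a \<in> carrier (K i)" "Poly_Mapping.keys q \<subseteq> words i l"
  shows "T_mult K W i i l (Inl a) (Inr (cls i l q)) = Inr (cls i l (lact i a q))"
  using group_hom.hom_coset[OF lact_hom[OF assms(1,2)] abelian_free_Abelian_group abelian_free_Abelian_group
      null_subgroup null_subgroup lact_null[OF assms(1,2)], of q] assms
  by (simp add: T_mult_def tens_class_def lact_def)

lemma T_mult_Inr_Inl:
  assumes "i < l" "b \<in> carrier (K l)" "Poly_Mapping.keys p \<subseteq> words i l"
  shows "T_mult K W i l l (Inr (cls i l p)) (Inl b) = Inr (cls i l (ract l p b))"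
  using group_hom.hom_coset[OF ract_hom[OF assms(1,2)] abelian_free_Abelian_group abelian_free_Abelian_group
      null_subgroup null_subgroup ract_null[OF assms(1,2)], of p] assms
  by (simp add: T_mult_def tens_class_def ract_def)

lemma concat_quotient:
  "biadditive_quotient (free i j) (free j l) (free i l) concat_ext (null i j) (null j l) (null i l)"
  by (rule biadditive_quotient.intro[OF concat_biadditive])
    (auto simp: biadditive_quotient_axioms_def null_subgroup null_concat_left null_concat_right)

lemma T_mult_Inr_Inr:
  assumes "i < j" "j < l" "Poly_Mapping.keys p \<subseteq> words i j" "Poly_Mapping.keys q \<subseteq> words j l"
  shows "T_mult K W i j l (Inr (cls i j p)) (Inr (cls j l q)) = Inr (cls i l (concat_ext p q))"
  using biadditive_quotient.quot_map_coset[OF concat_quotient, of p i j q l] assms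
  by (simp add: T_mult_def tens_class_def biadditive_quotient.quot_map_def[OF concat_quotient])

lemma hom_closed_words:
  "group_hom (free i j) (free i' j') h \<Longrightarrow> Poly_Mapping.keys p \<subseteq> words i j \<Longrightarrow> Poly_Mapping.keys (h p) \<subseteq> words i' j'"
  using group_hom.hom_closed[of "free i j" "free i' j'" h p] by simp

lemma keys_plus_subset:
  "Poly_Mapping.keys p \<subseteq> words i j \<Longrightarrow> Poly_Mapping.keys q \<subseteq> words i j \<Longrightarrow> Poly_Mapping.keys (p + q) \<subseteq> words i j"
  using keys_add[of p q] by blast

lemma T_biadditive: "biadditive (T_grp K W i j) (T_grp K W j l) (T_grp K W i l) (T_mult K W i j l)"
proof -
  interpret L: comm_group "T_grp K W i l" by (rule T_grp_comm_group)
  consider "\<not> (i \<le> j \<and> j \<le> l)" | "i = j" "j = l" | "i = j" "j < l" | "i < j" "j = l" | "i < j" "j < l"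
    by linarith
  then have "biadditive_axioms (T_grp K W i j) (T_grp K W j l) (T_grp K W i l) (T_mult K W i j l)"
  proof cases
    case 1
    then have "T_mult K W i j l = (\<lambda>X Y. \<one>\<^bsub>T_grp K W i l\<^esub>)"
      by (auto simp: fun_eq_iff T_mult_def)
    then show ?thesis
      by (simp add: biadditive_axioms_def)
  next
    case 2
    interpret cring "K l" by (rule K_cring)
    show ?thesis
      using 2 by (auto simp: biadditive_axioms_def carrier_T_grp_diag T_add_diag T_mult_Inl_Inl l_distr r_distr)
  next
    case 3
    interpret cring "K j" by (rule K_cring)
    have cl: "Poly_Mapping.keys (lact j a q) \<subseteq> words j l" if "a \<in> carrier (K j)" "Poly_Mapping.keys q \<subseteq> words j l" for a q
      using lact_hom 3 that hom_closed_words by blast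
    have "cls j l (lact j (a \<oplus>\<^bsub>K j\<^esub> b) q) = cls j l (lact j a q + lact j b q)"
      if "a \<in> carrier (K j)" "b \<in> carrier (K j)" "Poly_Mapping.keys q \<subseteq> words j l" for a b q
      using that 3 lact_add_scalar[of j l a b q] by (intro cls_eqI cl keys_plus_subset) (auto simp: diff_diff_eq)
    moreover have "lact j a (p + q) = lact j a p + lact j a q" for a p q
      by (simp add: lact_def frag_extend_add)
    ultimately show ?thesis
      using 3 by (auto simp: biadditive_axioms_def carrier_T_grp_diag carrier_T_grp T_add_diag T_add T_mult_Inl_Inr
          cl keys_plus_subset)
  next
    case 4
    interpret cring "K l" by (rule K_cring)
    have cl: "Poly_Mapping.keys (ract l q a) \<subseteq> words i l" if "a \<in> carrier (K l)" "Poly_Mapping.keys q \<subseteq> words i l" for a q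
      using hom_closed_words[OF ract_hom] 4 that by blast
    have "cls i l (ract l q (a \<oplus>\<^bsub>K l\<^esub> b)) = cls i l (ract l q a + ract l q b)"
      if "a \<in> carrier (K l)" "b \<in> carrier (K l)" "Poly_Mapping.keys q \<subseteq> words i l" for a b q
      using that 4 ract_add_scalar[of i l a b q] by (intro cls_eqI cl keys_plus_subset) (auto simp: diff_diff_eq)
    moreover have "ract l (p + q) a = ract l p a + ract l q a" for a p q
      by (simp add: ract_def frag_extend_add)
    ultimately show ?thesis
      using 4 by (auto simp: biadditive_axioms_def carrier_T_grp_diag carrier_T_grp T_add_diag T_add T_mult_Inr_Inl
          cl keys_plus_subset)
  next
    case 5
    have cl: "Poly_Mapping.keys (concat_ext p q) \<subseteq> words i l"
      if "Poly_Mapping.keys p \<subseteq> words i j" "Poly_Mapping.keys q \<subseteq> words j l" for p q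
      using keys_concat_ext[OF that] words_concat by blast
    show ?thesis
      using 5 by (auto simp: biadditive_axioms_def carrier_T_grp T_add T_mult_Inr_Inr cl keys_plus_subset
          concat_ext_add_left concat_ext_add_right)
  qed
  then show ?thesis
    by (intro biadditive.intro T_grp_comm_group)
qed

lemma biadditive_zalg_T_alg: "biadditive_zalg (T_alg K W)"
  by (simp add: biadditive_zalg_def T_alg_def T_biadditive)

abbreviation pure :: "int \<Rightarrow> 'v list \<Rightarrow> ('k, 'v) tens" where
  "pure \<equiv> pure_tens K W"

lemma pure_closed:
  assumes "s \<in> words i j" "s \<noteq> []"
  shows "pure i s \<in> zcar (T_alg K W) i j"
  using assms words_length[OF assms(1)] by (auto simp: T_alg_def carrier_T_grp pure_tens_def)

lemma pure_concat:
  assumes "s \<in> words i j" "t \<in> words j l" "s \<noteq> []" "t \<noteq> []"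
  shows "zmult (T_alg K W) i j l (pure i s) (pure j t) = pure i (s @ t)"
proof -
  have "j = i + int (length s)" "l = j + int (length t)"
    using assms words_length by blast+
  then show ?thesis
    using assms T_mult_Inr_Inr[of i j l "frag_of s" "frag_of t"]
    by (simp add: T_alg_def pure_tens_def add.assoc)
qed

lemma pure_smult:
  assumes "a \<in> carrier (K i)" "v \<in> carrier (W i)"
  shows "zmult (T_alg K W) i i (i + 1) (Inl a) (pure i [v]) = pure i [smult (W i) a v]"
  using T_mult_Inl_Inr[of i "i + 1" a "frag_of [v]"] assms
  by (simp add: T_alg_def pure_tens_def lact_def lact_word_def)

lemma pure_add:
  assumes "s @ x # t \<in> words i j" "s @ y # t \<in> words i j"
  shows "pure i (s @ (x \<oplus>\<^bsub>W (i + int (length s))\<^esub> y) # t) = pure i (s @ x # t) \<otimes>\<^bsub>zgrp (T_alg K W) i j\<^esub> pure i (s @ y # t)"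
proof -
  have j: "j = i + int (length s) + 1 + int (length t)"
    using words_length[OF assms(1)] by simp
  have "cls i j (frag_of (s @ (x \<oplus>\<^bsub>W (i + int (length s))\<^esub> y) # t)) = cls i j (frag_of (s @ x # t) + frag_of (s @ y # t))"
    by (rule cls_eqI[OF _ _ keys_plus_subset]) (use assms null_add[OF assms refl] in \<open>auto simp: diff_diff_eq\<close>)
  then show ?thesis
    using assms j T_add[of i j "frag_of (s @ x # t)" "frag_of (s @ y # t)"]
    by (simp add: pure_tens_def T_alg_def ac_simps)
qed

lemma pure_balance:
  assumes "x \<in> carrier (W i)" "y \<in> carrier (W (i + 1))" "a \<in> carrier (K (i + 1))"
  shows "pure i [rsmult (W i) x a, y] = pure i [x, smult (W (i + 1)) a y]"
proof -
  have "cls i (i + 2) (frag_of [rsmult (W i) x a, y]) = cls i (i + 2) (frag_of [x, smult (W (i + 1)) a y])"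
    by (rule cls_eqI) (use assms null_balance[of "[]" x y "[]" i "i + 2" i a] in auto)
  then show ?thesis
    by (simp add: pure_tens_def)
qed

end


section \<open>The non-commutative symmetric algebra\<close>

locale symmetric_algebra = bimodule_sequence K W
  for K :: "int \<Rightarrow> 'k ring" and W :: "int \<Rightarrow> ('k, 'v) bimod" +
  fixes ev :: "int \<Rightarrow> 'v \<Rightarrow> 'v \<Rightarrow> 'k"
begin

abbreviation A :: "('k, 'v) tens set zalg" where
  "A \<equiv> nc_sym K W ev"

abbreviation S :: "int \<Rightarrow> 'v list \<Rightarrow> ('k, 'v) tens set" where
  "S \<equiv> sym_pure K W ev"

definition scalar :: "int \<Rightarrow> 'k \<Rightarrow> ('k, 'v) tens set" where
  "scalar i a = zclass (T_alg K W) (R_ideal K W ev) i i (Inl a)"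

interpretation T: biadditive_zalg "T_alg K W" by (rule biadditive_zalg_T_alg)

lemma Q_set_closed: "Q_set K W ev i \<subseteq> zcar (T_alg K W) i (i + 2)"
proof
  fix q assume "q \<in> Q_set K W ev i"
  then obtain a x y x' y' where q: "q = pure i [smult (W i) a x, x'] \<otimes>\<^bsub>zgrp (T_alg K W) i (i + 2)\<^esub> pure i [smult (W i) a y, y']"
    and a: "a \<in> carrier (K i)" and d: "dual_bases K W ev i x y x' y'"
    by (auto simp: Q_set_def T_alg_def)
  have "x \<in> carrier (W i)" "y \<in> carrier (W i)" "x' \<in> carrier (W (i + 1))" "y' \<in> carrier (W (i + 1))"
    using d by (auto simp: dual_bases_def right_basis_def left_basis_def)
  then show "q \<in> zcar (T_alg K W) i (i + 2)"
    unfolding q using a by (intro T.zadd_closed pure_closed) auto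
qed

lemma zideal_R: "zideal (T_alg K W) (R_ideal K W ev)"
  unfolding R_ideal_def by (rule T.zideal_gen) (use Q_set_closed in auto)

lemma biadditive_zalg_A: "biadditive_zalg A"
  unfolding nc_sym_def by (rule T.biadditive_zalg_zquot[OF zideal_R])

lemma zone_A: "zone A i = scalar i \<one>\<^bsub>K i\<^esub>"
  by (simp add: nc_sym_def zquot_def scalar_def T_alg_def)

lemma Inl_closed: "a \<in> carrier (K i) \<Longrightarrow> Inl a \<in> zcar (T_alg K W) i i"
  by (simp add: T_alg_def carrier_T_grp_diag)

lemma scalar_closed: "a \<in> carrier (K i) \<Longrightarrow> scalar i a \<in> zcar A i i"
  unfolding scalar_def nc_sym_def by (rule T.zclass_closed) (rule Inl_closed)

lemma zone_A_closed: "zone A i \<in> zcar A i i"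
  unfolding zone_A by (rule scalar_closed) (use K_cring[of i] in \<open>simp add: cring.cring_simprules\<close>)

lemma S_closed:
  assumes "s \<in> words i j" "s \<noteq> []"
  shows "S i s \<in> zcar A i j"
  using T.zclass_closed[OF pure_closed[OF assms]] words_length[OF assms(1)] by (simp add: sym_pure_def nc_sym_def)

lemma scalar_mult:
  assumes "a \<in> carrier (K i)" "b \<in> carrier (K i)"
  shows "zmult A i i i (scalar i a) (scalar i b) = scalar i (a \<otimes>\<^bsub>K i\<^esub> b)"
  using assms T.zclass_mult[OF zideal_R Inl_closed Inl_closed, of a i b]
  by (simp add: scalar_def nc_sym_def) (simp add: T_alg_def T_mult_Inl_Inl)

lemma scalar_S:
  assumes "a \<in> carrier (K i)" "v \<in> carrier (W i)"
  shows "zmult A i i (i + 1) (scalar i a) (S i [v]) = S i [smult (W i) a v]"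
  using assms T.zclass_mult[OF zideal_R Inl_closed pure_closed, of a i "[v]" "i + 1"]
  by (simp add: scalar_def sym_pure_def nc_sym_def pure_smult)

lemma S_mult:
  assumes "v \<in> carrier (W i)" "w \<in> carrier (W (i + 1))"
  shows "zmult A i (i + 1) (i + 2) (S i [v]) (S (i + 1) [w]) = S i [v, w]"
  using assms T.zclass_mult[OF zideal_R pure_closed pure_closed, of "[v]" i "i + 1" "[w]" "i + 2"]
    pure_concat[of "[v]" i "i + 1" "[w]" "i + 2"]
  by (simp add: sym_pure_def nc_sym_def add.commute[of 2 i])

lemma S_add:
  assumes "s @ x # t \<in> words i j" "s @ y # t \<in> words i j"
  shows "S i (s @ (x \<oplus>\<^bsub>W (i + int (length s))\<^esub> y) # t) = S i (s @ x # t) \<otimes>\<^bsub>zgrp A i j\<^esub> S i (s @ y # t)"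
  using assms words_length[OF assms(1)] words_length[OF assms(2)]
    T.zclass_add[OF zideal_R pure_closed[OF assms(1)] pure_closed[OF assms(2)]] pure_add[OF assms]
  by (simp add: sym_pure_def nc_sym_def ac_simps)

lemma S_balance:
  assumes "x \<in> carrier (W i)" "y \<in> carrier (W (i + 1))" "a \<in> carrier (K (i + 1))"
  shows "S i [rsmult (W i) x a, y] = S i [x, smult (W (i + 1)) a y]"
  using pure_balance[OF assms] by (simp add: sym_pure_def)

lemma S_relation:
  assumes "dual_bases K W ev i x y x' y'" "a \<in> carrier (K i)"
  shows "S i [smult (W i) a x, x'] \<otimes>\<^bsub>zgrp A i (i + 2)\<^esub> S i [smult (W i) a y, y'] = \<one>\<^bsub>zgrp A i (i + 2)\<^esub>"
proof -
  have c: "x \<in> carrier (W i)" "y \<in> carrier (W i)" "x' \<in> carrier (W (i + 1))" "y' \<in> carrier (W (i + 1))"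
    using assms by (auto simp: dual_bases_def right_basis_def left_basis_def)
  have q: "pure i [smult (W i) a x, x'] \<otimes>\<^bsub>zgrp (T_alg K W) i (i + 2)\<^esub> pure i [smult (W i) a y, y'] \<in> R_ideal K W ev i (i + 2)"
    unfolding R_ideal_def
    by (rule subsetD[OF T.zideal_gen_incl]) (simp add: Q_set_def T_alg_def, use assms in blast)
  have "pure i [smult (W i) a x, x'] \<in> zcar (T_alg K W) i (i + 2)" "pure i [smult (W i) a y, y'] \<in> zcar (T_alg K W) i (i + 2)"
    using assms c by (auto intro!: pure_closed)
  then show ?thesis
    using T.zclass_add[OF zideal_R, of _ i "i + 2"] T.zclass_eq_one[OF zideal_R q]
    by (simp add: sym_pure_def nc_sym_def)
qed

end

section \<open>Modules over a localized indexed algebra\<close>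

context z_algebra
begin

sublocale biadditive_zalg D by (rule biadditive_zalg)

lemma mult_inv_left:
  "a \<in> zcar D i j \<Longrightarrow> b \<in> zcar D j l \<Longrightarrow> zmult D i j l (inv\<^bsub>zgrp D i j\<^esub> a) b = inv\<^bsub>zgrp D i l\<^esub> zmult D i j l a b"
  using biadditive.inv_left[OF mult_biadditive] .

lemma one_zmult: "b \<in> zcar D j l \<Longrightarrow> zmult D i j l \<one>\<^bsub>zgrp D i j\<^esub> b = \<one>\<^bsub>zgrp D i l\<^esub>"
  using biadditive.one_left[OF mult_biadditive] .

lemma zmult_one: "a \<in> zcar D i j \<Longrightarrow> zmult D i j l a \<one>\<^bsub>zgrp D j l\<^esub> = \<one>\<^bsub>zgrp D i l\<^esub>"
  using biadditive.one_right[OF mult_biadditive] .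

lemma lmodule_hom_right_mult:
  assumes "c \<in> zcar D j l"
  shows "(\<lambda>a. zmult D i j l a c) \<in> lmodule_hom (zcar D i i) (zmod D i j) (zmod D i l)"
  using assms by (auto simp: lmodule_hom_def zmod_def distrib_right assoc)

lemma lmodule_iso_right_mult:
  assumes "c \<in> zcar D j l" "c' \<in> zcar D l j"
    and "zmult D j l j c c' = zone D j" "zmult D l j l c' c = zone D l"
  shows "(\<lambda>a. zmult D i j l a c) \<in> lmodule_iso (zcar D i i) (zmod D i j) (zmod D i l)"
proof -
  have "bij_betw (\<lambda>a. zmult D i j l a c) (zcar D i j) (zcar D i l)"
    by (rule bij_betw_byWitness[where f' = "\<lambda>b. zmult D i l j b c'"])
      (use assms in \<open>auto simp: assoc one_right\<close>)
  then show ?thesis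
    using lmodule_hom_right_mult[OF assms(1)] by (simp add: lmodule_iso_def zmod_def)
qed

lemma freely_generated_by_unit:
  assumes "c \<in> zcar D i j" "c' \<in> zcar D j i"
    and "zmult D i j i c c' = zone D i" "zmult D j i j c' c = zone D j"
  shows "freely_generated_by (zcar D i i) (zmod D i j) c"
proof -
  have "m = zmult D i i j (zmult D i j i m c') c" if "m \<in> zcar D i j" for m
    using that assms by (simp add: assoc one_right)
  moreover have "r = zmult D i j i (zmult D i i j r c) c'" if "r \<in> zcar D i i" for r
    using that assms by (simp add: assoc one_right)
  ultimately show ?thesis
    using assms unfolding freely_generated_by_def by (auto simp: zmod_def) metis+
qed

end

text \<open>
  Write \<open>G\<close>, \<open>H\<close>, \<open>J\<close> for \<open>g\<^sub>-\<^sub>1\<close>, \<open>g\<^sub>-\<^sub>2\<close>, \<open>g\<^sub>-\<^sub>3\<close>.  The four equations for \<open>H\<close> say that \<open>(1, 0)\<close> and \<open>(0, 1)\<close>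
  agree with \<open>x G\<^sup>-\<^sup>1 (p, q)\<close> and \<open>y G\<^sup>-\<^sup>1 (p, q)\<close> up to left multiples of \<open>(sx, sy)\<close>.
\<close>

locale presentation_data = z_algebra D
  for D :: "'a zalg" +
  fixes x y sx sy tx ty p q x2 y2 c e G G' H H' J J' p' q'
  assumes xy: "x \<in> zcar D 0 1" "y \<in> zcar D 0 1"
    and sxy: "sx \<in> zcar D (-1) 0" "sy \<in> zcar D (-1) 0"
    and txy: "tx \<in> zcar D (-2) (-1)" "ty \<in> zcar D (-2) (-1)"
    and pq: "p \<in> zcar D (-1) 0" "q \<in> zcar D (-1) 0"
    and xye2: "x2 \<in> zcar D (-2) (-1)" "y2 \<in> zcar D (-2) (-1)" "c \<in> zcar D (-2) (-1)" "e \<in> zcar D (-2) (-1)"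
    and pq': "p' \<in> zcar D (-3) (-2)" "q' \<in> zcar D (-3) (-2)"
    and G: "G \<in> zcar D (-1) 1" "G' \<in> zcar D 1 (-1)"
      "zmult D (-1) 1 (-1) G G' = zone D (-1)" "zmult D 1 (-1) 1 G' G = zone D 1"
    and H: "H \<in> zcar D (-2) 0" "H' \<in> zcar D 0 (-2)"
      "zmult D (-2) 0 (-2) H H' = zone D (-2)" "zmult D 0 (-2) 0 H' H = zone D 0"
    and J: "J \<in> zcar D (-3) (-1)" "J' \<in> zcar D (-1) (-3)"
      "zmult D (-1) (-3) (-1) J' J = zone D (-1)"
    and relation: "zmult D (-1) 0 1 sx x \<otimes>\<^bsub>zgrp D (-1) 1\<^esub> zmult D (-1) 0 1 sy y = \<one>\<^bsub>zgrp D (-1) 1\<^esub>"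
    and G_eq: "G = zmult D (-1) 0 1 p x \<otimes>\<^bsub>zgrp D (-1) 1\<^esub> zmult D (-1) 0 1 q y"
    and J_eq: "J = zmult D (-3) (-2) (-1) p' tx \<otimes>\<^bsub>zgrp D (-3) (-1)\<^esub> zmult D (-3) (-2) (-1) q' ty"
    and x2p: "zmult D (-2) (-1) 0 x2 p = H \<otimes>\<^bsub>zgrp D (-2) 0\<^esub> zmult D (-2) (-1) 0 c sx"
    and x2q: "zmult D (-2) (-1) 0 x2 q = zmult D (-2) (-1) 0 c sy"
    and y2p: "zmult D (-2) (-1) 0 y2 p = zmult D (-2) (-1) 0 e sx"
    and y2q: "zmult D (-2) (-1) 0 y2 q = H \<otimes>\<^bsub>zgrp D (-2) 0\<^esub> zmult D (-2) (-1) 0 e sy"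
begin

lemmas carriers = xy sxy txy pq xye2 pq' G(1,2) H(1,2) J(1,2)

abbreviation proj :: "'a \<times> 'a \<Rightarrow> 'a" where
  "proj \<equiv> \<lambda>(a, b). zmult D 0 0 1 a x \<otimes>\<^bsub>zgrp D 0 1\<^esub> zmult D 0 0 1 b y"

abbreviation entry :: "'a \<Rightarrow> 'a \<Rightarrow> 'a" where
  "entry s t \<equiv> zmult D 0 (-2) 0 H' (zmult D (-2) (-1) 0 s t)"

abbreviation diff :: "'a \<times> 'a \<Rightarrow> 'a \<times> 'a" where
  "diff \<equiv> \<lambda>(a, b).
     (zmult D 0 0 0 a (entry tx sx) \<otimes>\<^bsub>zgrp D 0 0\<^esub> zmult D 0 0 0 b (entry ty sx),
      zmult D 0 0 0 a (entry tx sy) \<otimes>\<^bsub>zgrp D 0 0\<^esub> zmult D 0 0 0 b (entry ty sy))"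

lemma proj_surj:
  assumes "m \<in> zcar D 0 1"
  shows "\<exists>a\<in>zcar D 0 0. \<exists>b\<in>zcar D 0 0. proj (a, b) = m"
proof -
  let ?m = "zmult D 0 1 (-1) m G'"
  have m: "?m \<in> zcar D 0 (-1)"
    using assms G by blast
  have "proj (zmult D 0 (-1) 0 ?m p, zmult D 0 (-1) 0 ?m q) = zmult D 0 (-1) 1 ?m G"
    unfolding G_eq using m carriers by (simp add: assoc distrib_left)
  also have "\<dots> = m"
    using assms G by (simp add: assoc one_right)
  finally show ?thesis
    using m carriers by blast
qed

lemma generated_minus_one:
  assumes "w \<in> zcar D 0 (-1)"
  shows "\<exists>r\<in>zcar D 0 0. \<exists>s\<in>zcar D 0 0. w = zmult D 0 (-2) (-1) (zmult D 0 0 (-2) r H') tx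
    \<otimes>\<^bsub>zgrp D 0 (-1)\<^esub> zmult D 0 (-2) (-1) (zmult D 0 0 (-2) s H') ty"
proof -
  let ?w = "zmult D 0 (-1) (-3) w J'"
  let ?r = "zmult D 0 (-2) 0 (zmult D 0 (-3) (-2) ?w p') H"
  let ?s = "zmult D 0 (-2) 0 (zmult D 0 (-3) (-2) ?w q') H"
  have w: "?w \<in> zcar D 0 (-3)"
    using assms J by blast
  have "zmult D 0 0 (-2) ?r H' = zmult D 0 (-3) (-2) ?w p'" "zmult D 0 0 (-2) ?s H' = zmult D 0 (-3) (-2) ?w q'"
    using w carriers H by (simp_all add: assoc one_right)
  moreover have "w = zmult D 0 (-3) (-1) ?w J"
    using assms J by (simp add: assoc one_right)
  then have "w = zmult D 0 (-2) (-1) (zmult D 0 (-3) (-2) ?w p') tx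
    \<otimes>\<^bsub>zgrp D 0 (-1)\<^esub> zmult D 0 (-2) (-1) (zmult D 0 (-3) (-2) ?w q') ty"
    using w carriers by (simp add: J_eq distrib_left assoc)
  moreover have "?r \<in> zcar D 0 0" "?s \<in> zcar D 0 0"
    using w carriers by blast+
  ultimately show ?thesis by metis
qed

lemma diff_eq:
  assumes "r \<in> zcar D 0 0" "s \<in> zcar D 0 0" 
    and "w = zmult D 0 (-2) (-1) (zmult D 0 0 (-2) r H') tx \<otimes>\<^bsub>zgrp D 0 (-1)\<^esub> zmult D 0 (-2) (-1) (zmult D 0 0 (-2) s H') ty"
  shows "diff (r, s) = (zmult D 0 (-1) 0 w sx, zmult D 0 (-1) 0 w sy)"
  using assms carriers by (simp add: assoc distrib_right)

lemma kernel_proj: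
  assumes ab: "a \<in> zcar D 0 0" "b \<in> zcar D 0 0" and "proj (a, b) = \<one>\<^bsub>zgrp D 0 1\<^esub>"
  shows "\<exists>w\<in>zcar D 0 (-1). a = zmult D 0 (-1) 0 w sx \<and> b = zmult D 0 (-1) 0 w sy"
proof -
  interpret g00: comm_group "zgrp D 0 0" by (rule grp)
  interpret g01: comm_group "zgrp D 0 1" by (rule grp)
  interpret g0m: comm_group "zgrp D 0 (-1)" by (rule grp)
  interpret gm1: comm_group "zgrp D (-2) 1" by (rule grp)
  let ?aH = "zmult D 0 0 (-2) a H'" and ?bH = "zmult D 0 0 (-2) b H'"
  have aH: "?aH \<in> zcar D 0 (-2)" "?bH \<in> zcar D 0 (-2)"
    using ab carriers by blast+
  define w where "w = zmult D 0 (-2) (-1) ?aH c \<otimes>\<^bsub>zgrp D 0 (-1)\<^esub> zmult D 0 (-2) (-1) ?bH e"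
  have w: "w \<in> zcar D 0 (-1)"
    using aH carriers by (auto simp: w_def)
  define u where "u = zmult D 0 (-2) (-1) ?aH x2 \<otimes>\<^bsub>zgrp D 0 (-1)\<^esub> zmult D 0 (-2) (-1) ?bH y2"
  have u: "u \<in> zcar D 0 (-1)"
    using aH carriers by (auto simp: u_def)
  have rel: "zmult D (-2) 0 1 (zmult D (-2) (-1) 0 z sx) x \<otimes>\<^bsub>zgrp D (-2) 1\<^esub> zmult D (-2) 0 1 (zmult D (-2) (-1) 0 z sy) y
      = \<one>\<^bsub>zgrp D (-2) 1\<^esub>" if "z \<in> zcar D (-2) (-1)" for z
    using that carriers relation by (simp add: assoc zmult_one flip: distrib_left)
  have mG: "zmult D (-2) (-1) 1 z G = zmult D (-2) 0 1 (zmult D (-2) (-1) 0 z p) x \<otimes>\<^bsub>zgrp D (-2) 1\<^esub>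
      zmult D (-2) 0 1 (zmult D (-2) (-1) 0 z q) y" if "z \<in> zcar D (-2) (-1)" for z
    using that carriers by (simp add: G_eq assoc distrib_left)
  have x2G: "zmult D (-2) (-1) 1 x2 G = zmult D (-2) 0 1 H x"
    using rel[of c] carriers by (simp add: mG x2p x2q distrib_right gm1.m_assoc)
  have y2G: "zmult D (-2) (-1) 1 y2 G = zmult D (-2) 0 1 H y"
    using rel[of e] carriers by (simp add: mG y2p y2q distrib_right gm1.m_lcomm)
  have "zmult D 0 (-1) 1 u G = proj (zmult D 0 (-2) 0 ?aH H, zmult D 0 (-2) 0 ?bH H)"
    using aH carriers by (simp add: u_def distrib_right assoc x2G y2G)
  also have "\<dots> = proj (a, b)"
    using ab H by (simp add: assoc one_right)
  finally have "zmult D 0 (-1) 1 u G = \<one>\<^bsub>zgrp D 0 1\<^esub>"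
    using assms(3) by simp
  then have "zmult D 0 1 (-1) (zmult D 0 (-1) 1 u G) G' = \<one>\<^bsub>zgrp D 0 (-1)\<^esub>"
    using G by (simp add: one_zmult)
  then have "u = \<one>\<^bsub>zgrp D 0 (-1)\<^esub>"
    using u G by (simp add: assoc one_right)
  then have "zmult D 0 (-1) 0 u p = \<one>\<^bsub>zgrp D 0 0\<^esub>" "zmult D 0 (-1) 0 u q = \<one>\<^bsub>zgrp D 0 0\<^esub>"
    using pq by (simp_all add: one_zmult)
  moreover have aHH: "zmult D 0 (-2) 0 ?aH H = a" "zmult D 0 (-2) 0 ?bH H = b"
    using ab H by (simp_all add: assoc one_right)
  moreover have "zmult D 0 (-1) 0 u p = a \<otimes>\<^bsub>zgrp D 0 0\<^esub> zmult D 0 (-1) 0 w sx"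
  proof -
    have "zmult D 0 (-1) 0 u p = zmult D 0 (-2) 0 ?aH (zmult D (-2) (-1) 0 x2 p) \<otimes>\<^bsub>zgrp D 0 0\<^esub> zmult D 0 (-2) 0 ?bH (zmult D (-2) (-1) 0 y2 p)"
      unfolding u_def using aH carriers by (metis assoc distrib_right zmult_closed)
    also have "\<dots> = a \<otimes>\<^bsub>zgrp D 0 0\<^esub> (zmult D 0 (-2) 0 ?aH (zmult D (-2) (-1) 0 c sx) \<otimes>\<^bsub>zgrp D 0 0\<^esub> zmult D 0 (-2) 0 ?bH (zmult D (-2) (-1) 0 e sx))"
      using aH ab carriers by (simp add: x2p y2p distrib_left aHH g00.m_assoc zmult_closed[of _ 0 "-2" _ 0])
    also have "zmult D 0 (-2) 0 ?aH (zmult D (-2) (-1) 0 c sx) \<otimes>\<^bsub>zgrp D 0 0\<^esub> zmult D 0 (-2) 0 ?bH (zmult D (-2) (-1) 0 e sx)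
        = zmult D 0 (-1) 0 w sx"
      unfolding w_def using aH carriers by (metis assoc distrib_right zmult_closed)
    finally show ?thesis .
  qed
  moreover have "zmult D 0 (-1) 0 u q = b \<otimes>\<^bsub>zgrp D 0 0\<^esub> zmult D 0 (-1) 0 w sy"
  proof -
    have "zmult D 0 (-1) 0 u q = zmult D 0 (-2) 0 ?aH (zmult D (-2) (-1) 0 x2 q) \<otimes>\<^bsub>zgrp D 0 0\<^esub> zmult D 0 (-2) 0 ?bH (zmult D (-2) (-1) 0 y2 q)"
      unfolding u_def using aH carriers by (metis assoc distrib_right zmult_closed)
    also have "\<dots> = b \<otimes>\<^bsub>zgrp D 0 0\<^esub> (zmult D 0 (-2) 0 ?aH (zmult D (-2) (-1) 0 c sy) \<otimes>\<^bsub>zgrp D 0 0\<^esub> zmult D 0 (-2) 0 ?bH (zmult D (-2) (-1) 0 e sy))"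
      using aH ab carriers by (simp add: x2q y2q distrib_left aHH g00.m_lcomm zmult_closed[of _ 0 "-2" _ 0])
    also have "zmult D 0 (-2) 0 ?aH (zmult D (-2) (-1) 0 c sy) \<otimes>\<^bsub>zgrp D 0 0\<^esub> zmult D 0 (-2) 0 ?bH (zmult D (-2) (-1) 0 e sy)
        = zmult D 0 (-1) 0 w sy"
      unfolding w_def using aH carriers by (metis assoc distrib_right zmult_closed)
    finally show ?thesis .
  qed
  ultimately have "a = inv\<^bsub>zgrp D 0 0\<^esub> zmult D 0 (-1) 0 w sx" "b = inv\<^bsub>zgrp D 0 0\<^esub> zmult D 0 (-1) 0 w sy"
    using ab w sxy by (metis g00.inv_equality g00.inv_inv zmult_closed)+
  then have "a = zmult D 0 (-1) 0 (inv\<^bsub>zgrp D 0 (-1)\<^esub> w) sx" "b = zmult D 0 (-1) 0 (inv\<^bsub>zgrp D 0 (-1)\<^esub> w) sy"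
    using w sxy by (simp_all add: mult_inv_left)
  then show ?thesis
    using w by blast
qed

lemma proj_multiple:
  assumes "w \<in> zcar D 0 (-1)"
  shows "proj (zmult D 0 (-1) 0 w sx, zmult D 0 (-1) 0 w sy) = \<one>\<^bsub>zgrp D 0 1\<^esub>"
  using assms carriers relation by (simp add: assoc zmult_one flip: distrib_left)

theorem presentation:
  "is_presentation (zcar D 0 0) (module_sum (zmod D 0 0) (zmod D 0 0)) (module_sum (zmod D 0 0) (zmod D 0 0))
     (zmod D 0 1) diff proj"
proof -
  interpret g00: comm_group "zgrp D 0 0" by (rule grp)
  interpret g01: comm_group "zgrp D 0 1" by (rule grp)
  have M: "entry s t \<in> zcar D 0 0" if "s \<in> zcar D (-2) (-1)" "t \<in> zcar D (-1) 0" for s t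
    using that H by blast
  note Ms = M[OF txy(1) sxy(1)] M[OF txy(1) sxy(2)] M[OF txy(2) sxy(1)] M[OF txy(2) sxy(2)]
  have "diff \<in> lmodule_hom (zcar D 0 0) (module_sum (zmod D 0 0) (zmod D 0 0)) (module_sum (zmod D 0 0) (zmod D 0 0))"
    using Ms by (auto simp: lmodule_hom_def module_sum_def zmod_def distrib_right distrib_left assoc g00.m_ac
        simp del: assoc[of _ _ "-2"])
  moreover have "proj \<in> lmodule_hom (zcar D 0 0) (module_sum (zmod D 0 0) (zmod D 0 0)) (zmod D 0 1)"
    using xy by (auto simp: lmodule_hom_def module_sum_def zmod_def distrib_right distrib_left assoc g01.m_ac)
  moreover have "proj ` carrier (module_sum (zmod D 0 0) (zmod D 0 0)) = carrier (zmod D 0 1)"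
  proof
    show "proj ` carrier (module_sum (zmod D 0 0) (zmod D 0 0)) \<subseteq> carrier (zmod D 0 1)"
      using xy by (auto simp: module_sum_def zmod_def)
    show "carrier (zmod D 0 1) \<subseteq> proj ` carrier (module_sum (zmod D 0 0) (zmod D 0 0))"
      using proj_surj unfolding module_sum_def zmod_def by force
  qed
  moreover have "diff ` carrier (module_sum (zmod D 0 0) (zmod D 0 0)) =
      {q \<in> carrier (module_sum (zmod D 0 0) (zmod D 0 0)). proj q = \<zero>\<^bsub>zmod D 0 1\<^esub>}"
  proof (intro equalityI subsetI)
    fix z assume "z \<in> diff ` carrier (module_sum (zmod D 0 0) (zmod D 0 0))"
    then obtain r s where rs: "r \<in> zcar D 0 0" "s \<in> zcar D 0 0" "z = diff (r, s)"
      by (auto simp: module_sum_def zmod_def)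
    define w where "w = zmult D 0 (-2) (-1) (zmult D 0 0 (-2) r H') tx
      \<otimes>\<^bsub>zgrp D 0 (-1)\<^esub> zmult D 0 (-2) (-1) (zmult D 0 0 (-2) s H') ty"
    have w: "w \<in> zcar D 0 (-1)"
      unfolding w_def using rs carriers by blast
    have z: "z = (zmult D 0 (-1) 0 w sx, zmult D 0 (-1) 0 w sy)"
      using diff_eq[OF rs(1,2) w_def] rs(3) by simp
    show "z \<in> {q \<in> carrier (module_sum (zmod D 0 0) (zmod D 0 0)). proj q = \<zero>\<^bsub>zmod D 0 1\<^esub>}"
      using proj_multiple[OF w] w sxy unfolding z by (auto simp: module_sum_def zmod_def)
  next
    fix z assume "z \<in> {q \<in> carrier (module_sum (zmod D 0 0) (zmod D 0 0)). proj q = \<zero>\<^bsub>zmod D 0 1\<^esub>}"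
    then obtain a b where ab: "z = (a, b)" "a \<in> zcar D 0 0" "b \<in> zcar D 0 0" "proj (a, b) = \<one>\<^bsub>zgrp D 0 1\<^esub>"
      by (auto simp: module_sum_def zmod_def)
    then obtain w where w: "w \<in> zcar D 0 (-1)" "a = zmult D 0 (-1) 0 w sx" "b = zmult D 0 (-1) 0 w sy"
      using kernel_proj by blast
    obtain r s where rs: "r \<in> zcar D 0 0" "s \<in> zcar D 0 0"
      "w = zmult D 0 (-2) (-1) (zmult D 0 0 (-2) r H') tx \<otimes>\<^bsub>zgrp D 0 (-1)\<^esub> zmult D 0 (-2) (-1) (zmult D 0 0 (-2) s H') ty"
      using generated_minus_one[OF w(1)] by blast
    have "z = diff (r, s)"
      using diff_eq[OF rs] w ab by simp
    then show "z \<in> diff ` carrier (module_sum (zmod D 0 0) (zmod D 0 0))"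
      using rs by (force simp: module_sum_def zmod_def)
  qed
  ultimately show ?thesis
    by (simp add: is_presentation_def)
qed

end

section \<open>Quadratic field extensions\<close>

locale quadratic_extension = field F for F :: "'f ring" (structure) +
  fixes L :: "'f set" and w :: 'f
  assumes subfield_L: "subfield L F"
    and degree_two: "dimension 2 L (carrier F)"
    and w_carrier [simp]: "w \<in> carrier F"
    and w_notin_L: "w \<notin> L"
    and w_square_L: "w \<otimes> w \<in> L"
begin

lemma L_carrier [simp]: "a \<in> L \<Longrightarrow> a \<in> carrier F"
  using subfieldE(3)[OF subfield_L] by blast

lemma L_closed [simp]:
  "\<zero> \<in> L" "\<one> \<in> L" "a \<in> L \<Longrightarrow> b \<in> L \<Longrightarrow> a \<oplus> b \<in> L" "a \<in> L \<Longrightarrow> b \<in> L \<Longrightarrow> a \<otimes> b \<in> L" "a \<in> L \<Longrightarrow> \<ominus> a \<in> L"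
  using subringE[OF subfieldE(1)[OF subfield_L]] by auto

lemma L_inv: "a \<in> L \<Longrightarrow> a \<noteq> \<zero> \<Longrightarrow> inv a \<in> L"
  using subfield_m_inv(1)[OF subfield_L, of a] by simp

lemma w_nonzero: "w \<noteq> \<zero>"
  using w_notin_L L_closed(1) by metis

lemma decompose:
  assumes "z \<in> carrier F"
  obtains m n where "m \<in> L" "n \<in> L" "z = m \<oplus> n \<otimes> w"
proof -
  have "\<one> \<notin> Span L []"
    by simp
  then have i1: "independent L [\<one>]"
    by (intro li_Cons li_Nil) auto
  have "Span L [\<one>] = L"
    using L_carrier by (auto simp: line_extension_mem_iff)
  then have "independent L [w, \<one>]"
    using i1 w_notin_L by (intro li_Cons) auto
  then have "Span L [w, \<one>] = carrier F"
    using independent_length_eq_dimension[OF subfield_L degree_two, of "[w, \<one>]"] by simp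
  then have "z \<in> line_extension L w (line_extension L \<one> {\<zero>})"
    using assms by simp
  then obtain n m where "n \<in> L" "m \<in> L" "z = n \<otimes> w \<oplus> (m \<otimes> \<one> \<oplus> \<zero>)"
    by (auto simp: line_extension_mem_iff)
  then show thesis
    using that[of m n] by (simp add: a_comm)
qed

lemma independent_one_w:
  assumes "m \<in> L" "n \<in> L" "m' \<in> L" "n' \<in> L" "m \<oplus> n \<otimes> w = m' \<oplus> n' \<otimes> w"
  shows "m = m'" "n = n'"
proof -
  show "n = n'"
  proof (rule ccontr)
    assume "n \<noteq> n'"
    then have ne: "n \<ominus> n' \<noteq> \<zero>" and nL: "n \<ominus> n' \<in> L"
      using assms(1-4) by (simp_all, simp add: minus_eq)
    have "n \<otimes> w = \<ominus> m \<oplus> (m \<oplus> n \<otimes> w)"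
      using assms(1-4) by (simp add: r_neg1)
    also have "\<dots> = (\<ominus> m \<oplus> m') \<oplus> n' \<otimes> w"
      unfolding assms(5) using assms(1-4) by (simp add: a_assoc)
    finally have "n \<otimes> w \<oplus> \<ominus> (n' \<otimes> w) = \<ominus> m \<oplus> m'"
      using assms(1-4) by (simp add: a_assoc r_neg)
    then have "(n \<ominus> n') \<otimes> w = \<ominus> m \<oplus> m'"
      using assms(1-4) by (simp add: minus_eq l_distr l_minus)
    then have "inv (n \<ominus> n') \<otimes> ((n \<ominus> n') \<otimes> w) \<in> L"
      using assms nL ne by (simp add: L_inv minus_eq)
    moreover have "inv (n \<ominus> n') \<otimes> ((n \<ominus> n') \<otimes> w) = w"
      using nL ne by (simp add: field_Units flip: m_assoc)
    ultimately show False
      using w_notin_L by simp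
  qed
  then show "m = m'"
    using assms by simp
qed

definition re :: "'f \<Rightarrow> 'f" where
  "re z = (THE m. m \<in> L \<and> (\<exists>n\<in>L. z = m \<oplus> n \<otimes> w))"

lemma re_eq [simp]: "m \<in> L \<Longrightarrow> n \<in> L \<Longrightarrow> re (m \<oplus> n \<otimes> w) = m"
  unfolding re_def by (rule the_equality) (blast, metis independent_one_w(1))

lemma re_L [simp]: "m \<in> L \<Longrightarrow> re m = m"
  using re_eq[of m \<zero>] by simp

lemma re_times_w [simp]: "n \<in> L \<Longrightarrow> re (n \<otimes> w) = \<zero>"
  using re_eq[of \<zero> n] by simp

lemma re_in_L [simp]: "z \<in> carrier F \<Longrightarrow> re z \<in> L"
  by (rule decompose[of z]) auto

lemma re_add: "z \<in> carrier F \<Longrightarrow> z' \<in> carrier F \<Longrightarrow> re (z \<oplus> z') = re z \<oplus> re z'"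
proof -
  assume z: "z \<in> carrier F" "z' \<in> carrier F"
  obtain m n m' n' where mn: "m \<in> L" "n \<in> L" "z = m \<oplus> n \<otimes> w" "m' \<in> L" "n' \<in> L" "z' = m' \<oplus> n' \<otimes> w"
    by (metis decompose z)
  then have "z \<oplus> z' = (m \<oplus> m') \<oplus> (n \<oplus> n') \<otimes> w"
    by (simp add: l_distr a_ac)
  then show ?thesis
    using mn by simp
qed

lemma re_mult: "k \<in> L \<Longrightarrow> z \<in> carrier F \<Longrightarrow> re (k \<otimes> z) = k \<otimes> re z"
proof -
  assume z: "k \<in> L" "z \<in> carrier F"
  obtain m n where mn: "m \<in> L" "n \<in> L" "z = m \<oplus> n \<otimes> w"
    by (metis decompose z(2))
  then have "k \<otimes> z = k \<otimes> m \<oplus> (k \<otimes> n) \<otimes> w"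
    using z by (simp add: r_distr m_ac)
  then show ?thesis
    using mn z by simp
qed

lemma inv_w: "inv w = inv (w \<otimes> w) \<otimes> w" "inv (w \<otimes> w) \<in> L"
proof -
  have ww: "w \<otimes> w \<noteq> \<zero>"
    using w_nonzero integral[of w w] by auto
  then show "inv (w \<otimes> w) \<in> L"
    using w_square_L L_inv by blast
  then have "w \<otimes> (inv (w \<otimes> w) \<otimes> w) = (w \<otimes> w) \<otimes> inv (w \<otimes> w)"
    by (simp add: m_ac)
  also have "\<dots> = \<one>"
    using ww by (simp add: field_Units)
  finally show "inv w = inv (w \<otimes> w) \<otimes> w"
    using \<open>inv (w \<otimes> w) \<in> L\<close> by (intro comm_inv_char) auto
qed

lemma re_inv_w: "re (inv w) = \<zero>"
  using inv_w re_times_w by metis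

lemma half_trace_eq:
  assumes s: "\<sigma> \<in> ring_iso F F" "\<And>c. c \<in> L \<Longrightarrow> \<sigma> c = c" "\<sigma> w \<noteq> w"
    and two: "\<one> \<oplus> \<one> \<noteq> \<zero>" and z: "z \<in> carrier F"
  shows "half_trace F K \<iota> \<sigma> z = inv_into (carrier K) \<iota> (re z)"
proof -
  have hom: "\<sigma> \<in> ring_hom F F"
    using s(1) by (simp add: ring_iso_def)
  note h = ring_hom_memE[OF hom]
  have sw: "\<sigma> w \<in> carrier F"
    using h by simp
  have "\<sigma> w \<otimes> \<sigma> w = w \<otimes> w"
    using h(2)[of w w] s(2)[OF w_square_L] by simp
  then have "\<sigma> w \<otimes> (\<sigma> w \<oplus> w) = w \<otimes> (\<sigma> w \<oplus> w)"
    using sw by (simp add: r_distr m_comm a_comm)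
  then have "(\<sigma> w \<ominus> w) \<otimes> (\<sigma> w \<oplus> w) = \<zero>"
    using sw by (simp add: minus_eq l_distr l_minus r_neg)
  then have "\<sigma> w \<oplus> w = \<zero>"
    using s(3) sw integral[of "\<sigma> w \<ominus> w" "\<sigma> w \<oplus> w"] by auto
  then have w: "w \<oplus> \<sigma> w = \<zero>"
    using sw by (simp add: a_comm)
  obtain m n where mn: "m \<in> L" "n \<in> L" "z = m \<oplus> n \<otimes> w"
    by (metis decompose z)
  then have "\<sigma> z = m \<oplus> n \<otimes> \<sigma> w"
    using h s(2) by simp
  then have "z \<oplus> \<sigma> z = (m \<oplus> m) \<oplus> n \<otimes> (w \<oplus> \<sigma> w)"
    using mn sw by (simp add: r_distr a_ac)
  also have "\<dots> = (\<one> \<oplus> \<one>) \<otimes> m"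
    using mn by (simp add: w l_distr)
  finally have "inv (\<one> \<oplus> \<one>) \<otimes> (z \<oplus> \<sigma> z) = m"
    using mn two by (simp add: field_Units flip: m_assoc)
  then show ?thesis
    using mn by (simp add: half_trace_def)
qed

text \<open>
  If the generator fixed \<open>w\<close>, the half trace would be \<open>inv_into\<close> of \<open>\<iota>\<close>, which takes one and the same
  junk value at \<open>w\<close> and at \<open>w + 1\<close>.
\<close>

lemma conjugate_w_neq:
  assumes K: "ring K" "\<one>\<^bsub>K\<^esub> \<noteq> \<zero>\<^bsub>K\<^esub>" and \<iota>: "\<iota> \<in> ring_hom K F" "\<iota> ` carrier K = L"
    and inj: "inj_on \<iota> (carrier K)"
    and s: "\<sigma> \<in> ring_iso F F" "\<And>c. c \<in> L \<Longrightarrow> \<sigma> c = c"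
    and two: "\<one> \<oplus> \<one> \<noteq> \<zero>"
    and tr: "half_trace F K \<iota> \<sigma> w \<in> carrier K"
      "half_trace F K \<iota> \<sigma> (w \<oplus> \<one>) = half_trace F K \<iota> \<sigma> w \<oplus>\<^bsub>K\<^esub> half_trace F K \<iota> \<sigma> \<one>"
  shows "\<sigma> w \<noteq> w"
proof
  assume w: "\<sigma> w = w"
  interpret K: ring K by fact
  have hom: "\<sigma> \<in> ring_hom F F"
    using s(1) by (simp add: ring_iso_def)
  note h = ring_hom_memE[OF hom]
  have "\<sigma> z = z" if "z \<in> carrier F" for z
    using that by (rule decompose) (simp add: h s(2) w)
  moreover have "inv (\<one> \<oplus> \<one>) \<otimes> (z \<oplus> z) = z" if "z \<in> carrier F" for z
  proof -
    have "z \<oplus> z = (\<one> \<oplus> \<one>) \<otimes> z"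
      using that by (simp add: l_distr)
    then show ?thesis
      using that two by (simp add: field_Units flip: m_assoc)
  qed
  ultimately have t: "half_trace F K \<iota> \<sigma> z = inv_into (carrier K) \<iota> z" if "z \<in> carrier F" for z
    using that by (simp add: half_trace_def)
  have "w \<oplus> \<one> \<notin> L"
  proof
    assume "w \<oplus> \<one> \<in> L"
    then have "(w \<oplus> \<one>) \<oplus> \<ominus> \<one> \<in> L"
      by (rule L_closed(3)) simp
    then show False
      using w_notin_L by (simp add: a_assoc r_neg)
  qed
  moreover have "inv_into (carrier K) \<iota> z = (SOME y. False)" if "z \<notin> L" for z
  proof -
    have "(\<lambda>y. y \<in> carrier K \<and> \<iota> y = z) = (\<lambda>y. False)"
      using that \<iota>(2) by auto
    then show ?thesis
      by (simp add: inv_into_def)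
  qed
  ultimately have "inv_into (carrier K) \<iota> (w \<oplus> \<one>) = inv_into (carrier K) \<iota> w"
    using w_notin_L by simp
  moreover have "inv_into (carrier K) \<iota> \<one> = \<one>\<^bsub>K\<^esub>"
    using inv_into_f_f[OF inj, of "\<one>\<^bsub>K\<^esub>"] ring_hom_one[OF \<iota>(1)] by simp
  ultimately have "half_trace F K \<iota> \<sigma> w = half_trace F K \<iota> \<sigma> w \<oplus>\<^bsub>K\<^esub> \<one>\<^bsub>K\<^esub>"
    using tr(2) by (simp add: t)
  then show False
    using K tr(1) K.add.r_cancel_one'[of "half_trace F K \<iota> \<sigma> w" "\<one>\<^bsub>K\<^esub>"] by simp
qed

end

locale balanced_map = quadratic_extension F L w + biadditive "add_monoid F" "add_monoid F" H t
  for F :: "'f ring" (structure) and L w and H :: "'h monoid" and t +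
  assumes balanced: "a \<in> carrier F \<Longrightarrow> b \<in> carrier F \<Longrightarrow> k \<in> L \<Longrightarrow> t (a \<otimes> k) b = t a (k \<otimes> b)"
begin

lemma t_closed [simp]: "a \<in> carrier F \<Longrightarrow> b \<in> carrier F \<Longrightarrow> t a b \<in> carrier H"
  using closed by simp

lemma t_add_left: "a \<in> carrier F \<Longrightarrow> a' \<in> carrier F \<Longrightarrow> b \<in> carrier F \<Longrightarrow> t (a \<oplus> a') b = t a b \<otimes>\<^bsub>H\<^esub> t a' b"
  using add_left[of a a' b] by simp

lemma t_add_right: "a \<in> carrier F \<Longrightarrow> b \<in> carrier F \<Longrightarrow> b' \<in> carrier F \<Longrightarrow> t a (b \<oplus> b') = t a b \<otimes>\<^bsub>H\<^esub> t a b'"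
  using add_right[of a b b'] by simp

lemma symmetric_tensor_expand:
  assumes "X \<in> carrier F" "Y \<in> carrier F" "a \<in> L" "b \<in> L" "a' \<in> L" "b' \<in> L" "v \<in> carrier F"
    and "\<one> = a \<otimes> X \<oplus> b \<otimes> Y" "v = a' \<otimes> X \<oplus> b' \<otimes> Y"
  shows "t v \<one> \<otimes>\<^bsub>H\<^esub> t \<one> v = t (v \<otimes> a \<oplus> a') X \<otimes>\<^bsub>H\<^esub> t (v \<otimes> b \<oplus> b') Y"
proof -
  have "t v \<one> = t (v \<otimes> a) X \<otimes>\<^bsub>H\<^esub> t (v \<otimes> b) Y"
    using assms(1-7) by (subst assms(8)) (simp add: t_add_right balanced)
  moreover have "t \<one> v = t \<one> (a' \<otimes> X) \<otimes>\<^bsub>H\<^esub> t \<one> (b' \<otimes> Y)"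
    using assms(1-7) by (subst assms(9)) (simp add: t_add_right)
  moreover have "\<dots> = t a' X \<otimes>\<^bsub>H\<^esub> t b' Y"
    using assms(1-7) by (simp flip: balanced)
  ultimately show ?thesis
    using assms(1-7) by (simp add: t_add_left L.m_ac)
qed

lemma symmetric_tensor_dual_basis:
  assumes "X \<in> carrier F" "Y \<in> carrier F" "X' \<in> carrier F" "Y' \<in> carrier F"
    and basis: "\<And>z. z \<in> carrier F \<Longrightarrow> \<exists>a\<in>L. \<exists>b\<in>L. z = a \<otimes> X \<oplus> b \<otimes> Y"
    and dual: "re (X' \<otimes> X) = \<one>" "re (X' \<otimes> Y) = \<zero>" "re (Y' \<otimes> X) = \<zero>" "re (Y' \<otimes> Y) = \<one>"
  shows "t w \<one> \<otimes>\<^bsub>H\<^esub> t \<one> w = t (w \<otimes> X') X \<otimes>\<^bsub>H\<^esub> t (w \<otimes> Y') Y"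
proof -
  have coeff: "re (X' \<otimes> (a \<otimes> X \<oplus> b \<otimes> Y)) = a" "re (Y' \<otimes> (a \<otimes> X \<oplus> b \<otimes> Y)) = b" if "a \<in> L" "b \<in> L" for a b
  proof -
    have "X' \<otimes> (a \<otimes> X \<oplus> b \<otimes> Y) = a \<otimes> (X' \<otimes> X) \<oplus> b \<otimes> (X' \<otimes> Y)"
      "Y' \<otimes> (a \<otimes> X \<oplus> b \<otimes> Y) = a \<otimes> (Y' \<otimes> X) \<oplus> b \<otimes> (Y' \<otimes> Y)"
      using that assms(1-4) by (simp_all add: r_distr m_ac)
    then show "re (X' \<otimes> (a \<otimes> X \<oplus> b \<otimes> Y)) = a" "re (Y' \<otimes> (a \<otimes> X \<oplus> b \<otimes> Y)) = b"
      using that assms(1-4) dual by (simp_all add: re_add re_mult)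
  qed
  obtain a b where ab: "a \<in> L" "b \<in> L" "\<one> = a \<otimes> X \<oplus> b \<otimes> Y"
    using basis[of \<one>] by auto
  obtain a' b' where ab': "a' \<in> L" "b' \<in> L" "w = a' \<otimes> X \<oplus> b' \<otimes> Y"
    using basis[of w] by auto
  have mult: "z \<otimes> w = re (z \<otimes> w) \<oplus> re z \<otimes> w" if z: "z \<in> carrier F" for z
  proof -
    obtain m n where mn: "m \<in> L" "n \<in> L" "z = m \<oplus> n \<otimes> w"
      by (metis decompose z)
    then have "z \<otimes> w = n \<otimes> (w \<otimes> w) \<oplus> m \<otimes> w"
      by (simp add: l_distr m_assoc a_comm)
    then show ?thesis
      using mn w_square_L by simp
  qed
  have "re X' = a" "re Y' = b"
    using coeff[OF ab(1,2), folded ab(3)] assms(3,4) by simp_all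
  moreover have "re (X' \<otimes> w) = a'" "re (Y' \<otimes> w) = b'"
    using coeff[OF ab'(1,2), folded ab'(3)] by simp_all
  ultimately have "X' \<otimes> w = a' \<oplus> a \<otimes> w" "Y' \<otimes> w = b' \<oplus> b \<otimes> w"
    using mult assms(3,4) by metis+
  then have "w \<otimes> X' = w \<otimes> a \<oplus> a'" "w \<otimes> Y' = w \<otimes> b \<oplus> b'"
    using assms(3,4) ab(1,2) ab'(1,2) by (simp_all add: m_comm a_comm)
  then show ?thesis
    using symmetric_tensor_expand[of X Y a b a' b' w] assms(1-4) ab ab' by simp
qed

lemma swap_w:
  assumes "s \<in> carrier F" "b \<in> carrier F"
  shows "t s (w \<otimes> b) \<otimes>\<^bsub>H\<^esub> t (s \<otimes> w) b = t (s \<otimes> w \<otimes> b) \<one> \<otimes>\<^bsub>H\<^esub> t (s \<otimes> w \<otimes> b \<otimes> w) (inv w)"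
proof -
  obtain m n where mn: "m \<in> L" "n \<in> L" "b = m \<oplus> n \<otimes> w"
    by (metis decompose assms(2))
  have iw: "inv w \<in> carrier F" "w \<otimes> inv w = \<one>"
    using w_nonzero by (simp_all add: field_Units)
  have nL: "n \<otimes> (w \<otimes> w) \<in> L"
    using mn w_square_L by simp
  have "s \<otimes> w \<otimes> b \<otimes> w = s \<otimes> b \<otimes> (w \<otimes> w)"
    using assms by (simp add: m_ac)
  then have "t (s \<otimes> w \<otimes> b \<otimes> w) (inv w) = t (s \<otimes> b) (w \<otimes> w \<otimes> inv w)"
    using assms iw w_square_L by (simp add: balanced)
  also have "w \<otimes> w \<otimes> inv w = w"
    using iw by (simp add: m_assoc)
  also have "s \<otimes> b = s \<otimes> m \<oplus> s \<otimes> w \<otimes> n"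
    using mn assms by (simp add: r_distr m_ac)
  also have "t \<dots> w = t (s \<otimes> m) w \<otimes>\<^bsub>H\<^esub> t (s \<otimes> w \<otimes> n) w"
    using mn assms by (simp add: t_add_left)
  also have "\<dots> = t s (w \<otimes> m) \<otimes>\<^bsub>H\<^esub> t (s \<otimes> w) (n \<otimes> w)"
    using mn assms by (simp add: balanced m_comm[of w m])
  finally have 1: "t (s \<otimes> w \<otimes> b \<otimes> w) (inv w) = t s (w \<otimes> m) \<otimes>\<^bsub>H\<^esub> t (s \<otimes> w) (n \<otimes> w)" .
  have "s \<otimes> w \<otimes> b = s \<otimes> w \<otimes> m \<oplus> s \<otimes> (n \<otimes> (w \<otimes> w))"
    using mn assms by (simp add: r_distr m_ac)
  then have "t (s \<otimes> w \<otimes> b) \<one> = t (s \<otimes> w) m \<otimes>\<^bsub>H\<^esub> t s (n \<otimes> (w \<otimes> w))"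
    using mn assms nL by (simp add: t_add_left balanced del: L_closed)
  moreover have "t s (w \<otimes> b) = t s (w \<otimes> m) \<otimes>\<^bsub>H\<^esub> t s (n \<otimes> (w \<otimes> w))"
  proof -
    have "w \<otimes> b = w \<otimes> m \<oplus> n \<otimes> (w \<otimes> w)"
      using mn by (simp add: r_distr m_ac)
    then show ?thesis
      using mn assms by (simp add: t_add_right)
  qed
  moreover have "t (s \<otimes> w) b = t (s \<otimes> w) m \<otimes>\<^bsub>H\<^esub> t (s \<otimes> w) (n \<otimes> w)"
    using mn assms by (simp add: t_add_right)
  ultimately show ?thesis
    using 1 mn assms by (simp add: L.m_ac)
qed

text \<open>On the right, the first factor is \<open>r b\<close> times the generator \<open>1 \<otimes> 1 + w \<otimes> w\<^sup>-\<^sup>1\<close> of the relations.\<close>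

lemma tensor_conjugate:
  assumes "\<alpha> \<in> L" "\<beta> \<in> L" "x2 \<in> carrier F" "b \<in> carrier F" "r = x2 \<otimes> \<beta> \<otimes> w"
  shows "t x2 ((\<alpha> \<oplus> \<beta> \<otimes> w) \<otimes> b) =
    (t (r \<otimes> b) \<one> \<otimes>\<^bsub>H\<^esub> t (r \<otimes> b \<otimes> w) (inv w)) \<otimes>\<^bsub>H\<^esub> t (x2 \<otimes> (\<alpha> \<oplus> \<ominus> (\<beta> \<otimes> w))) b"
proof -
  let ?s = "x2 \<otimes> \<beta>"
  have "t x2 ((\<alpha> \<oplus> \<beta> \<otimes> w) \<otimes> b) = t x2 (\<alpha> \<otimes> b) \<otimes>\<^bsub>H\<^esub> t x2 (\<beta> \<otimes> (w \<otimes> b))"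
    using assms by (simp add: l_distr m_assoc t_add_right)
  also have "\<dots> = t (x2 \<otimes> \<alpha>) b \<otimes>\<^bsub>H\<^esub> t ?s (w \<otimes> b)"
    using assms by (simp add: balanced)
  also have "x2 \<otimes> \<alpha> = x2 \<otimes> (\<alpha> \<oplus> \<ominus> (\<beta> \<otimes> w)) \<oplus> ?s \<otimes> w"
    using assms by (simp add: r_distr m_assoc r_minus a_assoc l_neg)
  also have "t \<dots> b = t (x2 \<otimes> (\<alpha> \<oplus> \<ominus> (\<beta> \<otimes> w))) b \<otimes>\<^bsub>H\<^esub> t (?s \<otimes> w) b"
    using assms by (intro t_add_left) auto
  finally have "t x2 ((\<alpha> \<oplus> \<beta> \<otimes> w) \<otimes> b) = (t ?s (w \<otimes> b) \<otimes>\<^bsub>H\<^esub> t (?s \<otimes> w) b) \<otimes>\<^bsub>H\<^esub> t (x2 \<otimes> (\<alpha> \<oplus> \<ominus> (\<beta> \<otimes> w))) b"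
    using assms by (simp add: L.m_ac)
  then show ?thesis
    using swap_w[of ?s b] assms by simp
qed

lemma tensor_lift:
  assumes "\<alpha> \<in> L" "\<beta> \<in> L" "\<beta> \<noteq> \<zero>" "X \<in> carrier F" "Y \<in> carrier F" "Y \<noteq> \<zero>"
    and N: "N \<subseteq> carrier F"
    and rel: "\<And>k. k \<in> N \<Longrightarrow> t k \<one> \<otimes>\<^bsub>H\<^esub> t (k \<otimes> w) (inv w) = \<one>\<^bsub>H\<^esub>"
    and k: "k \<in> N" "k' \<in> N" "w \<otimes> Y \<oplus> k \<otimes> Y = k' \<otimes> X"
  shows "\<exists>x2\<in>carrier F. \<exists>c\<in>carrier F.
    t x2 ((\<alpha> \<oplus> \<beta> \<otimes> w) \<otimes> X) = (t w \<one> \<otimes>\<^bsub>H\<^esub> t \<one> w) \<otimes>\<^bsub>H\<^esub> t c X \<and> t x2 ((\<alpha> \<oplus> \<beta> \<otimes> w) \<otimes> Y) = t c Y"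
proof -
  define r where "r = k' \<otimes> inv Y"
  define x2 where "x2 = r \<otimes> inv (\<beta> \<otimes> w)"
  let ?c = "x2 \<otimes> (\<alpha> \<oplus> \<ominus> (\<beta> \<otimes> w))"
  have kc: "k \<in> carrier F" "k' \<in> carrier F"
    using N k by auto
  have iY: "inv Y \<in> carrier F" "Y \<otimes> inv Y = \<one>" "inv Y \<otimes> Y = \<one>"
    using assms by (simp_all add: field_Units)
  have bw: "\<beta> \<otimes> w \<noteq> \<zero>"
    using assms w_nonzero integral[of \<beta> w] by auto
  then have ib: "inv (\<beta> \<otimes> w) \<in> carrier F" "inv (\<beta> \<otimes> w) \<otimes> (\<beta> \<otimes> w) = \<one>"
    using assms by (simp_all add: field_Units)
  have iw: "inv w \<in> carrier F" "w \<otimes> inv w = \<one>"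
    using w_nonzero by (simp_all add: field_Units)
  have r: "r \<in> carrier F"
    using kc iY by (simp add: r_def)
  have x2: "x2 \<in> carrier F"
    using r ib by (simp add: x2_def)
  have r_eq: "r = x2 \<otimes> \<beta> \<otimes> w"
    using r ib assms(2) by (simp add: x2_def m_assoc)
  have rX: "r \<otimes> X = w \<oplus> k"
  proof -
    have "r \<otimes> X = (k' \<otimes> X) \<otimes> inv Y"
      using kc iY assms by (simp add: r_def m_ac)
    also have "\<dots> = (w \<oplus> k) \<otimes> (Y \<otimes> inv Y)"
      using kc iY(1) assms(5) by (simp add: l_distr m_assoc flip: k(3))
    finally show ?thesis
      using kc iY by simp
  qed
  have rY: "r \<otimes> Y = k'"
    using kc iY assms by (simp add: r_def m_assoc)
  have "w \<otimes> w \<otimes> inv w = w"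
    using iw by (simp add: m_assoc)
  then have ww: "t (w \<otimes> w) (inv w) = t \<one> w"
    using balanced[of \<one> "inv w" "w \<otimes> w"] iw w_square_L by simp
  have "t (r \<otimes> X) \<one> \<otimes>\<^bsub>H\<^esub> t (r \<otimes> X \<otimes> w) (inv w) =
      (t w \<one> \<otimes>\<^bsub>H\<^esub> t \<one> w) \<otimes>\<^bsub>H\<^esub> (t k \<one> \<otimes>\<^bsub>H\<^esub> t (k \<otimes> w) (inv w))"
    using kc iw by (simp add: rX l_distr t_add_left ww L.m_ac)
  then have "t (r \<otimes> X) \<one> \<otimes>\<^bsub>H\<^esub> t (r \<otimes> X \<otimes> w) (inv w) = t w \<one> \<otimes>\<^bsub>H\<^esub> t \<one> w"
    using rel[OF k(1)] by simp
  moreover have "t (r \<otimes> Y) \<one> \<otimes>\<^bsub>H\<^esub> t (r \<otimes> Y \<otimes> w) (inv w) = \<one>\<^bsub>H\<^esub>"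
    using rel[OF k(2)] rY by simp
  moreover have "?c \<in> carrier F"
    using x2 assms by simp
  ultimately show ?thesis
    using tensor_conjugate[OF assms(1,2) x2 _ r_eq] assms(4,5) x2 by (intro bexI[of _ x2] bexI[of _ ?c]) auto
qed

end

lemma (in localization) im_one: "im i j \<one>\<^bsub>zgrp D i j\<^esub> = \<one>\<^bsub>zgrp B i j\<^esub>"
proof -
  interpret A: comm_group "zgrp D i j" by (rule zgrp_comm_group)
  interpret B: comm_group "zgrp B i j" by (rule z_algebra.grp[OF z_algebra_zloc])
  have "im i j \<one>\<^bsub>zgrp D i j\<^esub> \<otimes>\<^bsub>zgrp B i j\<^esub> im i j \<one>\<^bsub>zgrp D i j\<^esub> = im i j \<one>\<^bsub>zgrp D i j\<^esub>"
    using im_add[of "\<one>\<^bsub>zgrp D i j\<^esub>" i j "\<one>\<^bsub>zgrp D i j\<^esub>"] by simp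
  then show ?thesis
    using im_closed[of "\<one>\<^bsub>zgrp D i j\<^esub>" i j] by (simp add: B.r_cancel_one')
qed

lemma (in symmetric_algebra) localization_A:
  assumes "\<And>i. g i \<in> zcar A i (i + d)"
  shows "localization A d g"
  by (intro localization.intro biadditive_zalg_A localization_axioms.intro zone_A_closed assms)

lemma left_basis_nonzero:
  assumes "field L" "module L W" "left_basis L W x y"
  shows "x \<noteq> \<zero>\<^bsub>W\<^esub>" "y \<noteq> \<zero>\<^bsub>W\<^esub>"
proof -
  interpret L: field L by fact
  interpret W: module L W by fact
  have xy: "x \<in> carrier W" "y \<in> carrier W"
    and u: "\<exists>!(a, b). a \<in> carrier L \<and> b \<in> carrier L \<and> \<zero>\<^bsub>W\<^esub> = smult W a x \<oplus>\<^bsub>W\<^esub> smult W b y"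
    using assms(3) W.zero_closed by (auto simp: left_basis_def)
  have 0: "\<zero>\<^bsub>W\<^esub> = smult W \<zero>\<^bsub>L\<^esub> x \<oplus>\<^bsub>W\<^esub> smult W \<zero>\<^bsub>L\<^esub> y"
    using xy by simp
  show "x \<noteq> \<zero>\<^bsub>W\<^esub>"
  proof
    assume "x = \<zero>\<^bsub>W\<^esub>"
    then have "\<zero>\<^bsub>W\<^esub> = smult W \<one>\<^bsub>L\<^esub> x \<oplus>\<^bsub>W\<^esub> smult W \<zero>\<^bsub>L\<^esub> y"
      using xy by simp
    then show False
      using u 0 L.one_closed L.zero_closed L.one_not_zero by blast
  qed
  show "y \<noteq> \<zero>\<^bsub>W\<^esub>"
  proof
    assume "y = \<zero>\<^bsub>W\<^esub>"
    then have "\<zero>\<^bsub>W\<^esub> = smult W \<zero>\<^bsub>L\<^esub> x \<oplus>\<^bsub>W\<^esub> smult W \<one>\<^bsub>L\<^esub> y"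
      using xy by simp
    then show False
      using u 0 L.one_closed L.zero_closed L.one_not_zero by blast
  qed
qed

lemma (in dual_system) symmetric_algebra: "symmetric_algebra (alt K0 K1) W"
  by (intro symmetric_algebra.intro bimodule_sequence.intro bimod)

lemma (in nonsimple_model) freeness:
  assumes "field K0"
  defines "B \<equiv> zloc (nc_sym (alt K0 K1) W ev) 1 (g_nonsimple (alt K0 K1) W ev u v)"
  shows "lmodule_iso (zcar B 0 0) (zmod B 0 1) (zmod B 0 0) \<noteq> {}"
    and "c \<in> carrier K0 \<Longrightarrow> left_basis K0 V x y \<Longrightarrow> y = smult V c (v 0) \<Longrightarrow>
      freely_generated_by (zcar B 0 0) (zmod B 0 1)
        (loc_map (nc_sym (alt K0 K1) W ev) 1 (g_nonsimple (alt K0 K1) W ev u v) 0 1 (sym_pure (alt K0 K1) W ev 0 [y]))"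
proof -
  interpret K0: field K0 by fact
  interpret symmetric_algebra "alt K0 K1" W ev by (rule symmetric_algebra)
  define g where "g = g_nonsimple (alt K0 K1) W ev u v"
  have uv: "u i \<in> carrier (W i)" "v i \<in> carrier (W i)" for i
    using uv_dual[of i] by (auto simp: dual_bases_def right_basis_def left_basis_def)
  have g: "g i \<in> zcar A i (i + 1)" for i
    unfolding g_def g_nonsimple_def using uv by (intro S_closed) (auto simp: alt_def)
  interpret localization A 1 g by (rule localization_A) (rule g)
  have B: "B = zloc A 1 g"
    by (simp add: B_def g_def)
  interpret B: z_algebra B
    unfolding B by (rule z_algebra_zloc)
  have gB: "im 0 1 (g 0) \<in> zcar B 0 1" "loc_inv A 1 g 0 \<in> zcar B 1 0"
    "zmult B 0 1 0 (im 0 1 (g 0)) (loc_inv A 1 g 0) = zone B 0"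
    "zmult B 1 0 1 (loc_inv A 1 g 0) (im 0 1 (g 0)) = zone B 1"
    using im_closed[OF g[of 0]] loc_inv_closed[of 0] g_loc_inv[of 0] loc_inv_g[of 0] by (simp_all add: B)
  show "lmodule_iso (zcar B 0 0) (zmod B 0 1) (zmod B 0 0) \<noteq> {}"
    using B.lmodule_iso_right_mult[OF gB(2,1,4,3), of 0] by blast
  assume c: "c \<in> carrier K0" and y: "left_basis K0 V x y" "y = smult V c (v 0)"
  interpret V: module K0 V
    using left_module[of 0] start by (simp add: alt_def)
  have v0: "v 0 \<in> carrier V"
    using uv(2)[of 0] start by simp
  have "c \<noteq> \<zero>\<^bsub>K0\<^esub>"
    using left_basis_nonzero(2)[OF assms(1) V.module_axioms y(1)] y(2) v0 by auto
  then have ic: "inv\<^bsub>K0\<^esub> c \<in> carrier K0" "c \<otimes>\<^bsub>K0\<^esub> inv\<^bsub>K0\<^esub> c = \<one>\<^bsub>K0\<^esub>" "inv\<^bsub>K0\<^esub> c \<otimes>\<^bsub>K0\<^esub> c = \<one>\<^bsub>K0\<^esub>"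
    using c by (simp_all add: K0.field_Units)
  define s where "s a = im 0 0 (scalar 0 a)" for a
  have s: "s a \<in> zcar B 0 0" if "a \<in> carrier K0" for a
    unfolding s_def B using that by (intro im_closed scalar_closed) (simp add: alt_def)
  have s_mult: "zmult B 0 0 0 (s a) (s b) = s (a \<otimes>\<^bsub>K0\<^esub> b)" if "a \<in> carrier K0" "b \<in> carrier K0" for a b
    using that im_mult[of "scalar 0 a" 0 0 "scalar 0 b" 0] scalar_mult[of a 0 b] scalar_closed[of _ 0]
    by (simp add: s_def B alt_def)
  have s_one: "s \<one>\<^bsub>K0\<^esub> = zone B 0"
    using im_zone[of 0] by (simp add: s_def B zone_A alt_def)
  have "S 0 [y] = zmult A 0 0 1 (scalar 0 c) (g 0)"
    using scalar_S[of c 0 "v 0"] c uv(2)[of 0] start by (simp add: y(2) g_def g_nonsimple_def alt_def)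
  then have y_eq: "im 0 1 (S 0 [y]) = zmult B 0 0 1 (s c) (im 0 1 (g 0))"
    using im_mult[of "scalar 0 c" 0 0 "g 0" 1] scalar_closed[of c 0] c g[of 0] by (simp add: s_def B alt_def)
  let ?y' = "zmult B 1 0 0 (loc_inv A 1 g 0) (s (inv\<^bsub>K0\<^esub> c))"
  have "freely_generated_by (zcar B 0 0) (zmod B 0 1) (im 0 1 (S 0 [y]))"
  proof (rule B.freely_generated_by_unit)
    show "im 0 1 (S 0 [y]) \<in> zcar B 0 1" "?y' \<in> zcar B 1 0"
      using gB s c ic unfolding y_eq by blast+
    have "zmult B 0 1 0 (im 0 1 (S 0 [y])) ?y' =
        zmult B 0 0 0 (s c) (zmult B 0 0 0 (zmult B 0 1 0 (im 0 1 (g 0)) (loc_inv A 1 g 0)) (s (inv\<^bsub>K0\<^esub> c)))"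
      unfolding y_eq using gB(1,2) s c ic by (simp add: B.assoc)
    then show "zmult B 0 1 0 (im 0 1 (S 0 [y])) ?y' = zone B 0"
      using gB s c ic by (simp add: B.one_left s_mult s_one)
    have "zmult B 1 0 1 ?y' (im 0 1 (S 0 [y])) =
        zmult B 1 0 1 (loc_inv A 1 g 0) (zmult B 0 0 1 (zmult B 0 0 0 (s (inv\<^bsub>K0\<^esub> c)) (s c)) (im 0 1 (g 0)))"
      unfolding y_eq using gB(1,2) s c ic by (simp add: B.assoc)
    then show "zmult B 1 0 1 ?y' (im 0 1 (S 0 [y])) = zone B 1"
      using gB s c ic by (simp add: B.one_left s_mult s_one)
  qed
  then show "freely_generated_by (zcar B 0 0) (zmod B 0 1)
        (loc_map (nc_sym (alt K0 K1) W ev) 1 (g_nonsimple (alt K0 K1) W ev u v) 0 1 (sym_pure (alt K0 K1) W ev 0 [y]))"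
    by (simp add: g_def)
qed

lemma left_basis_transport:
  assumes "field L" "module L W" "left_basis L W x y"
    and f: "bij_betw f (carrier F) (carrier W)"
      "\<And>a b. a \<in> carrier F \<Longrightarrow> b \<in> carrier F \<Longrightarrow> f (a \<oplus>\<^bsub>F\<^esub> b) = f a \<oplus>\<^bsub>W\<^esub> f b"
      "\<And>k a. k \<in> carrier L \<Longrightarrow> a \<in> carrier F \<Longrightarrow> f (\<iota> k \<otimes>\<^bsub>F\<^esub> a) = smult W k (f a)"
    and F: "field F" and \<iota>: "\<iota> \<in> ring_hom L F"
  obtains X Y where "X \<in> carrier F" "Y \<in> carrier F" "x = f X" "y = f Y" "X \<noteq> \<zero>\<^bsub>F\<^esub>" "Y \<noteq> \<zero>\<^bsub>F\<^esub>"
    "\<And>z. z \<in> carrier F \<Longrightarrow> \<exists>a\<in>\<iota> ` carrier L. \<exists>b\<in>\<iota> ` carrier L. z = a \<otimes>\<^bsub>F\<^esub> X \<oplus>\<^bsub>F\<^esub> b \<otimes>\<^bsub>F\<^esub> Y"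
proof -
  interpret L: field L by fact
  interpret F: field F by fact
  interpret W: module L W by fact
  have "x \<in> f ` carrier F" "y \<in> f ` carrier F"
    using assms(3) f(1) by (auto simp: left_basis_def bij_betw_def)
  then obtain X Y where XY: "X \<in> carrier F" "Y \<in> carrier F" "x = f X" "y = f Y"
    by blast
  have ic: "\<iota> k \<in> carrier F" if "k \<in> carrier L" for k
    using \<iota> that by (simp add: ring_hom_def Pi_iff)
  have "f \<zero>\<^bsub>F\<^esub> = f (\<zero>\<^bsub>F\<^esub> \<oplus>\<^bsub>F\<^esub> \<zero>\<^bsub>F\<^esub>)"
    by simp
  then have "f \<zero>\<^bsub>F\<^esub> = f \<zero>\<^bsub>F\<^esub> \<oplus>\<^bsub>W\<^esub> f \<zero>\<^bsub>F\<^esub>"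
    using f(2)[of "\<zero>\<^bsub>F\<^esub>" "\<zero>\<^bsub>F\<^esub>"] by simp
  moreover have "f \<zero>\<^bsub>F\<^esub> \<in> carrier W"
    using f(1) by (auto simp: bij_betw_def)
  ultimately have "f \<zero>\<^bsub>F\<^esub> = \<zero>\<^bsub>W\<^esub>"
    using W.add.r_cancel_one' by metis
  then have ne: "X \<noteq> \<zero>\<^bsub>F\<^esub>" "Y \<noteq> \<zero>\<^bsub>F\<^esub>"
    using left_basis_nonzero[OF assms(1-3)] XY by auto
  have "\<exists>a\<in>\<iota> ` carrier L. \<exists>b\<in>\<iota> ` carrier L. z = a \<otimes>\<^bsub>F\<^esub> X \<oplus>\<^bsub>F\<^esub> b \<otimes>\<^bsub>F\<^esub> Y" if z: "z \<in> carrier F" for z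
  proof -
    have "f z \<in> carrier W"
      using z f(1) by (auto simp: bij_betw_def)
    then obtain a b where ab: "a \<in> carrier L" "b \<in> carrier L" "f z = smult W a x \<oplus>\<^bsub>W\<^esub> smult W b y"
      using assms(3) unfolding left_basis_def by blast
    then have "f z = f (\<iota> a \<otimes>\<^bsub>F\<^esub> X \<oplus>\<^bsub>F\<^esub> \<iota> b \<otimes>\<^bsub>F\<^esub> Y)"
      using XY f(2,3) ic by simp
    then have "z = \<iota> a \<otimes>\<^bsub>F\<^esub> X \<oplus>\<^bsub>F\<^esub> \<iota> b \<otimes>\<^bsub>F\<^esub> Y"
      using inj_onD[OF bij_betw_imp_inj_on[OF f(1)]] z XY ab ic by simp
    then show ?thesis
      using ab by blast
  qed
  then show thesis
    using that XY ne by blast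
qed

section \<open>The simple case\<close>

lemma alt_minus_two: "alt p q (-2) = alt p q 0"
  by (simp add: alt_def)

locale simple_field_model = simple_model K0 K1 V W ev F \<iota>0 \<iota>1 \<sigma>0 \<sigma>1 w0 w1 f
  for K0 K1 :: "'k ring" and V :: "('k, 'v) bimod" and W ev and F :: "'f ring"
    and \<iota>0 \<iota>1 \<sigma>0 \<sigma>1 w0 w1 f +
  assumes fields: "field K0" "field K1"
    and char_not_two: "\<one>\<^bsub>K0\<^esub> \<oplus>\<^bsub>K0\<^esub> \<one>\<^bsub>K0\<^esub> \<noteq> \<zero>\<^bsub>K0\<^esub>"
begin

sublocale symmetric_algebra "alt K0 K1" W ev by (rule symmetric_algebra)

interpretation F: field F by (rule field_F)

abbreviation KK :: "int \<Rightarrow> 'k ring" where "KK \<equiv> alt K0 K1"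
abbreviation emb_of :: "int \<Rightarrow> 'k \<Rightarrow> 'f" where "emb_of \<equiv> alt \<iota>0 \<iota>1"
abbreviation LL :: "int \<Rightarrow> 'f set" where "LL i \<equiv> emb_of i ` carrier (KK i)"
abbreviation ww :: "int \<Rightarrow> 'f" where "ww \<equiv> alt w0 w1"
abbreviation \<sigma>\<sigma> :: "int \<Rightarrow> 'f \<Rightarrow> 'f" where "\<sigma>\<sigma> \<equiv> alt \<sigma>0 \<sigma>1"
abbreviation trace :: "int \<Rightarrow> 'f \<Rightarrow> 'k" where "trace i \<equiv> half_trace F (KK i) (emb_of i) (\<sigma>\<sigma> i)"
abbreviation g :: "int \<Rightarrow> ('k, 'v) tens set" where "g \<equiv> g_simple KK W ev F w0 w1 f"

lemma KK_field: "field (KK i)"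
  using fields by (simp add: alt_def)

lemma emb_hom: "emb_of i \<in> ring_hom (KK i) F"
  using emb by (simp add: alt_def)

lemma emb_ring_hom_ring: "ring_hom_ring (KK i) F (emb_of i)"
  using KK_field[of i] field_F emb_hom[of i]
  by (intro ring_hom_ringI2) (auto simp: field_def domain_def cring_def)

lemma emb_closed [simp]: "k \<in> carrier (KK i) \<Longrightarrow> emb_of i k \<in> carrier F"
  by (rule ring_hom_closed[OF emb_hom])

lemma emb_inj: "inj_on (emb_of i) (carrier (KK i))"
  by (rule ring_hom_ring.img_is_subfield(1)[OF emb_ring_hom_ring field.carrier_is_subfield[OF KK_field] F.one_not_zero])

lemma subfield_LL: "subfield (LL i) F"
  by (rule ring_hom_ring.img_is_subfield(2)[OF emb_ring_hom_ring field.carrier_is_subfield[OF KK_field] F.one_not_zero])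

lemma two_nonzero: "\<one>\<^bsub>F\<^esub> \<oplus>\<^bsub>F\<^esub> \<one>\<^bsub>F\<^esub> \<noteq> \<zero>\<^bsub>F\<^esub>"
proof
  assume *: "\<one>\<^bsub>F\<^esub> \<oplus>\<^bsub>F\<^esub> \<one>\<^bsub>F\<^esub> = \<zero>\<^bsub>F\<^esub>"
  interpret h: ring_hom_ring K0 F \<iota>0
    using emb_ring_hom_ring[of 0] by (simp add: alt_def)
  have "\<iota>0 (\<one>\<^bsub>K0\<^esub> \<oplus>\<^bsub>K0\<^esub> \<one>\<^bsub>K0\<^esub>) = \<iota>0 \<zero>\<^bsub>K0\<^esub>"
    using * by simp
  then have "\<one>\<^bsub>K0\<^esub> \<oplus>\<^bsub>K0\<^esub> \<one>\<^bsub>K0\<^esub> = \<zero>\<^bsub>K0\<^esub>"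
    using emb_inj[of 0] unfolding alt_def inj_on_def by simp
  then show False
    using char_not_two by simp
qed

lemma quadratic: "quadratic_extension F (LL i) (ww i)"
  by (rule quadratic_extension.intro[OF field_F], rule quadratic_extension_axioms.intro)
    (use subfield_LL[of i] degree w_closed w_square w_notin in \<open>auto simp: alt_def split: if_splits\<close>)

lemma LL_carrier: "a \<in> LL i \<Longrightarrow> a \<in> carrier F"
  using quadratic_extension.L_carrier[OF quadratic] .

lemma ww_carrier [simp]: "ww i \<in> carrier F"
  using w_closed by (simp add: alt_def)

abbreviation re :: "int \<Rightarrow> 'f \<Rightarrow> 'f" where "re i \<equiv> quadratic_extension.re F (LL i) (ww i)"

lemma f_bij: "bij_betw (f i) (carrier F) (carrier (W i))"
  using f_iso[of i] by (simp add: bimod_iso_def field_bimod_def)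

lemma f_closed [simp]: "a \<in> carrier F \<Longrightarrow> f i a \<in> carrier (W i)"
  using f_bij[of i] by (auto simp: bij_betw_def)

lemma f_add: "a \<in> carrier F \<Longrightarrow> b \<in> carrier F \<Longrightarrow> f i (a \<oplus>\<^bsub>F\<^esub> b) = f i a \<oplus>\<^bsub>W i\<^esub> f i b"
  using f_iso[of i] by (simp add: bimod_iso_def field_bimod_def)

lemma f_smult: "k \<in> carrier (KK i) \<Longrightarrow> a \<in> carrier F \<Longrightarrow> f i (emb_of i k \<otimes>\<^bsub>F\<^esub> a) = smult (W i) k (f i a)"
  using f_iso[of i] by (simp add: bimod_iso_def field_bimod_def)

lemma f_rsmult:
  "k \<in> carrier (KK (i + 1)) \<Longrightarrow> a \<in> carrier F \<Longrightarrow> f i (a \<otimes>\<^bsub>F\<^esub> emb_of (i + 1) k) = rsmult (W i) (f i a) k"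
  using f_iso[of i] by (simp add: bimod_iso_def field_bimod_def)

lemma trace_additive:
  assumes "a \<in> carrier F" "b \<in> carrier F"
  shows "trace i a \<in> carrier (KK i)" "trace i (a \<oplus>\<^bsub>F\<^esub> b) = trace i a \<oplus>\<^bsub>KK i\<^esub> trace i b"
proof -
  define n :: int where "n = (if even i then 1 else 0)"
  have n: "alt p q (n + 1) = alt p q i" for p q :: 'x
    by (simp add: alt_def n_def)
  have tr: "trace i z = ev n (f (n + 1) \<one>\<^bsub>F\<^esub>) (f n z)" if "z \<in> carrier F" for z
    using f_pairing[of "\<one>\<^bsub>F\<^esub>" z n] that by (simp add: n) (simp add: alt_def)
  have "0 \<le> n"
    by (simp add: n_def)
  then have "bij_betw (\<lambda>\<psi>. \<lambda>v\<in>carrier (W n). ev n \<psi> v) (carrier (W (n + 1)))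
      (carrier (right_dual (KK n) (KK (n + 1)) (W n)))"
    using right[of n] by (simp add: bimod_iso_def)
  then have "(\<lambda>v\<in>carrier (W n). ev n (f (n + 1) \<one>\<^bsub>F\<^esub>) v) \<in> carrier (right_dual (KK n) (KK (n + 1)) (W n))"
    by (rule bij_betw_apply) simp
  then have evn: "ev n (f (n + 1) \<one>\<^bsub>F\<^esub>) v \<in> carrier (KK i)"
    "ev n (f (n + 1) \<one>\<^bsub>F\<^esub>) (v \<oplus>\<^bsub>W n\<^esub> v') = ev n (f (n + 1) \<one>\<^bsub>F\<^esub>) v \<oplus>\<^bsub>KK i\<^esub> ev n (f (n + 1) \<one>\<^bsub>F\<^esub>) v'"
    if "v \<in> carrier (W n)" "v' \<in> carrier (W n)" for v v'
    using that by (auto simp: right_dual_def n PiE_iff)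
  then show "trace i a \<in> carrier (KK i)" "trace i (a \<oplus>\<^bsub>F\<^esub> b) = trace i a \<oplus>\<^bsub>KK i\<^esub> trace i b"
    using assms evn[of "f n a" "f n b"] by (simp_all add: tr f_add)
qed

lemma trace_eq: "z \<in> carrier F \<Longrightarrow> trace i z = inv_into (carrier (KK i)) (emb_of i) (re i z)"
proof -
  interpret Q: quadratic_extension F "LL i" "ww i" by (rule quadratic)
  have s: "\<sigma>\<sigma> i \<in> ring_iso F F" "\<And>c. c \<in> LL i \<Longrightarrow> \<sigma>\<sigma> i c = c"
    using gal by (auto simp: alt_def galois_generator_def galois_group_def)
  have "ring (KK i)" "\<one>\<^bsub>KK i\<^esub> \<noteq> \<zero>\<^bsub>KK i\<^esub>"
    using KK_field[of i] by (auto simp: field_def domain_def cring_def domain_axioms_def)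
  then have "\<sigma>\<sigma> i (ww i) \<noteq> ww i"
    using Q.conjugate_w_neq[OF _ _ emb_hom refl emb_inj s two_nonzero] trace_additive(1)[of "ww i" "ww i"] trace_additive(2) by simp
  then show "z \<in> carrier F \<Longrightarrow> ?thesis"
    using Q.half_trace_eq[OF s _ two_nonzero] by simp
qed

lemma ev_eq:
  assumes "a \<in> carrier F" "b \<in> carrier F" "k \<in> carrier (KK (i + 1))"
  shows "ev i (f (i + 1) a) (f i b) = k \<longleftrightarrow> re (i + 1) (b \<otimes>\<^bsub>F\<^esub> a) = emb_of (i + 1) k"
proof -
  interpret Q: quadratic_extension F "LL (i + 1)" "ww (i + 1)" by (rule quadratic)
  have "ev i (f (i + 1) a) (f i b) = trace (i + 1) (b \<otimes>\<^bsub>F\<^esub> a)"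
    using f_pairing[OF assms(1,2)] by (simp add: alt_def)
  also have "\<dots> = inv_into (carrier (KK (i + 1))) (emb_of (i + 1)) (re (i + 1) (b \<otimes>\<^bsub>F\<^esub> a))"
    using assms by (simp add: trace_eq)
  moreover have "re (i + 1) (b \<otimes>\<^bsub>F\<^esub> a) \<in> LL (i + 1)"
    using assms by (intro Q.re_in_L) simp
  ultimately show ?thesis
    using assms(3) emb_inj[of "i + 1"] by (metis f_inv_into_f inv_into_f_f)
qed

lemma ev_one_zero:
  assumes "a \<in> carrier F" "b \<in> carrier F"
  shows "ev i (f (i + 1) a) (f i b) = \<one>\<^bsub>KK (i + 1)\<^esub> \<longleftrightarrow> re (i + 1) (b \<otimes>\<^bsub>F\<^esub> a) = \<one>\<^bsub>F\<^esub>"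
    "ev i (f (i + 1) a) (f i b) = \<zero>\<^bsub>KK (i + 1)\<^esub> \<longleftrightarrow> re (i + 1) (b \<otimes>\<^bsub>F\<^esub> a) = \<zero>\<^bsub>F\<^esub>"
proof -
  interpret h: ring_hom_ring "KK (i + 1)" F "emb_of (i + 1)" by (rule emb_ring_hom_ring)
  show "ev i (f (i + 1) a) (f i b) = \<one>\<^bsub>KK (i + 1)\<^esub> \<longleftrightarrow> re (i + 1) (b \<otimes>\<^bsub>F\<^esub> a) = \<one>\<^bsub>F\<^esub>"
    "ev i (f (i + 1) a) (f i b) = \<zero>\<^bsub>KK (i + 1)\<^esub> \<longleftrightarrow> re (i + 1) (b \<otimes>\<^bsub>F\<^esub> a) = \<zero>\<^bsub>F\<^esub>"
    by (simp_all add: ev_eq assms)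
qed

definition t :: "int \<Rightarrow> 'f \<Rightarrow> 'f \<Rightarrow> ('k, 'v) tens set" where
  "t i a b = S i [f i a, f (i + 1) b]"

lemma t_balanced_map: "balanced_map F (LL (i + 1)) (ww (i + 1)) (zgrp A i (i + 2)) (t i)"
proof (intro balanced_map.intro quadratic balanced_map_axioms.intro)
  show "biadditive (add_monoid F) (add_monoid F) (zgrp A i (i + 2)) (t i)"
  proof (intro biadditive.intro biadditive_axioms.intro F.a_comm_group)
    show "comm_group (zgrp A i (i + 2))"
      by (rule biadditive_zalg.zgrp_comm_group[OF biadditive_zalg_A])
    show "t i a b \<in> carrier (zgrp A i (i + 2))" if "a \<in> carrier (add_monoid F)" "b \<in> carrier (add_monoid F)" for a b
      unfolding t_def using that by (intro S_closed) auto
    show "t i (a \<otimes>\<^bsub>add_monoid F\<^esub> a') b = t i a b \<otimes>\<^bsub>zgrp A i (i + 2)\<^esub> t i a' b"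
      if "a \<in> carrier (add_monoid F)" "a' \<in> carrier (add_monoid F)" "b \<in> carrier (add_monoid F)" for a a' b
      using that S_add[of "[]" "f i a" "[f (i + 1) b]" i "i + 2" "f i a'"] by (simp add: t_def f_add)
    show "t i a (b \<otimes>\<^bsub>add_monoid F\<^esub> b') = t i a b \<otimes>\<^bsub>zgrp A i (i + 2)\<^esub> t i a b'"
      if "a \<in> carrier (add_monoid F)" "b \<in> carrier (add_monoid F)" "b' \<in> carrier (add_monoid F)" for a b b'
      using that S_add[of "[f i a]" "f (i + 1) b" "[]" i "i + 2" "f (i + 1) b'"] by (simp add: t_def f_add)
  qed
  show "t i (a \<otimes>\<^bsub>F\<^esub> k) b = t i a (k \<otimes>\<^bsub>F\<^esub> b)" if "a \<in> carrier F" "b \<in> carrier F" "k \<in> LL (i + 1)" for a b k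
    using that S_balance[of "f i a" i "f (i + 1) b"] by (auto simp: t_def f_smult f_rsmult)
qed

lemma g_eq: "g i = t i (ww (i + 1)) \<one>\<^bsub>F\<^esub> \<otimes>\<^bsub>zgrp A i (i + 2)\<^esub> t i \<one>\<^bsub>F\<^esub> (ww (i + 1))"
  by (simp add: g_simple_def t_def alt_def Let_def)

lemma t_mult: "a \<in> carrier F \<Longrightarrow> b \<in> carrier F \<Longrightarrow> zmult A i (i + 1) (i + 2) (S i [f i a]) (S (i + 1) [f (i + 1) b]) = t i a b"
  by (simp add: S_mult t_def)

lemma g_closed: "g i \<in> zcar A i (i + 2)"
proof -
  interpret t: balanced_map F "LL (i + 1)" "ww (i + 1)" "zgrp A i (i + 2)" "t i" by (rule t_balanced_map)
  show ?thesis by (simp add: g_eq)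
qed

sublocale localization A 2 g
  by (rule localization_A) (rule g_closed)

lemma left_basis_coordinates:
  assumes "left_basis (KK i) (W i) x y"
  obtains X Y where "X \<in> carrier F" "Y \<in> carrier F" "x = f i X" "y = f i Y" "X \<noteq> \<zero>\<^bsub>F\<^esub>" "Y \<noteq> \<zero>\<^bsub>F\<^esub>"
    "\<And>z. z \<in> carrier F \<Longrightarrow> \<exists>a\<in>LL i. \<exists>b\<in>LL i. z = a \<otimes>\<^bsub>F\<^esub> X \<oplus>\<^bsub>F\<^esub> b \<otimes>\<^bsub>F\<^esub> Y"
  by (rule left_basis_transport[OF KK_field left_module assms f_bij f_add f_smult field_F emb_hom]) (use that in blast)+

lemma right_basis_coordinates:
  assumes "right_basis (KK (i + 1)) (W i) x y"
  obtains X Y where "X \<in> carrier F" "Y \<in> carrier F" "x = f i X" "y = f i Y" "X \<noteq> \<zero>\<^bsub>F\<^esub>" "Y \<noteq> \<zero>\<^bsub>F\<^esub>"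
    "\<And>z. z \<in> carrier F \<Longrightarrow> \<exists>a\<in>LL (i + 1). \<exists>b\<in>LL (i + 1). z = a \<otimes>\<^bsub>F\<^esub> X \<oplus>\<^bsub>F\<^esub> b \<otimes>\<^bsub>F\<^esub> Y"
proof (rule left_basis_transport[OF KK_field right_module, of i x y "f i" F "emb_of (i + 1)"])
  show "left_basis (KK (i + 1)) (right_module (W i)) x y"
    using assms by (simp add: right_basis_def)
  show "f i (emb_of (i + 1) k \<otimes>\<^bsub>F\<^esub> a) = smult (right_module (W i)) k (f i a)"
    if "k \<in> carrier (KK (i + 1))" "a \<in> carrier F" for k a
    using that f_rsmult[of k i a] by (simp add: F.m_comm)
qed (use that f_bij f_add emb_hom field_F in auto)

lemma dual_bases_one_w:
  "dual_bases KK W ev i (f i \<one>\<^bsub>F\<^esub>) (f i (ww (i + 1))) (f (i + 1) \<one>\<^bsub>F\<^esub>) (f (i + 1) (inv\<^bsub>F\<^esub> (ww (i + 1))))"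
proof -
  interpret Q: quadratic_extension F "LL (i + 1)" "ww (i + 1)" by (rule quadratic)
  let ?w = "ww (i + 1)"
  have iw: "inv\<^bsub>F\<^esub> ?w \<in> carrier F" "?w \<otimes>\<^bsub>F\<^esub> inv\<^bsub>F\<^esub> ?w = \<one>\<^bsub>F\<^esub>"
    using Q.w_nonzero by (simp_all add: F.field_Units)
  have "\<exists>!(a, b). a \<in> carrier (KK (i + 1)) \<and> b \<in> carrier (KK (i + 1)) \<and>
      v = rsmult (W i) (f i \<one>\<^bsub>F\<^esub>) a \<oplus>\<^bsub>W i\<^esub> rsmult (W i) (f i ?w) b" if v: "v \<in> carrier (W i)" for v
  proof -
    have comb: "rsmult (W i) (f i \<one>\<^bsub>F\<^esub>) a \<oplus>\<^bsub>W i\<^esub> rsmult (W i) (f i ?w) b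
        = f i (emb_of (i + 1) a \<oplus>\<^bsub>F\<^esub> emb_of (i + 1) b \<otimes>\<^bsub>F\<^esub> ?w)"
      if "a \<in> carrier (KK (i + 1))" "b \<in> carrier (KK (i + 1))" for a b
      using that f_rsmult[of a i "\<one>\<^bsub>F\<^esub>"] f_rsmult[of b i ?w]
      by (simp add: f_add F.m_comm)
    obtain z where z: "z \<in> carrier F" "v = f i z"
      using v f_bij[of i] by (auto simp: bij_betw_def)
    obtain m n where mn: "m \<in> LL (i + 1)" "n \<in> LL (i + 1)" "z = m \<oplus>\<^bsub>F\<^esub> n \<otimes>\<^bsub>F\<^esub> ?w"
      by (rule Q.decompose[OF z(1)])
    then obtain a b where ab: "a \<in> carrier (KK (i + 1))" "b \<in> carrier (KK (i + 1))"
      "z = emb_of (i + 1) a \<oplus>\<^bsub>F\<^esub> emb_of (i + 1) b \<otimes>\<^bsub>F\<^esub> ?w"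
      by (elim imageE) simp
    have uniq: "a' = a \<and> b' = b" if "a' \<in> carrier (KK (i + 1))" "b' \<in> carrier (KK (i + 1))"
      "v = rsmult (W i) (f i \<one>\<^bsub>F\<^esub>) a' \<oplus>\<^bsub>W i\<^esub> rsmult (W i) (f i ?w) b'" for a' b'
    proof -
      have "f i z = f i (emb_of (i + 1) a' \<oplus>\<^bsub>F\<^esub> emb_of (i + 1) b' \<otimes>\<^bsub>F\<^esub> ?w)"
        using that comb z by simp
      then have "z = emb_of (i + 1) a' \<oplus>\<^bsub>F\<^esub> emb_of (i + 1) b' \<otimes>\<^bsub>F\<^esub> ?w"
        by (rule inj_onD[OF bij_betw_imp_inj_on[OF f_bij]]) (simp_all add: z(1) that(1,2))
      then have "emb_of (i + 1) a' \<oplus>\<^bsub>F\<^esub> emb_of (i + 1) b' \<otimes>\<^bsub>F\<^esub> ?w = emb_of (i + 1) a \<oplus>\<^bsub>F\<^esub> emb_of (i + 1) b \<otimes>\<^bsub>F\<^esub> ?w"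
        by (simp only: ab(3))
      note Q.independent_one_w[OF imageI imageI imageI imageI this, OF that(1,2) ab(1,2)]
      then show ?thesis
        using inj_onD[OF emb_inj] ab(1,2) that(1,2) by metis
    qed
    show ?thesis
    proof (rule ex1I[of _ "(a, b)"])
      have "v = rsmult (W i) (f i \<one>\<^bsub>F\<^esub>) a \<oplus>\<^bsub>W i\<^esub> rsmult (W i) (f i ?w) b"
        unfolding comb[OF ab(1,2)] z(2) ab(3) ..
      then show "case (a, b) of (a, b) \<Rightarrow> a \<in> carrier (KK (i + 1)) \<and> b \<in> carrier (KK (i + 1)) \<and>
          v = rsmult (W i) (f i \<one>\<^bsub>F\<^esub>) a \<oplus>\<^bsub>W i\<^esub> rsmult (W i) (f i ?w) b"
        using ab(1,2) by blast
    next
      fix r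
      assume "case r of (a, b) \<Rightarrow> a \<in> carrier (KK (i + 1)) \<and> b \<in> carrier (KK (i + 1)) \<and>
          v = rsmult (W i) (f i \<one>\<^bsub>F\<^esub>) a \<oplus>\<^bsub>W i\<^esub> rsmult (W i) (f i ?w) b"
      then show "r = (a, b)"
        by (cases r) (use uniq in blast)
    qed
  qed
  then have "right_basis (KK (i + 1)) (W i) (f i \<one>\<^bsub>F\<^esub>) (f i ?w)"
    by (simp add: right_basis_def left_basis_def)
  moreover have "re (i + 1) ?w = \<zero>\<^bsub>F\<^esub>"
    using Q.re_times_w[of "\<one>\<^bsub>F\<^esub>"] by simp
  ultimately show ?thesis
    using iw Q.re_inv_w by (simp add: dual_bases_def ev_one_zero)
qed

lemma t_relation:
  assumes "k \<in> LL i"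
  shows "t i k \<one>\<^bsub>F\<^esub> \<otimes>\<^bsub>zgrp A i (i + 2)\<^esub> t i (k \<otimes>\<^bsub>F\<^esub> ww (i + 1)) (inv\<^bsub>F\<^esub> (ww (i + 1))) = \<one>\<^bsub>zgrp A i (i + 2)\<^esub>"
proof -
  obtain a where a: "a \<in> carrier (KK i)" "k = emb_of i a"
    using assms by blast
  have "smult (W i) a (f i \<one>\<^bsub>F\<^esub>) = f i k" "smult (W i) a (f i (ww (i + 1))) = f i (k \<otimes>\<^bsub>F\<^esub> ww (i + 1))"
    using a LL_carrier[OF assms] f_smult[of a i "\<one>\<^bsub>F\<^esub>"] by (simp_all add: f_smult)
  then show ?thesis
    using S_relation[OF dual_bases_one_w a(1)] by (simp add: t_def)
qed

lemma t_dual_relation: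
  assumes "dual_bases KK W ev i (f i X) (f i Y) (f (i + 1) X') (f (i + 1) Y')"
  shows "t i X X' \<otimes>\<^bsub>zgrp A i (i + 2)\<^esub> t i Y Y' = \<one>\<^bsub>zgrp A i (i + 2)\<^esub>"
proof -
  interpret module "KK i" "W i" by (rule left_module)
  have "f i X \<in> carrier (W i)" "f i Y \<in> carrier (W i)"
    using assms by (auto simp: dual_bases_def right_basis_def left_basis_def)
  then show ?thesis
    using S_relation[OF assms R.one_closed] by (simp add: t_def)
qed

lemma t_lift:
  assumes "X \<in> carrier F" "Y \<in> carrier F" "Y \<noteq> \<zero>\<^bsub>F\<^esub>"
    and "\<And>z. z \<in> carrier F \<Longrightarrow> \<exists>a\<in>LL i. \<exists>b\<in>LL i. z = a \<otimes>\<^bsub>F\<^esub> X \<oplus>\<^bsub>F\<^esub> b \<otimes>\<^bsub>F\<^esub> Y"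
  shows "\<exists>x2\<in>carrier F. \<exists>c\<in>carrier F. t i x2 (ww i \<otimes>\<^bsub>F\<^esub> X) = g i \<otimes>\<^bsub>zgrp A i (i + 2)\<^esub> t i c X \<and>
    t i x2 (ww i \<otimes>\<^bsub>F\<^esub> Y) = t i c Y"
proof -
  interpret t: balanced_map F "LL (i + 1)" "ww (i + 1)" "zgrp A i (i + 2)" "t i" by (rule t_balanced_map)
  interpret Q: quadratic_extension F "LL i" "ww i" by (rule quadratic)
  obtain \<alpha> \<beta> where ab: "\<alpha> \<in> LL (i + 1)" "\<beta> \<in> LL (i + 1)" "ww i = \<alpha> \<oplus>\<^bsub>F\<^esub> \<beta> \<otimes>\<^bsub>F\<^esub> ww (i + 1)"
    by (rule t.decompose[OF ww_carrier])
  have "ww i \<notin> LL (i + 1)"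
    using w_notin by (simp add: alt_def)
  moreover have "ww i = \<alpha>" if "\<beta> = \<zero>\<^bsub>F\<^esub>"
    unfolding ab(3) that using LL_carrier[OF ab(1)] by simp
  ultimately have "\<beta> \<noteq> \<zero>\<^bsub>F\<^esub>"
    using ab(1) by metis
  moreover obtain k' k where k: "k' \<in> LL i" "k \<in> LL i" "ww (i + 1) \<otimes>\<^bsub>F\<^esub> Y = k' \<otimes>\<^bsub>F\<^esub> X \<oplus>\<^bsub>F\<^esub> k \<otimes>\<^bsub>F\<^esub> Y"
    using assms(4)[OF F.m_closed[OF ww_carrier assms(2)]] by blast
  moreover have "ww (i + 1) \<otimes>\<^bsub>F\<^esub> Y \<oplus>\<^bsub>F\<^esub> (\<ominus>\<^bsub>F\<^esub> k) \<otimes>\<^bsub>F\<^esub> Y = k' \<otimes>\<^bsub>F\<^esub> X"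
    unfolding k(3) using assms(1,2) LL_carrier[OF k(1)] LL_carrier[OF k(2)]
    by (simp add: F.a_assoc F.l_minus F.r_neg)
  moreover have "LL i \<subseteq> carrier F"
    using LL_carrier by blast
  ultimately show ?thesis
    using t.tensor_lift[OF ab(1,2) _ assms(1-3) _ t_relation, where k = "\<ominus>\<^bsub>F\<^esub> k" and k' = k'] Q.L_closed(5)[OF k(2)]
    by (simp add: ab(3) g_eq)
qed

lemma presentation:
  assumes basis: "two_sided_basis K0 K1 V x y" and dual: "dual_bases KK W ev (-1) lx ly x y"
    and llbasis: "two_sided_basis K0 K1 (W (-2)) llx lly"
  defines "entry \<equiv> \<lambda>s t. zmult B 0 (-2) 0 (loc_inv A 2 g (-2))
      (zmult B (-2) (-1) 0 (im (-2) (-1) (S (-2) [s])) (im (-1) 0 (S (-1) [t])))"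
  shows "is_presentation (zcar B 0 0) (module_sum (zmod B 0 0) (zmod B 0 0)) (module_sum (zmod B 0 0) (zmod B 0 0))
     (zmod B 0 1)
     (\<lambda>(a, b). (zmult B 0 0 0 a (entry llx lx) \<otimes>\<^bsub>zgrp B 0 0\<^esub> zmult B 0 0 0 b (entry lly lx),
        zmult B 0 0 0 a (entry llx ly) \<otimes>\<^bsub>zgrp B 0 0\<^esub> zmult B 0 0 0 b (entry lly ly)))
     (\<lambda>(a, b). zmult B 0 0 1 a (im 0 1 (S 0 [x])) \<otimes>\<^bsub>zgrp B 0 1\<^esub> zmult B 0 0 1 b (im 0 1 (S 0 [y])))"
proof -
  note par = alt_minus_two
  interpret Q: quadratic_extension F "LL 0" "ww 0" by (rule quadratic)
  have lb: "left_basis (KK 0) (W 0) x y" "left_basis (KK (-2)) (W (-2)) llx lly"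
    using basis llbasis start by (simp_all add: two_sided_basis_def alt_def)
  obtain X Y where XY: "X \<in> carrier F" "Y \<in> carrier F" "x = f 0 X" "y = f 0 Y"
    and XY_span: "\<And>z. z \<in> carrier F \<Longrightarrow> \<exists>a\<in>LL 0. \<exists>b\<in>LL 0. z = a \<otimes>\<^bsub>F\<^esub> X \<oplus>\<^bsub>F\<^esub> b \<otimes>\<^bsub>F\<^esub> Y"
    by (rule left_basis_coordinates[OF lb(1)]) blast
  obtain P Q where PQ: "P \<in> carrier F" "Q \<in> carrier F" "llx = f (-2) P" "lly = f (-2) Q"
    and PQ_span: "\<And>z. z \<in> carrier F \<Longrightarrow> \<exists>a\<in>LL 0. \<exists>b\<in>LL 0. z = a \<otimes>\<^bsub>F\<^esub> P \<oplus>\<^bsub>F\<^esub> b \<otimes>\<^bsub>F\<^esub> Q"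
    by (rule left_basis_coordinates[OF lb(2), unfolded par]) blast
  have index: "(-1::int) + 1 = 0"
    by simp
  have rb: "right_basis (KK (-1 + 1)) (W (-1)) lx ly"
    using dual by (simp add: dual_bases_def)
  obtain X' Y' where XY': "X' \<in> carrier F" "Y' \<in> carrier F" "lx = f (-1) X'" "ly = f (-1) Y'" "X' \<noteq> \<zero>\<^bsub>F\<^esub>" "Y' \<noteq> \<zero>\<^bsub>F\<^esub>"
    and XY'_span: "\<And>z. z \<in> carrier F \<Longrightarrow> \<exists>a\<in>LL 0. \<exists>b\<in>LL 0. z = a \<otimes>\<^bsub>F\<^esub> X' \<oplus>\<^bsub>F\<^esub> b \<otimes>\<^bsub>F\<^esub> Y'"
    by (rule right_basis_coordinates[OF rb, unfolded index]) blast
  have re: "re 0 (X' \<otimes>\<^bsub>F\<^esub> X) = \<one>\<^bsub>F\<^esub>" "re 0 (X' \<otimes>\<^bsub>F\<^esub> Y) = \<zero>\<^bsub>F\<^esub>" "re 0 (Y' \<otimes>\<^bsub>F\<^esub> X) = \<zero>\<^bsub>F\<^esub>" "re 0 (Y' \<otimes>\<^bsub>F\<^esub> Y) = \<one>\<^bsub>F\<^esub>"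
    using dual ev_one_zero[of _ _ "-1"] XY XY' by (simp_all add: dual_bases_def)
  define p where "p = ww 0 \<otimes>\<^bsub>F\<^esub> X'"
  define q where "q = ww 0 \<otimes>\<^bsub>F\<^esub> Y'"
  have pq: "p \<in> carrier F" "q \<in> carrier F"
    using XY' by (simp_all add: p_def q_def)
  interpret t1: balanced_map F "LL 0" "ww 0" "zgrp A (-1) 1" "t (-1)"
    using t_balanced_map[of "-1"] by simp
  interpret t3: balanced_map F "LL 0" "ww 0" "zgrp A (-3) (-1)" "t (-3)"
    using t_balanced_map[of "-3"] by (simp add: par)
  have g1: "g (-1) = t (-1) p X \<otimes>\<^bsub>zgrp A (-1) 1\<^esub> t (-1) q Y"
    using t1.symmetric_tensor_dual_basis[OF XY(1,2) XY'(1,2) XY_span re] g_eq[of "-1"] by (simp add: p_def q_def)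
  obtain a b where ab: "a \<in> LL 0" "b \<in> LL 0" "\<one>\<^bsub>F\<^esub> = a \<otimes>\<^bsub>F\<^esub> P \<oplus>\<^bsub>F\<^esub> b \<otimes>\<^bsub>F\<^esub> Q"
    using PQ_span[of "\<one>\<^bsub>F\<^esub>"] by blast
  obtain a' b' where ab': "a' \<in> LL 0" "b' \<in> LL 0" "ww 0 = a' \<otimes>\<^bsub>F\<^esub> P \<oplus>\<^bsub>F\<^esub> b' \<otimes>\<^bsub>F\<^esub> Q"
    using PQ_span[of "ww 0"] by auto
  define p' where "p' = ww 0 \<otimes>\<^bsub>F\<^esub> a \<oplus>\<^bsub>F\<^esub> a'"
  define q' where "q' = ww 0 \<otimes>\<^bsub>F\<^esub> b \<oplus>\<^bsub>F\<^esub> b'"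
  have pq': "p' \<in> carrier F" "q' \<in> carrier F"
    unfolding p'_def q'_def by (simp_all add: LL_carrier[OF ab(1)] LL_carrier[OF ab(2)] LL_carrier[OF ab'(1)] LL_carrier[OF ab'(2)])
  have g3: "g (-3) = t (-3) p' P \<otimes>\<^bsub>zgrp A (-3) (-1)\<^esub> t (-3) q' Q"
    using t3.symmetric_tensor_expand[OF PQ(1,2) ab(1,2) ab'(1,2) _ ab(3) ab'(3)] g_eq[of "-3"]
    by (simp add: p'_def q'_def par)
  obtain x2 c where x2: "x2 \<in> carrier F" "c \<in> carrier F"
    "t (-2) x2 p = g (-2) \<otimes>\<^bsub>zgrp A (-2) 0\<^esub> t (-2) c X'" "t (-2) x2 q = t (-2) c Y'"
    using t_lift[of X' Y' "-2"] XY' XY'_span by (auto simp: par p_def q_def)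
  have "\<exists>a\<in>LL 0. \<exists>b\<in>LL 0. z = a \<otimes>\<^bsub>F\<^esub> Y' \<oplus>\<^bsub>F\<^esub> b \<otimes>\<^bsub>F\<^esub> X'" if z: "z \<in> carrier F" for z
  proof -
    obtain a b where "a \<in> LL 0" "b \<in> LL 0" "z = a \<otimes>\<^bsub>F\<^esub> X' \<oplus>\<^bsub>F\<^esub> b \<otimes>\<^bsub>F\<^esub> Y'"
      using XY'_span[OF z] by blast
    then have "z = b \<otimes>\<^bsub>F\<^esub> Y' \<oplus>\<^bsub>F\<^esub> a \<otimes>\<^bsub>F\<^esub> X'"
      using XY'(1,2) LL_carrier F.a_comm F.m_closed by metis
    then show ?thesis
      using \<open>a \<in> LL 0\<close> \<open>b \<in> LL 0\<close> by blast
  qed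
  then obtain y2 e where y2: "y2 \<in> carrier F" "e \<in> carrier F"
    "t (-2) y2 q = g (-2) \<otimes>\<^bsub>zgrp A (-2) 0\<^esub> t (-2) e Y'" "t (-2) y2 p = t (-2) e X'"
    using t_lift[of Y' X' "-2"] XY' by (auto simp: par p_def q_def)
  define I where "I i z = im i (i + 1) (S i [f i z])" for i z
  have I_closed: "I i z \<in> zcar B i (i + 1)" if "z \<in> carrier F" for i z
    unfolding I_def using that by (intro im_closed S_closed) auto
  have S1: "S i [f i z] \<in> zcar A i (i + 1)" if "z \<in> carrier F" for i z
    using that by (intro S_closed) auto
  have I_mult: "zmult B i (i + 1) (i + 2) (I i z) (I (i + 1) z') = im i (i + 2) (t i z z')"
    if "z \<in> carrier F" "z' \<in> carrier F" for i z z'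
    using that im_mult[OF S1[of z i] S1[of z' "i + 1", simplified add.assoc one_add_one]]
    by (simp add: I_def t_mult add.assoc)
  have t_closed: "t i z z' \<in> zcar A i (i + 2)" if "z \<in> carrier F" "z' \<in> carrier F" for i z z'
    unfolding t_def using that by (intro S_closed) auto
  interpret B: z_algebra B
    by (rule z_algebra_zloc)
  have G: "im i (i + 2) (g i) \<in> zcar B i (i + 2)" "loc_inv A 2 g i \<in> zcar B (i + 2) i"
    "zmult B i (i + 2) i (im i (i + 2) (g i)) (loc_inv A 2 g i) = zone B i"
    "zmult B (i + 2) i (i + 2) (loc_inv A 2 g i) (im i (i + 2) (g i)) = zone B (i + 2)" for i
    using im_closed[OF g_closed] loc_inv_closed g_loc_inv loc_inv_g by simp_all
  have rel: "t (-1) X' X \<otimes>\<^bsub>zgrp A (-1) 1\<^esub> t (-1) Y' Y = \<one>\<^bsub>zgrp A (-1) 1\<^esub>"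
    using t_dual_relation[of "-1" X' Y' X Y] dual XY XY' by simp
  interpret presentation_data B "I 0 X" "I 0 Y" "I (-1) X'" "I (-1) Y'" "I (-2) P" "I (-2) Q" "I (-1) p" "I (-1) q"
    "I (-2) x2" "I (-2) y2" "I (-2) c" "I (-2) e" "im (-1) 1 (g (-1))" "loc_inv A 2 g (-1)"
    "im (-2) 0 (g (-2))" "loc_inv A 2 g (-2)" "im (-3) (-1) (g (-3))" "loc_inv A 2 g (-3)" "I (-3) p'" "I (-3) q'"
  proof unfold_locales
    show "I 0 X \<in> zcar B 0 1" "I 0 Y \<in> zcar B 0 1" "I (-1) X' \<in> zcar B (-1) 0" "I (-1) Y' \<in> zcar B (-1) 0"
      "I (-2) P \<in> zcar B (-2) (-1)" "I (-2) Q \<in> zcar B (-2) (-1)" "I (-1) p \<in> zcar B (-1) 0" "I (-1) q \<in> zcar B (-1) 0"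
      "I (-2) x2 \<in> zcar B (-2) (-1)" "I (-2) y2 \<in> zcar B (-2) (-1)" "I (-2) c \<in> zcar B (-2) (-1)" "I (-2) e \<in> zcar B (-2) (-1)"
      "I (-3) p' \<in> zcar B (-3) (-2)" "I (-3) q' \<in> zcar B (-3) (-2)"
      using I_closed[of _ 0] I_closed[of _ "-1"] I_closed[of _ "-2"] I_closed[of _ "-3"] XY XY' PQ pq pq' x2 y2 by simp_all
    show "im (-1) 1 (g (-1)) \<in> zcar B (-1) 1" "loc_inv A 2 g (-1) \<in> zcar B 1 (-1)"
      "zmult B (-1) 1 (-1) (im (-1) 1 (g (-1))) (loc_inv A 2 g (-1)) = zone B (-1)"
      "zmult B 1 (-1) 1 (loc_inv A 2 g (-1)) (im (-1) 1 (g (-1))) = zone B 1"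
      using G[of "-1"] by simp_all
    show "im (-2) 0 (g (-2)) \<in> zcar B (-2) 0" "loc_inv A 2 g (-2) \<in> zcar B 0 (-2)"
      "zmult B (-2) 0 (-2) (im (-2) 0 (g (-2))) (loc_inv A 2 g (-2)) = zone B (-2)"
      "zmult B 0 (-2) 0 (loc_inv A 2 g (-2)) (im (-2) 0 (g (-2))) = zone B 0"
      using G[of "-2"] by simp_all
    show "im (-3) (-1) (g (-3)) \<in> zcar B (-3) (-1)" "loc_inv A 2 g (-3) \<in> zcar B (-1) (-3)"
      "zmult B (-1) (-3) (-1) (loc_inv A 2 g (-3)) (im (-3) (-1) (g (-3))) = zone B (-1)"
      using G[of "-3"] by simp_all
    have add: "im i (i + 2) (t i z z') \<otimes>\<^bsub>zgrp B i (i + 2)\<^esub> im i (i + 2) (t i u u') = im i (i + 2) (t i z z' \<otimes>\<^bsub>zgrp A i (i + 2)\<^esub> t i u u')"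
      if "z \<in> carrier F" "z' \<in> carrier F" "u \<in> carrier F" "u' \<in> carrier F" for i z z' u u'
      using im_add[OF t_closed t_closed] that by simp
    show "zmult B (-1) 0 1 (I (-1) X') (I 0 X) \<otimes>\<^bsub>zgrp B (-1) 1\<^esub> zmult B (-1) 0 1 (I (-1) Y') (I 0 Y) = \<one>\<^bsub>zgrp B (-1) 1\<^esub>"
      using I_mult[of _ _ "-1"] add[of X' X Y' Y "-1"] rel im_one XY XY' by simp
    show "im (-1) 1 (g (-1)) = zmult B (-1) 0 1 (I (-1) p) (I 0 X) \<otimes>\<^bsub>zgrp B (-1) 1\<^esub> zmult B (-1) 0 1 (I (-1) q) (I 0 Y)"
      using I_mult[of _ _ "-1"] add[of p X q Y "-1"] g1 XY pq by simp
    show "im (-3) (-1) (g (-3)) = zmult B (-3) (-2) (-1) (I (-3) p') (I (-2) P)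
        \<otimes>\<^bsub>zgrp B (-3) (-1)\<^esub> zmult B (-3) (-2) (-1) (I (-3) q') (I (-2) Q)"
      using I_mult[of _ _ "-3"] add[of p' P q' Q "-3"] g3 PQ pq' by simp
    have add_g: "im (-2) 0 (g (-2) \<otimes>\<^bsub>zgrp A (-2) 0\<^esub> t (-2) u u') = im (-2) 0 (g (-2)) \<otimes>\<^bsub>zgrp B (-2) 0\<^esub> im (-2) 0 (t (-2) u u')"
      if "u \<in> carrier F" "u' \<in> carrier F" for u u'
      using im_add[of "g (-2)" "-2" 0 "t (-2) u u'"] g_closed[of "-2"] t_closed[OF that, of "-2"] by simp
    note m = I_mult[of _ _ "-2", simplified]
    show "zmult B (-2) (-1) 0 (I (-2) x2) (I (-1) p) = im (-2) 0 (g (-2)) \<otimes>\<^bsub>zgrp B (-2) 0\<^esub> zmult B (-2) (-1) 0 (I (-2) c) (I (-1) X')"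
      "zmult B (-2) (-1) 0 (I (-2) x2) (I (-1) q) = zmult B (-2) (-1) 0 (I (-2) c) (I (-1) Y')"
      "zmult B (-2) (-1) 0 (I (-2) y2) (I (-1) p) = zmult B (-2) (-1) 0 (I (-2) e) (I (-1) X')"
      "zmult B (-2) (-1) 0 (I (-2) y2) (I (-1) q) = im (-2) 0 (g (-2)) \<otimes>\<^bsub>zgrp B (-2) 0\<^esub> zmult B (-2) (-1) 0 (I (-2) e) (I (-1) Y')"
      using x2 y2 XY' pq by (simp_all add: m add_g)
  qed
  have "I 0 X = im 0 1 (S 0 [x])" "I 0 Y = im 0 1 (S 0 [y])" "I (-1) X' = im (-1) 0 (S (-1) [lx])"
    "I (-1) Y' = im (-1) 0 (S (-1) [ly])" "I (-2) P = im (-2) (-1) (S (-2) [llx])" "I (-2) Q = im (-2) (-1) (S (-2) [lly])"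
    using XY XY' PQ by (simp_all add: I_def)
  then show ?thesis
    using presentation by (simp add: entry_def)
qed

end

theorem proposition10p20:
  fixes K0 K1 :: "'k ring"
    and V :: "('k, 'v) bimod"
    and W :: "int \<Rightarrow> ('k, 'v) bimod"
    and ev :: "int \<Rightarrow> 'v \<Rightarrow> 'v \<Rightarrow> 'k"
    and x y :: 'v
  assumes "field K0" and "field K1"
    and "\<one>\<^bsub>K0\<^esub> \<oplus>\<^bsub>K0\<^esub> \<one>\<^bsub>K0\<^esub> \<noteq> \<zero>\<^bsub>K0\<^esub>" and "\<one>\<^bsub>K1\<^esub> \<oplus>\<^bsub>K1\<^esub> \<one>\<^bsub>K1\<^esub> \<noteq> \<zero>\<^bsub>K1\<^esub>"
    and "rank_two_bimodule K0 K1 V"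
    and "dual_system K0 K1 V W ev"
    and "two_sided_basis K0 K1 V x y"
  shows "let K = alt K0 K1; A = nc_sym K W ev in
    (\<not> simple_bimodule K0 K1 V \<longrightarrow>
      (\<forall>\<theta> \<sigma> \<tau> \<eta> f u v. nonsimple_model K0 K1 V W ev \<theta> \<sigma> \<tau> \<eta> f u v \<longrightarrow>
        (let g = g_nonsimple K W ev u v;
             B = zloc A 1 g;
             Ag = zcar B 0 0;
             AgV = zmod B 0 1
         in lmodule_iso Ag AgV (zmod B 0 0) \<noteq> {} \<and>
            ((\<exists>c\<in>carrier K0. y = smult V c (v 0)) \<longrightarrow>
               freely_generated_by Ag AgV (loc_map A 1 g 0 1 (sym_pure K W ev 0 [y]))))))
    \<and> (simple_bimodule K0 K1 V \<longrightarrow>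
      (\<forall>(F :: 'f ring) \<iota>0 \<iota>1 \<sigma>0 \<sigma>1 w0 w1 f lx ly llx lly.
        simple_model K0 K1 V W ev F \<iota>0 \<iota>1 \<sigma>0 \<sigma>1 w0 w1 f \<longrightarrow>
        dual_bases K W ev (-1) lx ly x y \<longrightarrow>
        dual_bases K W ev (-2) llx lly lx ly \<longrightarrow>
        two_sided_basis K0 K1 (W (-2)) llx lly \<longrightarrow>
        (let g = g_simple K W ev F w0 w1 f;
             B = zloc A 2 g;
             Ag = zcar B 0 0;
             AgV = zmod B 0 1;
             Ag2 = module_sum (zmod B 0 0) (zmod B 0 0);
             im = (\<lambda>i s. loc_map A 2 g i (i + 1) (sym_pure K W ev i [s]));
             M = (\<lambda>s t. zmult B 0 (-2) 0 (loc_inv A 2 g (-2))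
                          (zmult B (-2) (-1) 0 (im (-2) s) (im (-1) t)))
         in is_presentation Ag Ag2 Ag2 AgV
              (\<lambda>(a, b).
                 (zmult B 0 0 0 a (M llx lx) \<otimes>\<^bsub>zgrp B 0 0\<^esub> zmult B 0 0 0 b (M lly lx),
                  zmult B 0 0 0 a (M llx ly) \<otimes>\<^bsub>zgrp B 0 0\<^esub> zmult B 0 0 0 b (M lly ly)))
              (\<lambda>(a, b).
                 zmult B 0 0 1 a (im 0 x) \<otimes>\<^bsub>zgrp B 0 1\<^esub> zmult B 0 0 1 b (im 0 y)))))"
proof (unfold Let_def, intro conjI impI allI)
  fix \<theta> \<sigma> \<tau> \<eta> f u v
  assume "nonsimple_model K0 K1 V W ev \<theta> \<sigma> \<tau> \<eta> f u v"
  then interpret nonsimple_model K0 K1 V W ev \<theta> \<sigma> \<tau> \<eta> f u v .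
  let ?g = "g_nonsimple (alt K0 K1) W ev u v"
  let ?B = "zloc (nc_sym (alt K0 K1) W ev) 1 ?g"
  show "lmodule_iso (zcar ?B 0 0) (zmod ?B 0 1) (zmod ?B 0 0) \<noteq> {}"
    by (rule freeness(1)[OF assms(1)])
  assume "\<exists>c\<in>carrier K0. y = smult V c (v 0)"
  then show "freely_generated_by (zcar ?B 0 0) (zmod ?B 0 1)
      (loc_map (nc_sym (alt K0 K1) W ev) 1 ?g 0 1 (sym_pure (alt K0 K1) W ev 0 [y]))"
    using freeness(2)[OF assms(1)] assms(7) unfolding two_sided_basis_def by blast
next
  fix F :: "'f ring" and \<iota>0 \<iota>1 \<sigma>0 \<sigma>1 w0 w1 f lx ly llx lly
  assume model: "simple_model K0 K1 V W ev F \<iota>0 \<iota>1 \<sigma>0 \<sigma>1 w0 w1 f"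
    and dual: "dual_bases (alt K0 K1) W ev (-1) lx ly x y"
    and basis: "two_sided_basis K0 K1 (W (-2)) llx lly"
  interpret simple_field_model K0 K1 V W ev F \<iota>0 \<iota>1 \<sigma>0 \<sigma>1 w0 w1 f
    using model assms(1-3) by (simp add: simple_field_model_def simple_field_model_axioms_def)
  have index: "(-2::int) + 1 = -1" "(-1::int) + 1 = 0" "(0::int) + 1 = 1"
    by simp_all
  let ?B = "zloc A 2 g"
  let ?im = "\<lambda>i s. loc_map A 2 g i (i + 1) (S i [s])"
  let ?M = "\<lambda>s t. zmult ?B 0 (-2) 0 (loc_inv A 2 g (-2)) (zmult ?B (-2) (-1) 0 (?im (-2) s) (?im (-1) t))"
  show "is_presentation (zcar ?B 0 0) (module_sum (zmod ?B 0 0) (zmod ?B 0 0)) (module_sum (zmod ?B 0 0) (zmod ?B 0 0))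
     (zmod ?B 0 1)
     (\<lambda>(a, b). (zmult ?B 0 0 0 a (?M llx lx) \<otimes>\<^bsub>zgrp ?B 0 0\<^esub> zmult ?B 0 0 0 b (?M lly lx),
        zmult ?B 0 0 0 a (?M llx ly) \<otimes>\<^bsub>zgrp ?B 0 0\<^esub> zmult ?B 0 0 0 b (?M lly ly)))
     (\<lambda>(a, b). zmult ?B 0 0 1 a (?im 0 x) \<otimes>\<^bsub>zgrp ?B 0 1\<^esub> zmult ?B 0 0 1 b (?im 0 y))"
    using presentation[OF assms(7) dual basis] unfolding index .
qed

end
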